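(* Let $K$ be a field and let $\mathbb G$ be a functor of monoids such that $\mathbb A_{\mathbb G}$ is reflexive. The category of dual functors of $\mathbb G$-modules is equivalent to the category of dual functors of $\mathbb A_{\mathbb G}^*$-modules. In particular, the category of quasi-coherent $\mathbb G$-modules is equivalent to the category of quasi-coherent $\mathbb A_{\mathbb G}^*$-modules.
   Context: All functors are covariant functors on the category of commutative (associative, unital) $K$-algebras. $\mathcal K(S)=S$. A functor of $\mathcal K$-modules is a functor $\mathbb M$ with functorial $S$-module structures on $\mathbb M(S)$; functors of $\mathcal K$-algebras analogously. For a $K$-module $M$, $\mathcal M(S):=M\otimes_KS$ is the quasi-coherent module associated with $M$. $\mathbb{H}om_{\mathcal K}(\mathbb M,\mathbb M')(S):=\operatorname{Hom}_{\mathcal S}(\mathbb M_{|S},\mathbb M'_{|S})$ where $|S$ denotes restriction to commutative $S$-algebras, and $\mathbb M^*:=\mathbb{H}om_{\mathcal K}(\mathbb M,\mathcal K)$. A dual functor is a functor of $\mathcal K$-modules of the form $\mathbb N^*$ (up to isomorphism); $\mathbb M$ is reflexive if the canonical morphism $\mathbb M\to\mathbb M^{**}$ is an isomorphism; quasi-coherent modules are reflexive. For a functor of sets $\mathbb X$, $\mathbb A_{\mathbb X}(S):=\operatorname{Hom}(\mathbb X_{|S},\mathcal K_{|S})$. There is a natural morphism $\mathbb G\to\mathbb A_{\mathbb G}^*$, $g\mapsto(f\mapsto f(g))$, and $\mathbb A_{\mathbb G}^*$ is endowed with the unique structure of functor of $\mathcal K$-algebras for which this is a morphism of functors of monoids (explicitly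 $(w\cdot w')(f)=w\big(g\mapsto w'(h\mapsto f(gh))\big)$). A functor of $\mathbb G$-modules is a functor of $\mathcal K$-modules $\mathbb M$ with a morphism of functors of monoids $\mathbb G\to\mathbb{E}nd_{\mathcal K}(\mathbb M)$; a functor of $\mathbb A_{\mathbb G}^*$-modules is a functor of $\mathcal K$-modules $\mathbb M$ with a morphism of functors of $\mathcal K$-algebras $\mathbb A_{\mathbb G}^*\to\mathbb{E}nd_{\mathcal K}(\mathbb M)$. "Dual functor of $\mathbb G$-modules" (resp. of $\mathbb A^*_{\mathbb G}$-modules) means a $\mathbb G$-module (resp. $\mathbb A_{\mathbb G}^*$-module) whose underlying functor of $\mathcal K$-modules is a dual functor; similarly for quasi-coherent. Morphisms are the $\mathcal K$-linear morphisms of functors compatible with the actions. The equivalence is compatible with restriction of the action along $\mathbb G\to\mathbb A_{\mathbb G}^*$. *)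

theory Defs
  imports "HOL-Algebra.Module" "HOL-Algebra.Free_Abelian_Groups"
begin

section \<open>Commutative algebras and functors on them\<close>

text \<open>
  The type \<open>'u\<close> plays the role of the universe: \<open>K\<close>, all commutative \<open>K\<close>-algebras and all
  \<open>K\<close>-modules defining quasi-coherent modules have their carriers inside \<open>'u\<close>.  Functors may take
  values in arbitrary types.  An infinite \<open>'u\<close> is closed, up to isomorphism, under polynomial rings
  over its algebras in as many variables as a \<open>K\<close>-module of the universe has elements; this is the
  only size condition needed for quasi-coherent modules to be reflexive.  All maps are taken extensional (\<open>undefined\<close> off their domain), so
  that equality of maps and of natural transformations is equality in HOL.
\<close>

type_synonym 'u alg = "('u, 'u) module"

definition alg_hom :: "'u ring \<Rightarrow> 'u alg \<Rightarrow> 'u alg \<Rightarrow> ('u \<Rightarrow> 'u) set" where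
  "alg_hom K S T = {p \<in> ring_hom S T \<inter> extensional (carrier S).
     \<forall>k\<in>carrier K. \<forall>s\<in>carrier S. p (k \<odot>\<^bsub>S\<^esub> s) = k \<odot>\<^bsub>T\<^esub> p s}"

text \<open>\<open>val F S\<close> is the structure \<open>F(S)\<close> (a set, monoid, module, ... as a HOL-Algebra record) and
  \<open>tr F S T p\<close> is the map \<open>F(S) \<rightarrow> F(T)\<close> induced by \<open>p : S \<rightarrow> T\<close>.\<close>

record ('u, 's, 'x) kfunctor =
  val :: "'u alg \<Rightarrow> 's"
  tr :: "'u alg \<Rightarrow> 'u alg \<Rightarrow> ('u \<Rightarrow> 'u) \<Rightarrow> 'x \<Rightarrow> 'x"

type_synonym ('u, 'g) monfunctor = "('u, 'g monoid, 'g) kfunctor"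
type_synonym ('u, 'm) modfunctor = "('u, ('u, 'm) module, 'm) kfunctor"

definition set_functor ::
    "'u ring \<Rightarrow> ('u, ('x, 's) partial_object_scheme, 'x) kfunctor \<Rightarrow> bool" where
  "set_functor K F \<longleftrightarrow>
     (\<forall>S T p. algebra K S \<longrightarrow> algebra K T \<longrightarrow> p \<in> alg_hom K S T \<longrightarrow>
        tr F S T p \<in> carrier (val F S) \<rightarrow> carrier (val F T)) \<and>
     (\<forall>S. algebra K S \<longrightarrow> (\<forall>x\<in>carrier (val F S). tr F S S (\<lambda>s\<in>carrier S. s) x = x)) \<and>
     (\<forall>S T U p q. algebra K S \<longrightarrow> algebra K T \<longrightarrow> algebra K U \<longrightarrow>
        p \<in> alg_hom K S T \<longrightarrow> q \<in> alg_hom K T U \<longrightarrow>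
        (\<forall>x\<in>carrier (val F S).
           tr F S U (compose (carrier S) q p) x = tr F T U q (tr F S T p x)))"

definition monoid_functor :: "'u ring \<Rightarrow> ('u, 'g) monfunctor \<Rightarrow> bool" where
  "monoid_functor K G \<longleftrightarrow> set_functor K G \<and>
     (\<forall>S. algebra K S \<longrightarrow> monoid (val G S)) \<and>
     (\<forall>S T p. algebra K S \<longrightarrow> algebra K T \<longrightarrow> p \<in> alg_hom K S T \<longrightarrow>
        tr G S T p \<in> hom (val G S) (val G T) \<and> tr G S T p \<one>\<^bsub>val G S\<^esub> = \<one>\<^bsub>val G T\<^esub>)"

definition mod_functor :: "'u ring \<Rightarrow> ('u, 'm) modfunctor \<Rightarrow> bool" where
  "mod_functor K M \<longleftrightarrow> set_functor K M \<and>
     (\<forall>S. algebra K S \<longrightarrow> module S (val M S)) \<and>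
     (\<forall>S T p. algebra K S \<longrightarrow> algebra K T \<longrightarrow> p \<in> alg_hom K S T \<longrightarrow>
        (\<forall>x\<in>carrier (val M S). \<forall>y\<in>carrier (val M S).
           tr M S T p (x \<oplus>\<^bsub>val M S\<^esub> y) = tr M S T p x \<oplus>\<^bsub>val M T\<^esub> tr M S T p y) \<and>
        (\<forall>s\<in>carrier S. \<forall>x\<in>carrier (val M S).
           tr M S T p (s \<odot>\<^bsub>val M S\<^esub> x) = p s \<odot>\<^bsub>val M T\<^esub> tr M S T p x))"

definition base_functor :: "('u, 'u) modfunctor" where
  "base_functor = \<lparr>val = (\<lambda>S. S\<lparr>smult := (\<lambda>x y. x \<otimes>\<^bsub>S\<^esub> y)\<rparr>), tr = (\<lambda>S T p. p)\<rparr>"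


section \<open>Morphisms over \<open>K\<close>\<close>

definition linear_maps :: "'u alg \<Rightarrow> ('u, 'm) module \<Rightarrow> ('u, 'n) module \<Rightarrow> ('m \<Rightarrow> 'n) set" where
  "linear_maps S M N = {h \<in> carrier M \<rightarrow>\<^sub>E carrier N.
     (\<forall>x\<in>carrier M. \<forall>y\<in>carrier M. h (x \<oplus>\<^bsub>M\<^esub> y) = h x \<oplus>\<^bsub>N\<^esub> h y) \<and>
     (\<forall>s\<in>carrier S. \<forall>x\<in>carrier M. h (s \<odot>\<^bsub>M\<^esub> x) = s \<odot>\<^bsub>N\<^esub> h x)}"

definition set_mor :: "'u ring \<Rightarrow> ('u, ('x, 's) partial_object_scheme, 'x) kfunctor \<Rightarrow>
    ('u, ('y, 't) partial_object_scheme, 'y) kfunctor \<Rightarrow> ('u alg \<Rightarrow> 'x \<Rightarrow> 'y) set" where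
  "set_mor K X Y = {\<alpha>.
     (\<forall>S. algebra K S \<longrightarrow> \<alpha> S \<in> carrier (val X S) \<rightarrow>\<^sub>E carrier (val Y S)) \<and>
     (\<forall>S. \<not> algebra K S \<longrightarrow> \<alpha> S = undefined) \<and>
     (\<forall>S T p. algebra K S \<longrightarrow> algebra K T \<longrightarrow> p \<in> alg_hom K S T \<longrightarrow>
        (\<forall>x\<in>carrier (val X S). \<alpha> T (tr X S T p x) = tr Y S T p (\<alpha> S x)))}"

definition monoid_mor :: "'u ring \<Rightarrow> ('u, ('x, 's) monoid_scheme, 'x) kfunctor \<Rightarrow>
    ('u, ('y, 't) monoid_scheme, 'y) kfunctor \<Rightarrow> ('u alg \<Rightarrow> 'x \<Rightarrow> 'y) set" where
  "monoid_mor K X Y = {\<alpha> \<in> set_mor K X Y. \<forall>S. algebra K S \<longrightarrow>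
     \<alpha> S \<in> hom (val X S) (val Y S) \<and> \<alpha> S \<one>\<^bsub>val X S\<^esub> = \<one>\<^bsub>val Y S\<^esub>}"

definition mod_mor ::
    "'u ring \<Rightarrow> ('u, 'm) modfunctor \<Rightarrow> ('u, 'n) modfunctor \<Rightarrow> ('u alg \<Rightarrow> 'm \<Rightarrow> 'n) set" where
  "mod_mor K M N = {\<alpha> \<in> set_mor K M N. \<forall>S. algebra K S \<longrightarrow> \<alpha> S \<in> linear_maps S (val M S) (val N S)}"

definition mod_iso ::
    "'u ring \<Rightarrow> ('u, 'm) modfunctor \<Rightarrow> ('u, 'n) modfunctor \<Rightarrow> ('u alg \<Rightarrow> 'm \<Rightarrow> 'n) set" where
  "mod_iso K M N = {\<alpha> \<in> mod_mor K M N. \<forall>S. algebra K S \<longrightarrow>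
     bij_betw (\<alpha> S) (carrier (val M S)) (carrier (val N S))}"

definition alg_mor ::
    "'u ring \<Rightarrow> ('u, 'm) modfunctor \<Rightarrow> ('u, 'n) modfunctor \<Rightarrow> ('u alg \<Rightarrow> 'm \<Rightarrow> 'n) set" where
  "alg_mor K A B = mod_mor K A B \<inter> monoid_mor K A B"


section \<open>Restriction to \<open>S\<close>-algebras and internal Hom\<close>

text \<open>
  A commutative \<open>S\<close>-algebra is a commutative \<open>K\<close>-algebra \<open>T\<close> with a \<open>K\<close>-algebra morphism
  \<open>p : S \<rightarrow> T\<close>.  A morphism between restrictions to \<open>S\<close>-algebras is thus a family
  \<open>\<alpha> T p\<close> indexed by such pairs, natural in \<open>(T, p)\<close>: a morphism \<open>(T, p) \<rightarrow> (U, p')\<close> is a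
  \<open>q : T \<rightarrow> U\<close> with \<open>q \<circ> p = p'\<close>.
\<close>

type_synonym ('u, 'x, 'y) family = "'u alg \<Rightarrow> ('u \<Rightarrow> 'u) \<Rightarrow> 'x \<Rightarrow> 'y"

definition fam :: "'u ring \<Rightarrow> 'u alg \<Rightarrow> ('u, 'x, 'y) family \<Rightarrow> ('u, 'x, 'y) family" where
  "fam K S \<alpha> = (\<lambda>T p. if algebra K T \<and> p \<in> alg_hom K S T then \<alpha> T p else undefined)"

definition set_mor_over ::
    "'u ring \<Rightarrow> 'u alg \<Rightarrow> ('u, ('x, 's) partial_object_scheme, 'x) kfunctor \<Rightarrow>
     ('u, ('y, 't) partial_object_scheme, 'y) kfunctor \<Rightarrow> ('u, 'x, 'y) family set" where
  "set_mor_over K S X Y = {\<alpha>. fam K S \<alpha> = \<alpha> \<and>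
     (\<forall>T p. algebra K T \<longrightarrow> p \<in> alg_hom K S T \<longrightarrow>
        \<alpha> T p \<in> carrier (val X T) \<rightarrow>\<^sub>E carrier (val Y T)) \<and>
     (\<forall>T U p q. algebra K T \<longrightarrow> algebra K U \<longrightarrow> p \<in> alg_hom K S T \<longrightarrow> q \<in> alg_hom K T U \<longrightarrow>
        (\<forall>x\<in>carrier (val X T).
           \<alpha> U (compose (carrier S) q p) (tr X T U q x) = tr Y T U q (\<alpha> T p x)))}"

definition mod_mor_over ::
    "'u ring \<Rightarrow> 'u alg \<Rightarrow> ('u, 'm) modfunctor \<Rightarrow> ('u, 'n) modfunctor \<Rightarrow> ('u, 'm, 'n) family set" where
  "mod_mor_over K S M N = {\<alpha> \<in> set_mor_over K S M N.
     \<forall>T p. algebra K T \<longrightarrow> p \<in> alg_hom K S T \<longrightarrow> \<alpha> T p \<in> linear_maps T (val M T) (val N T)}"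

text \<open>The map from \<open>S\<close>-families to \<open>S'\<close>-families induced by \<open>r : S \<rightarrow> S'\<close>.\<close>

definition fam_restrict ::
    "'u ring \<Rightarrow> 'u alg \<Rightarrow> 'u alg \<Rightarrow> ('u \<Rightarrow> 'u) \<Rightarrow> ('u, 'x, 'y) family \<Rightarrow> ('u, 'x, 'y) family" where
  "fam_restrict K S S' r \<alpha> = fam K S' (\<lambda>T p. \<alpha> T (compose (carrier S) p r))"

text \<open>The multiplication and unit fields of the records are meaningless for a mere module; they
  are filled in for the functors of algebras below.\<close>

definition hom_functor ::
    "'u ring \<Rightarrow> ('u, 'm) modfunctor \<Rightarrow> ('u, 'n) modfunctor \<Rightarrow> ('u, ('u, 'm, 'n) family) modfunctor" where
  "hom_functor K M N =
     \<lparr>val = (\<lambda>S.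
        \<lparr>carrier = mod_mor_over K S M N,
         monoid.mult = undefined,
         one = undefined,
         ring.zero = fam K S (\<lambda>T p. \<lambda>x\<in>carrier (val M T). \<zero>\<^bsub>val N T\<^esub>),
         ring.add = (\<lambda>\<alpha> \<beta>. fam K S (\<lambda>T p. \<lambda>x\<in>carrier (val M T). \<alpha> T p x \<oplus>\<^bsub>val N T\<^esub> \<beta> T p x)),
         smult = (\<lambda>s \<alpha>. fam K S (\<lambda>T p. \<lambda>x\<in>carrier (val M T). p s \<odot>\<^bsub>val N T\<^esub> \<alpha> T p x))\<rparr>),
      tr = fam_restrict K\<rparr>"

definition end_functor ::
    "'u ring \<Rightarrow> ('u, 'm) modfunctor \<Rightarrow> ('u, ('u, 'm, 'm) family) modfunctor" where
  "end_functor K M =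
     \<lparr>val = (\<lambda>S. (val (hom_functor K M M) S)
        \<lparr>monoid.mult := (\<lambda>\<alpha> \<beta>. fam K S (\<lambda>T p. compose (carrier (val M T)) (\<alpha> T p) (\<beta> T p))),
         one := fam K S (\<lambda>T p. \<lambda>x\<in>carrier (val M T). x)\<rparr>),
      tr = fam_restrict K\<rparr>"

abbreviation dual ::
    "'u ring \<Rightarrow> ('u, 'm) modfunctor \<Rightarrow> ('u, ('u, 'm, 'u) family) modfunctor" where
  "dual K M \<equiv> hom_functor K M base_functor"

definition bidual_map ::
    "'u ring \<Rightarrow> ('u, 'm) modfunctor \<Rightarrow> 'u alg \<Rightarrow> 'm \<Rightarrow> ('u, ('u, 'm, 'u) family, 'u) family" where
  "bidual_map K M = (\<lambda>S. if algebra K S then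
     (\<lambda>x\<in>carrier (val M S). fam K S (\<lambda>T p. \<lambda>w\<in>carrier (val (dual K M) T).
        w T (\<lambda>t\<in>carrier T. t) (tr M S T p x)))
     else undefined)"

definition reflexive :: "'u ring \<Rightarrow> ('u, 'm) modfunctor \<Rightarrow> bool" where
  "reflexive K M \<longleftrightarrow> bidual_map K M \<in> mod_iso K M (dual K (dual K M))"

text \<open>HOL cannot quantify over types inside a formula, hence the type argument recording where the
  predual takes its values.\<close>

definition dual_functor :: "'n itself \<Rightarrow> 'u ring \<Rightarrow> ('u, 'm) modfunctor \<Rightarrow> bool" where
  "dual_functor _ K M \<longleftrightarrow> mod_functor K M \<and>
     (\<exists>N :: ('u, 'n) modfunctor. mod_functor K N \<and> mod_iso K M (dual K N) \<noteq> {})"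


section \<open>Quasi-coherent modules\<close>

text \<open>\<open>M \<otimes>\<^sub>K S\<close> is the quotient of the free abelian group on \<open>M \<times> S\<close> by the subgroup generated by
  the bilinearity relations; its elements are cosets.\<close>

definition tensor_group :: "('u, 'v) module \<Rightarrow> 'u alg \<Rightarrow> (('v \<times> 'u) \<Rightarrow>\<^sub>0 int) monoid" where
  "tensor_group M S = free_Abelian_group (carrier M \<times> carrier S)"

definition tensor_relations :: "'u ring \<Rightarrow> ('u, 'v) module \<Rightarrow> 'u alg \<Rightarrow> (('v \<times> 'u) \<Rightarrow>\<^sub>0 int) set" where
  "tensor_relations K M S = generate (tensor_group M S)
     ({frag_of (x \<oplus>\<^bsub>M\<^esub> y, s) - frag_of (x, s) - frag_of (y, s) | x y s.
         x \<in> carrier M \<and> y \<in> carrier M \<and> s \<in> carrier S} \<union>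
      {frag_of (x, s \<oplus>\<^bsub>S\<^esub> t) - frag_of (x, s) - frag_of (x, t) | x s t.
         x \<in> carrier M \<and> s \<in> carrier S \<and> t \<in> carrier S} \<union>
      {frag_of (k \<odot>\<^bsub>M\<^esub> x, s) - frag_of (x, k \<odot>\<^bsub>S\<^esub> s) | k x s.
         k \<in> carrier K \<and> x \<in> carrier M \<and> s \<in> carrier S})"

text \<open>The map \<open>M \<otimes> S \<rightarrow> M \<otimes> T\<close> induced by an additive, \<open>K\<close>-linear \<open>f : S \<rightarrow> T\<close>,
  i.e. \<open>m \<otimes> s \<mapsto> m \<otimes> f s\<close>; on cosets it does not depend on the representative \<open>z\<close>.\<close>

definition tensor_map ::
    "'u ring \<Rightarrow> ('u, 'v) module \<Rightarrow> 'u alg \<Rightarrow> ('u \<Rightarrow> 'u) \<Rightarrow>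
     (('v \<times> 'u) \<Rightarrow>\<^sub>0 int) set \<Rightarrow> (('v \<times> 'u) \<Rightarrow>\<^sub>0 int) set" where
  "tensor_map K M T f C = (\<Union>z\<in>C. tensor_relations K M T
     #>\<^bsub>tensor_group M T\<^esub> frag_extend (\<lambda>(m, s). frag_of (m, f s)) z)"

definition quasi_coherent_module ::
    "'u ring \<Rightarrow> ('u, 'v) module \<Rightarrow> ('u, (('v \<times> 'u) \<Rightarrow>\<^sub>0 int) set) modfunctor" where
  "quasi_coherent_module K M =
     \<lparr>val = (\<lambda>S. let Q = tensor_group M S Mod tensor_relations K M S in
        \<lparr>carrier = carrier Q,
         monoid.mult = undefined,
         one = undefined,
         ring.zero = \<one>\<^bsub>Q\<^esub>,
         ring.add = (\<lambda>x y. x \<otimes>\<^bsub>Q\<^esub> y),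
         smult = (\<lambda>s. tensor_map K M S (\<lambda>t. s \<otimes>\<^bsub>S\<^esub> t))\<rparr>),
      tr = (\<lambda>S T p. tensor_map K M T p)\<rparr>"

definition quasi_coherent :: "'u ring \<Rightarrow> ('u, 'm) modfunctor \<Rightarrow> bool" where
  "quasi_coherent K M \<longleftrightarrow> mod_functor K M \<and>
     (\<exists>V :: ('u, 'u) module. module K V \<and> mod_iso K M (quasi_coherent_module K V) \<noteq> {})"


section \<open>The functor of functions and its dual algebra\<close>

definition fun_functor ::
    "'u ring \<Rightarrow> ('u, ('x, 's) partial_object_scheme, 'x) kfunctor \<Rightarrow>
     ('u, ('u, 'x, 'u) family) modfunctor" where
  "fun_functor K X =
     \<lparr>val = (\<lambda>S.
        \<lparr>carrier = set_mor_over K S X base_functor,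
         monoid.mult = (\<lambda>f g. fam K S (\<lambda>T p. \<lambda>x\<in>carrier (val X T). f T p x \<otimes>\<^bsub>T\<^esub> g T p x)),
         one = fam K S (\<lambda>T p. \<lambda>x\<in>carrier (val X T). \<one>\<^bsub>T\<^esub>),
         ring.zero = fam K S (\<lambda>T p. \<lambda>x\<in>carrier (val X T). \<zero>\<^bsub>T\<^esub>),
         ring.add = (\<lambda>f g. fam K S (\<lambda>T p. \<lambda>x\<in>carrier (val X T). f T p x \<oplus>\<^bsub>T\<^esub> g T p x)),
         smult = (\<lambda>s f. fam K S (\<lambda>T p. \<lambda>x\<in>carrier (val X T). p s \<otimes>\<^bsub>T\<^esub> f T p x))\<rparr>),
      tr = fam_restrict K\<rparr>"

text \<open>The morphism from \<open>X\<close> to the dual of its functor of functions, \<open>x \<mapsto> (f \<mapsto> f(x))\<close>.\<close>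

definition eval_map ::
    "'u ring \<Rightarrow> ('u, ('x, 's) partial_object_scheme, 'x) kfunctor \<Rightarrow>
     'u alg \<Rightarrow> 'x \<Rightarrow> ('u, ('u, 'x, 'u) family, 'u) family" where
  "eval_map K X = (\<lambda>S. if algebra K S then
     (\<lambda>x\<in>carrier (val X S). fam K S (\<lambda>T p. \<lambda>f\<in>carrier (val (fun_functor K X) T).
        f T (\<lambda>t\<in>carrier T. t) (tr X S T p x)))
     else undefined)"

text \<open>\<open>(w \<cdot> w')(f) = w(g \<mapsto> w'(h \<mapsto> f(g h)))\<close>.  For \<open>f\<close> over \<open>T\<close>, the argument \<open>g\<close> runs over
  points with values in \<open>T\<close>-algebras \<open>q : T \<rightarrow> U\<close>, and then \<open>h\<close> over points with values in
  \<open>U\<close>-algebras \<open>r : U \<rightarrow> V\<close>.\<close>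

definition convolution ::
    "'u ring \<Rightarrow> ('u, 'g) monfunctor \<Rightarrow> 'u alg \<Rightarrow> ('u, ('u, 'g, 'u) family, 'u) family \<Rightarrow>
     ('u, ('u, 'g, 'u) family, 'u) family \<Rightarrow> ('u, ('u, 'g, 'u) family, 'u) family" where
  "convolution K G S w w' =
     fam K S (\<lambda>T p. \<lambda>f\<in>carrier (val (fun_functor K G) T).
       w T p (fam K T (\<lambda>U q. \<lambda>g\<in>carrier (val G U).
         w' U (compose (carrier S) q p) (fam K U (\<lambda>V r. \<lambda>h\<in>carrier (val G V).
           f V (compose (carrier T) r q) (tr G U V r g \<otimes>\<^bsub>val G V\<^esub> h))))))"

definition dist_algebra ::
    "'u ring \<Rightarrow> ('u, 'g) monfunctor \<Rightarrow> ('u, ('u, ('u, 'g, 'u) family, 'u) family) modfunctor" where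
  "dist_algebra K G =
     \<lparr>val = (\<lambda>S. (val (dual K (fun_functor K G)) S)
        \<lparr>monoid.mult := convolution K G S, one := eval_map K G S \<one>\<^bsub>val G S\<^esub>\<rparr>),
      tr = fam_restrict K\<rparr>"


section \<open>Modules over functors of monoids and of algebras\<close>

text \<open>A module is a pair \<open>(M, \<rho>)\<close> of a functor of modules and an action morphism into its
  endomorphisms.\<close>

type_synonym ('u, 'h, 'm) rep = "('u, 'm) modfunctor \<times> ('u alg \<Rightarrow> 'h \<Rightarrow> ('u, 'm, 'm) family)"

definition monoid_reps :: "'u ring \<Rightarrow> ('u, 'g) monfunctor \<Rightarrow> ('u, 'g, 'm) rep set" where
  "monoid_reps K G = {(M, \<rho>). mod_functor K M \<and> \<rho> \<in> monoid_mor K G (end_functor K M)}"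

definition algebra_reps :: "'u ring \<Rightarrow> ('u, 'a) modfunctor \<Rightarrow> ('u, 'a, 'm) rep set" where
  "algebra_reps K A = {(M, \<rho>). mod_functor K M \<and> \<rho> \<in> alg_mor K A (end_functor K M)}"

definition rep_mor ::
    "'u ring \<Rightarrow> ('u, ('h, 's) partial_object_scheme, 'h) kfunctor \<Rightarrow>
     ('u, 'h, 'm) rep \<Rightarrow> ('u, 'h, 'm) rep \<Rightarrow> ('u alg \<Rightarrow> 'm \<Rightarrow> 'm) set" where
  "rep_mor K H X Y = {\<alpha> \<in> mod_mor K (fst X) (fst Y).
     \<forall>S T p. algebra K S \<longrightarrow> algebra K T \<longrightarrow> p \<in> alg_hom K S T \<longrightarrow>
       (\<forall>h\<in>carrier (val H S). \<forall>x\<in>carrier (val (fst X) T).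
          \<alpha> T (snd X S h T p x) = snd Y S h T p (\<alpha> T x))}"


section \<open>Categories and equivalences\<close>

record ('o, 'a) cat =
  Ob :: "'o set"
  Hom :: "'o \<Rightarrow> 'o \<Rightarrow> 'a set"
  Idt :: "'o \<Rightarrow> 'a"
  Cmp :: "'o \<Rightarrow> 'o \<Rightarrow> 'o \<Rightarrow> 'a \<Rightarrow> 'a \<Rightarrow> 'a"  \<comment> \<open>\<open>Cmp C X Y Z g f = g \<circ> f\<close> for \<open>f : X \<rightarrow> Y\<close>, \<open>g : Y \<rightarrow> Z\<close>\<close>

definition is_category :: "('o, 'a) cat \<Rightarrow> bool" where
  "is_category C \<longleftrightarrow>
     (\<forall>X\<in>Ob C. Idt C X \<in> Hom C X X) \<and>
     (\<forall>X\<in>Ob C. \<forall>Y\<in>Ob C. \<forall>Z\<in>Ob C. \<forall>f\<in>Hom C X Y. \<forall>g\<in>Hom C Y Z. Cmp C X Y Z g f \<in> Hom C X Z) \<and>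
     (\<forall>X\<in>Ob C. \<forall>Y\<in>Ob C. \<forall>f\<in>Hom C X Y.
        Cmp C X X Y f (Idt C X) = f \<and> Cmp C X Y Y (Idt C Y) f = f) \<and>
     (\<forall>W\<in>Ob C. \<forall>X\<in>Ob C. \<forall>Y\<in>Ob C. \<forall>Z\<in>Ob C. \<forall>f\<in>Hom C W X. \<forall>g\<in>Hom C X Y. \<forall>h\<in>Hom C Y Z.
        Cmp C W X Z (Cmp C X Y Z h g) f = Cmp C W Y Z h (Cmp C W X Y g f))"

record ('o, 'a, 'p, 'b) cfunctor =
  on_ob :: "'o \<Rightarrow> 'p"
  on_mor :: "'o \<Rightarrow> 'o \<Rightarrow> 'a \<Rightarrow> 'b"

definition is_cfunctor ::
    "('o, 'a) cat \<Rightarrow> ('p, 'b) cat \<Rightarrow> ('o, 'a, 'p, 'b) cfunctor \<Rightarrow> bool" where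
  "is_cfunctor C D F \<longleftrightarrow> is_category C \<and> is_category D \<and>
     (\<forall>X\<in>Ob C. on_ob F X \<in> Ob D \<and> on_mor F X X (Idt C X) = Idt D (on_ob F X)) \<and>
     (\<forall>X\<in>Ob C. \<forall>Y\<in>Ob C. \<forall>f\<in>Hom C X Y. on_mor F X Y f \<in> Hom D (on_ob F X) (on_ob F Y)) \<and>
     (\<forall>X\<in>Ob C. \<forall>Y\<in>Ob C. \<forall>Z\<in>Ob C. \<forall>f\<in>Hom C X Y. \<forall>g\<in>Hom C Y Z.
        on_mor F X Z (Cmp C X Y Z g f) =
        Cmp D (on_ob F X) (on_ob F Y) (on_ob F Z) (on_mor F Y Z g) (on_mor F X Y f))"

definition id_cfunctor :: "('o, 'a, 'o, 'a) cfunctor" where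
  "id_cfunctor = \<lparr>on_ob = (\<lambda>X. X), on_mor = (\<lambda>X Y f. f)\<rparr>"

definition comp_cfunctor ::
    "('p, 'b, 'q, 'c) cfunctor \<Rightarrow> ('o, 'a, 'p, 'b) cfunctor \<Rightarrow> ('o, 'a, 'q, 'c) cfunctor" where
  "comp_cfunctor G F = \<lparr>on_ob = (\<lambda>X. on_ob G (on_ob F X)),
     on_mor = (\<lambda>X Y f. on_mor G (on_ob F X) (on_ob F Y) (on_mor F X Y f))\<rparr>"

definition naturally_isomorphic ::
    "('o, 'a) cat \<Rightarrow> ('p, 'b) cat \<Rightarrow> ('o, 'a, 'p, 'b) cfunctor \<Rightarrow> ('o, 'a, 'p, 'b) cfunctor \<Rightarrow> bool" where
  "naturally_isomorphic C D F G \<longleftrightarrow> (\<exists>\<eta> \<theta>.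
     (\<forall>X\<in>Ob C. \<eta> X \<in> Hom D (on_ob F X) (on_ob G X) \<and> \<theta> X \<in> Hom D (on_ob G X) (on_ob F X) \<and>
        Cmp D (on_ob F X) (on_ob G X) (on_ob F X) (\<theta> X) (\<eta> X) = Idt D (on_ob F X) \<and>
        Cmp D (on_ob G X) (on_ob F X) (on_ob G X) (\<eta> X) (\<theta> X) = Idt D (on_ob G X)) \<and>
     (\<forall>X\<in>Ob C. \<forall>Y\<in>Ob C. \<forall>f\<in>Hom C X Y.
        Cmp D (on_ob F X) (on_ob F Y) (on_ob G Y) (\<eta> Y) (on_mor F X Y f) =
        Cmp D (on_ob F X) (on_ob G X) (on_ob G Y) (on_mor G X Y f) (\<eta> X)))"

definition is_equivalence ::
    "('o, 'a) cat \<Rightarrow> ('p, 'b) cat \<Rightarrow> ('o, 'a, 'p, 'b) cfunctor \<Rightarrow> bool" where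
  "is_equivalence C D F \<longleftrightarrow> is_cfunctor C D F \<and> (\<exists>G. is_cfunctor D C G \<and>
     naturally_isomorphic C C (comp_cfunctor G F) id_cfunctor \<and>
     naturally_isomorphic D D (comp_cfunctor F G) id_cfunctor)"


section \<open>Categories of modules\<close>

definition rep_category ::
    "'u ring \<Rightarrow> ('u, ('h, 's) partial_object_scheme, 'h) kfunctor \<Rightarrow> ('u, 'h, 'm) rep set \<Rightarrow>
     (('u, 'h, 'm) rep, 'u alg \<Rightarrow> 'm \<Rightarrow> 'm) cat" where
  "rep_category K H reps =
     \<lparr>Ob = reps,
      Hom = rep_mor K H,
      Idt = (\<lambda>X S. if algebra K S then (\<lambda>x\<in>carrier (val (fst X) S). x) else undefined),
      Cmp = (\<lambda>X Y Z \<beta> \<alpha> S.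
        if algebra K S then compose (carrier (val (fst X) S)) (\<beta> S) (\<alpha> S) else undefined)\<rparr>"

definition dual_G_modules ::
    "'n itself \<Rightarrow> 'u ring \<Rightarrow> ('u, 'g) monfunctor \<Rightarrow> (('u, 'g, 'm) rep, 'u alg \<Rightarrow> 'm \<Rightarrow> 'm) cat" where
  "dual_G_modules n K G =
     rep_category K G {X \<in> monoid_reps K G. dual_functor n K (fst X)}"

definition dual_A_modules ::
    "'n itself \<Rightarrow> 'u ring \<Rightarrow> ('u, 'a) modfunctor \<Rightarrow> (('u, 'a, 'm) rep, 'u alg \<Rightarrow> 'm \<Rightarrow> 'm) cat" where
  "dual_A_modules n K A =
     rep_category K A {X \<in> algebra_reps K A. dual_functor n K (fst X)}"

definition quasi_coherent_G_modules ::
    "'u ring \<Rightarrow> ('u, 'g) monfunctor \<Rightarrow> (('u, 'g, 'm) rep, 'u alg \<Rightarrow> 'm \<Rightarrow> 'm) cat" where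
  "quasi_coherent_G_modules K G =
     rep_category K G {X \<in> monoid_reps K G. quasi_coherent K (fst X)}"

definition quasi_coherent_A_modules ::
    "'u ring \<Rightarrow> ('u, 'a) modfunctor \<Rightarrow> (('u, 'a, 'm) rep, 'u alg \<Rightarrow> 'm \<Rightarrow> 'm) cat" where
  "quasi_coherent_A_modules K A =
     rep_category K A {X \<in> algebra_reps K A. quasi_coherent K (fst X)}"

text \<open>Restriction of the action along \<^const>\<open>eval_map\<close>; it is the identity on morphisms.\<close>

definition restriction_functor ::
    "'u ring \<Rightarrow> ('u, 'g) monfunctor \<Rightarrow>
     (('u, ('u, ('u, 'g, 'u) family, 'u) family, 'm) rep, 'u alg \<Rightarrow> 'm \<Rightarrow> 'm,
      ('u, 'g, 'm) rep, 'u alg \<Rightarrow> 'm \<Rightarrow> 'm) cfunctor" where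
  "restriction_functor K G =
     \<lparr>on_ob = (\<lambda>(M, \<rho>). (M, \<lambda>S. if algebra K S
         then compose (carrier (val G S)) (\<rho> S) (eval_map K G S) else undefined)),
      on_mor = (\<lambda>X Y \<alpha>. \<alpha>)\<rparr>"

end

theory Submission
  imports Defs
begin

text \<open>If \<open>M = N\<^sup>*\<close> is a dual functor, maps of functors of sets \<open>X \<rightarrow> M\<close> are the same as linear maps
  \<open>N \<rightarrow> \<A>\<^sub>X\<close>, and linear maps \<open>\<A>\<^sub>X\<^sup>* \<rightarrow> M\<close> are the same as linear maps \<open>N \<rightarrow> \<A>\<^sub>X\<^sup>*\<^sup>*\<close>.  So if \<open>\<A>\<^sub>X\<close> is
  reflexive, every map \<open>X \<rightarrow> M\<close> extends uniquely to a linear map \<open>\<A>\<^sub>X\<^sup>* \<rightarrow> M\<close>.  Applied to the orbit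
  maps \<open>g \<mapsto> g m\<close> this extends a \<open>G\<close>-action on \<open>M\<close> to \<open>\<A>\<^sub>G\<^sup>*\<close>; uniqueness gives linearity in \<open>m\<close>,
  multiplicativity, and the equivariance of \<open>G\<close>-morphisms.  Restriction of the action is therefore
  bijective on objects and the identity on morphisms.

  A quasi-coherent module is dual to the functor of \<open>K\<close>-linear maps \<open>V \<rightarrow> S\<close>.  This needs neither a
  basis nor polynomial rings: evaluating at the generic functional with values in a square-zero
  extension suffices.\<close>

section \<open>Algebras, natural families and functors of modules\<close>

abbreviation idm :: "'u alg \<Rightarrow> 'u \<Rightarrow> 'u" where "idm S \<equiv> \<lambda>s\<in>carrier S. s"

lemma alg_hom_closed: "p \<in> alg_hom K S T \<Longrightarrow> s \<in> carrier S \<Longrightarrow> p s \<in> carrier T"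
  by (auto simp: alg_hom_def ring_hom_def)

lemma alg_hom_add:
  "p \<in> alg_hom K S T \<Longrightarrow> s \<in> carrier S \<Longrightarrow> t \<in> carrier S \<Longrightarrow> p (s \<oplus>\<^bsub>S\<^esub> t) = p s \<oplus>\<^bsub>T\<^esub> p t"
  by (auto simp: alg_hom_def ring_hom_def)

lemma alg_hom_mult:
  "p \<in> alg_hom K S T \<Longrightarrow> s \<in> carrier S \<Longrightarrow> t \<in> carrier S \<Longrightarrow> p (s \<otimes>\<^bsub>S\<^esub> t) = p s \<otimes>\<^bsub>T\<^esub> p t"
  by (auto simp: alg_hom_def ring_hom_def)

lemma alg_hom_one: "p \<in> alg_hom K S T \<Longrightarrow> p \<one>\<^bsub>S\<^esub> = \<one>\<^bsub>T\<^esub>"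
  by (auto simp: alg_hom_def ring_hom_def)

lemma alg_hom_smult:
  "p \<in> alg_hom K S T \<Longrightarrow> k \<in> carrier K \<Longrightarrow> s \<in> carrier S \<Longrightarrow> p (k \<odot>\<^bsub>S\<^esub> s) = k \<odot>\<^bsub>T\<^esub> p s"
  by (auto simp: alg_hom_def)

lemma algebraD: "algebra K S \<Longrightarrow> cring S" "algebra K S \<Longrightarrow> module K S" "algebra K S \<Longrightarrow> ring S"
  "algebra K S \<Longrightarrow> abelian_group S" "algebra K S \<Longrightarrow> monoid S"
  by (auto simp: algebra_def module_def cring_def ring_def)

lemma alg_hom_zero:
  assumes S: "algebra K S" and T: "algebra K T" and p: "p \<in> alg_hom K S T"
  shows "p \<zero>\<^bsub>S\<^esub> = \<zero>\<^bsub>T\<^esub>"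
proof -
  interpret S: cring S by (rule algebraD(1)[OF S])
  interpret T: cring T by (rule algebraD(1)[OF T])
  show ?thesis
    using alg_hom_add[OF p, of "\<zero>\<^bsub>S\<^esub>" "\<zero>\<^bsub>S\<^esub>"] alg_hom_closed[OF p, of "\<zero>\<^bsub>S\<^esub>"] T.add.r_cancel_one' by simp
qed

lemma algebra_closed [simp]:
  assumes "algebra K S"
  shows "x \<in> carrier S \<Longrightarrow> y \<in> carrier S \<Longrightarrow> x \<oplus>\<^bsub>S\<^esub> y \<in> carrier S"
    "x \<in> carrier S \<Longrightarrow> y \<in> carrier S \<Longrightarrow> x \<otimes>\<^bsub>S\<^esub> y \<in> carrier S"
    "\<one>\<^bsub>S\<^esub> \<in> carrier S" "\<zero>\<^bsub>S\<^esub> \<in> carrier S"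
    "k \<in> carrier K \<Longrightarrow> x \<in> carrier S \<Longrightarrow> k \<odot>\<^bsub>S\<^esub> x \<in> carrier S"
proof -
  interpret algebra K S by fact
  show "x \<in> carrier S \<Longrightarrow> y \<in> carrier S \<Longrightarrow> x \<oplus>\<^bsub>S\<^esub> y \<in> carrier S"
    "x \<in> carrier S \<Longrightarrow> y \<in> carrier S \<Longrightarrow> x \<otimes>\<^bsub>S\<^esub> y \<in> carrier S"
    "\<one>\<^bsub>S\<^esub> \<in> carrier S" "\<zero>\<^bsub>S\<^esub> \<in> carrier S"
    "k \<in> carrier K \<Longrightarrow> x \<in> carrier S \<Longrightarrow> k \<odot>\<^bsub>S\<^esub> x \<in> carrier S" by auto
qed

lemma alg_hom_id [simp]: "algebra K S \<Longrightarrow> idm S \<in> alg_hom K S S"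
  by (auto simp: alg_hom_def ring_hom_def)

lemma alg_hom_compose [simp]:
  "algebra K S \<Longrightarrow> p \<in> alg_hom K S T \<Longrightarrow> q \<in> alg_hom K T U \<Longrightarrow>
    compose (carrier S) q p \<in> alg_hom K S U"
  by (auto simp: alg_hom_def ring_hom_def compose_def Pi_iff)

lemma compose_idm [simp]:
  "p \<in> alg_hom K S T \<Longrightarrow> compose (carrier S) (idm T) p = p"
  "p \<in> alg_hom K S T \<Longrightarrow> compose (carrier S) p (idm S) = p"
  by (auto simp: compose_def fun_eq_iff alg_hom_def ring_hom_def extensional_def)

lemma compose_idm_idm [simp]: "compose (carrier S) (idm S) (idm S) = idm S"
  by (auto simp: compose_def)

lemma compose_idm_compose [simp]:
  "q \<in> alg_hom K T U \<Longrightarrow> p \<in> alg_hom K S T \<Longrightarrow>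
    compose (carrier S) (idm U) (compose (carrier S) q p) = compose (carrier S) q p"
  by (auto simp: compose_def fun_eq_iff alg_hom_closed)

lemma compose_alg_hom_assoc [simp]:
  "p \<in> alg_hom K S T \<Longrightarrow>
    compose (carrier S) (compose (carrier T) r q) p = compose (carrier S) r (compose (carrier S) q p)"
  by (auto simp: compose_def fun_eq_iff alg_hom_closed)

lemma compose_apply [simp]: "s \<in> A \<Longrightarrow> compose A q p s = q (p s)"
  by (simp add: compose_eq)

lemma base_functor_simps [simp]:
  "carrier (val base_functor S) = carrier S"
  "\<zero>\<^bsub>val base_functor S\<^esub> = \<zero>\<^bsub>S\<^esub>"
  "x \<oplus>\<^bsub>val base_functor S\<^esub> y = x \<oplus>\<^bsub>S\<^esub> y"
  "x \<odot>\<^bsub>val base_functor S\<^esub> y = x \<otimes>\<^bsub>S\<^esub> y"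
  "tr base_functor S T p = p"
  by (simp_all add: base_functor_def)

lemma hom_functor_simps [simp]:
  "carrier (val (hom_functor K M N) S) = mod_mor_over K S M N"
  "tr (hom_functor K M N) = fam_restrict K"
  by (simp_all add: hom_functor_def)

lemma hom_functor_ops:
  "\<alpha> \<oplus>\<^bsub>val (hom_functor K M N) S\<^esub> \<beta> = fam K S (\<lambda>T p. \<lambda>x\<in>carrier (val M T). \<alpha> T p x \<oplus>\<^bsub>val N T\<^esub> \<beta> T p x)"
  "s \<odot>\<^bsub>val (hom_functor K M N) S\<^esub> \<alpha> = fam K S (\<lambda>T p. \<lambda>x\<in>carrier (val M T). p s \<odot>\<^bsub>val N T\<^esub> \<alpha> T p x)"
  by (simp_all add: hom_functor_def)

lemma end_functor_simps [simp]:
  "carrier (val (end_functor K M) S) = mod_mor_over K S M M"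
  "tr (end_functor K M) = fam_restrict K"
  by (simp_all add: end_functor_def hom_functor_def)

lemma end_functor_ops:
  "\<alpha> \<oplus>\<^bsub>val (end_functor K M) S\<^esub> \<beta> = fam K S (\<lambda>T p. \<lambda>x\<in>carrier (val M T). \<alpha> T p x \<oplus>\<^bsub>val M T\<^esub> \<beta> T p x)"
  "s \<odot>\<^bsub>val (end_functor K M) S\<^esub> \<alpha> = fam K S (\<lambda>T p. \<lambda>x\<in>carrier (val M T). p s \<odot>\<^bsub>val M T\<^esub> \<alpha> T p x)"
  "\<alpha> \<otimes>\<^bsub>val (end_functor K M) S\<^esub> \<beta> = fam K S (\<lambda>T p. compose (carrier (val M T)) (\<alpha> T p) (\<beta> T p))"
  "\<one>\<^bsub>val (end_functor K M) S\<^esub> = fam K S (\<lambda>T p. \<lambda>x\<in>carrier (val M T). x)"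
  by (simp_all add: end_functor_def hom_functor_def)

lemma fun_functor_simps [simp]:
  "carrier (val (fun_functor K X) S) = set_mor_over K S X base_functor"
  "tr (fun_functor K X) = fam_restrict K"
  by (simp_all add: fun_functor_def)

lemma fun_functor_ops:
  "f \<oplus>\<^bsub>val (fun_functor K X) S\<^esub> g = fam K S (\<lambda>T p. \<lambda>x\<in>carrier (val X T). f T p x \<oplus>\<^bsub>T\<^esub> g T p x)"
  "s \<odot>\<^bsub>val (fun_functor K X) S\<^esub> f = fam K S (\<lambda>T p. \<lambda>x\<in>carrier (val X T). p s \<otimes>\<^bsub>T\<^esub> f T p x)"
  by (simp_all add: fun_functor_def)

lemma dist_algebra_simps [simp]:
  "carrier (val (dist_algebra K G) S) = mod_mor_over K S (fun_functor K G) base_functor"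
  "w \<oplus>\<^bsub>val (dist_algebra K G) S\<^esub> w' = w \<oplus>\<^bsub>val (dual K (fun_functor K G)) S\<^esub> w'"
  "s \<odot>\<^bsub>val (dist_algebra K G) S\<^esub> w = s \<odot>\<^bsub>val (dual K (fun_functor K G)) S\<^esub> w"
  "w \<otimes>\<^bsub>val (dist_algebra K G) S\<^esub> w' = convolution K G S w w'"
  "\<one>\<^bsub>val (dist_algebra K G) S\<^esub> = eval_map K G S \<one>\<^bsub>val G S\<^esub>"
  "tr (dist_algebra K G) = fam_restrict K"
  by (simp_all add: dist_algebra_def hom_functor_def)

lemma fam_apply [simp]: "algebra K T \<Longrightarrow> p \<in> alg_hom K S T \<Longrightarrow> fam K S \<alpha> T p = \<alpha> T p"
  by (simp add: fam_def)

lemma hom_functor_apply [simp]: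
  assumes "algebra K T" "p \<in> alg_hom K S T" "x \<in> carrier (val M T)"
  shows "(\<alpha> \<oplus>\<^bsub>val (hom_functor K M N) S\<^esub> \<beta>) T p x = \<alpha> T p x \<oplus>\<^bsub>val N T\<^esub> \<beta> T p x"
    and "(s \<odot>\<^bsub>val (hom_functor K M N) S\<^esub> \<alpha>) T p x = p s \<odot>\<^bsub>val N T\<^esub> \<alpha> T p x"
  using assms by (simp_all add: hom_functor_ops)

lemma end_functor_apply [simp]:
  assumes "algebra K T" "p \<in> alg_hom K S T" "x \<in> carrier (val M T)"
  shows "(\<alpha> \<oplus>\<^bsub>val (end_functor K M) S\<^esub> \<beta>) T p x = \<alpha> T p x \<oplus>\<^bsub>val M T\<^esub> \<beta> T p x"
    and "(s \<odot>\<^bsub>val (end_functor K M) S\<^esub> \<alpha>) T p x = p s \<odot>\<^bsub>val M T\<^esub> \<alpha> T p x"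
    and "(\<alpha> \<otimes>\<^bsub>val (end_functor K M) S\<^esub> \<beta>) T p x = \<alpha> T p (\<beta> T p x)"
    and "\<one>\<^bsub>val (end_functor K M) S\<^esub> T p x = x"
  using assms by (simp_all add: end_functor_ops)

lemma fun_functor_apply [simp]:
  assumes "algebra K T" "p \<in> alg_hom K S T" "x \<in> carrier (val X T)"
  shows "(f \<oplus>\<^bsub>val (fun_functor K X) S\<^esub> g) T p x = f T p x \<oplus>\<^bsub>T\<^esub> g T p x"
    and "(s \<odot>\<^bsub>val (fun_functor K X) S\<^esub> f) T p x = p s \<otimes>\<^bsub>T\<^esub> f T p x"
  using assms by (simp_all add: fun_functor_ops)

lemma fam_fam [simp]: "fam K S (fam K S \<alpha>) = fam K S \<alpha>"
  by (auto simp: fam_def fun_eq_iff)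

lemma fam_restrict_apply [simp]:
  "algebra K T \<Longrightarrow> p \<in> alg_hom K S' T \<Longrightarrow>
    fam_restrict K S S' r \<alpha> T p = \<alpha> T (compose (carrier S) p r)"
  by (simp add: fam_restrict_def)

lemma set_mor_over_ext:
  assumes "\<alpha> \<in> set_mor_over K S X Y" "\<beta> \<in> set_mor_over K S X Y"
    and "\<And>T p x. algebra K T \<Longrightarrow> p \<in> alg_hom K S T \<Longrightarrow> x \<in> carrier (val X T) \<Longrightarrow> \<alpha> T p x = \<beta> T p x"
  shows "\<alpha> = \<beta>"
proof -
  have "\<alpha> T p = \<beta> T p" if "algebra K T" "p \<in> alg_hom K S T" for T p
  proof (rule PiE_ext)
    show "\<alpha> T p \<in> carrier (val X T) \<rightarrow>\<^sub>E carrier (val Y T)" "\<beta> T p \<in> carrier (val X T) \<rightarrow>\<^sub>E carrier (val Y T)"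
      using assms(1,2) that by (simp_all add: set_mor_over_def)
  qed (use assms(3) that in auto)
  then have "fam K S \<alpha> = fam K S \<beta>" by (auto simp: fam_def fun_eq_iff)
  with assms show ?thesis by (simp add: set_mor_over_def)
qed

lemma set_mor_over_closed:
  "\<alpha> \<in> set_mor_over K S X Y \<Longrightarrow> algebra K T \<Longrightarrow> p \<in> alg_hom K S T \<Longrightarrow> x \<in> carrier (val X T) \<Longrightarrow>
    \<alpha> T p x \<in> carrier (val Y T)"
  by (auto simp: set_mor_over_def)

lemma set_mor_over_natural:
  "\<alpha> \<in> set_mor_over K S X Y \<Longrightarrow> algebra K T \<Longrightarrow> algebra K U \<Longrightarrow> p \<in> alg_hom K S T \<Longrightarrow>
    q \<in> alg_hom K T U \<Longrightarrow> x \<in> carrier (val X T) \<Longrightarrow>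
    \<alpha> U (compose (carrier S) q p) (tr X T U q x) = tr Y T U q (\<alpha> T p x)"
  by (auto simp: set_mor_over_def)

lemma set_mor_over_natural_id:
  "\<alpha> \<in> set_mor_over K S X Y \<Longrightarrow> algebra K S \<Longrightarrow> algebra K U \<Longrightarrow>
    q \<in> alg_hom K S U \<Longrightarrow> x \<in> carrier (val X S) \<Longrightarrow>
    \<alpha> U q (tr X S U q x) = tr Y S U q (\<alpha> S (idm S) x)"
  using set_mor_over_natural[of \<alpha> K S X Y S U "idm S" q x] by simp

lemma set_mor_overI:
  assumes "set_functor K X" "algebra K S"
    and "\<And>T p x. algebra K T \<Longrightarrow> p \<in> alg_hom K S T \<Longrightarrow> x \<in> carrier (val X T) \<Longrightarrow>
      f T p x \<in> carrier (val Y T)"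
    and "\<And>T U p q x. algebra K T \<Longrightarrow> algebra K U \<Longrightarrow> p \<in> alg_hom K S T \<Longrightarrow> q \<in> alg_hom K T U \<Longrightarrow>
      x \<in> carrier (val X T) \<Longrightarrow> f U (compose (carrier S) q p) (tr X T U q x) = tr Y T U q (f T p x)"
  shows "fam K S (\<lambda>T p. \<lambda>x\<in>carrier (val X T). f T p x) \<in> set_mor_over K S X Y"
  unfolding set_mor_over_def
proof (intro CollectI conjI allI impI ballI)
  fix T U p q x
  assume *: "algebra K T" "algebra K U" "p \<in> alg_hom K S T" "q \<in> alg_hom K T U" "x \<in> carrier (val X T)"
  then have "tr X T U q x \<in> carrier (val X U)"
    using assms(1) by (auto simp: set_functor_def Pi_iff)
  with * show "fam K S (\<lambda>T p. \<lambda>x\<in>carrier (val X T). f T p x) U (compose (carrier S) q p) (tr X T U q x) =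
      tr Y T U q (fam K S (\<lambda>T p. \<lambda>x\<in>carrier (val X T). f T p x) T p x)"
    using assms(2,4) by simp
qed (use assms(3) in auto)

lemma set_functor_closed:
  "set_functor K X \<Longrightarrow> algebra K S \<Longrightarrow> algebra K T \<Longrightarrow> p \<in> alg_hom K S T \<Longrightarrow>
    x \<in> carrier (val X S) \<Longrightarrow> tr X S T p x \<in> carrier (val X T)"
  by (auto simp: set_functor_def Pi_iff)

lemma set_functor_id:
  "set_functor K X \<Longrightarrow> algebra K S \<Longrightarrow> x \<in> carrier (val X S) \<Longrightarrow> tr X S S (idm S) x = x"
  by (auto simp: set_functor_def)

lemma set_functor_compose:
  "set_functor K X \<Longrightarrow> algebra K S \<Longrightarrow> algebra K T \<Longrightarrow> algebra K U \<Longrightarrow> p \<in> alg_hom K S T \<Longrightarrow>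
    q \<in> alg_hom K T U \<Longrightarrow> x \<in> carrier (val X S) \<Longrightarrow>
    tr X T U q (tr X S T p x) = tr X S U (compose (carrier S) q p) x"
  by (auto simp: set_functor_def)

lemma mod_mor_over_set: "\<alpha> \<in> mod_mor_over K S M N \<Longrightarrow> \<alpha> \<in> set_mor_over K S M N"
  by (simp add: mod_mor_over_def)

lemmas mod_mor_over_ext = set_mor_over_ext[OF mod_mor_over_set mod_mor_over_set]
lemmas mod_mor_over_closed = set_mor_over_closed[OF mod_mor_over_set]
lemmas mod_mor_over_natural = set_mor_over_natural[OF mod_mor_over_set]
lemmas mod_mor_over_natural_id = set_mor_over_natural_id[OF mod_mor_over_set]

lemma mod_mor_over_add:
  "\<alpha> \<in> mod_mor_over K S M N \<Longrightarrow> algebra K T \<Longrightarrow> p \<in> alg_hom K S T \<Longrightarrow> x \<in> carrier (val M T) \<Longrightarrow>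
    y \<in> carrier (val M T) \<Longrightarrow> \<alpha> T p (x \<oplus>\<^bsub>val M T\<^esub> y) = \<alpha> T p x \<oplus>\<^bsub>val N T\<^esub> \<alpha> T p y"
  by (auto simp: mod_mor_over_def linear_maps_def)

lemma mod_mor_over_smult:
  "\<alpha> \<in> mod_mor_over K S M N \<Longrightarrow> algebra K T \<Longrightarrow> p \<in> alg_hom K S T \<Longrightarrow> t \<in> carrier T \<Longrightarrow>
    x \<in> carrier (val M T) \<Longrightarrow> \<alpha> T p (t \<odot>\<^bsub>val M T\<^esub> x) = t \<odot>\<^bsub>val N T\<^esub> \<alpha> T p x"
  by (auto simp: mod_mor_over_def linear_maps_def)

text \<open>Of the functors \<open>\<A>\<^sub>X\<close> and \<open>\<A>\<^sub>X\<^sup>*\<close> only closure under the operations is needed, not the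
  module axioms.\<close>

definition closed_functor :: "'u ring \<Rightarrow> ('u, 'm) modfunctor \<Rightarrow> bool" where
  "closed_functor K M \<longleftrightarrow> set_functor K M \<and> (\<forall>S. algebra K S \<longrightarrow>
     (\<forall>x\<in>carrier (val M S). \<forall>y\<in>carrier (val M S). x \<oplus>\<^bsub>val M S\<^esub> y \<in> carrier (val M S)) \<and>
     (\<forall>s\<in>carrier S. \<forall>x\<in>carrier (val M S). s \<odot>\<^bsub>val M S\<^esub> x \<in> carrier (val M S)))"

lemma closed_functor_add: "closed_functor K M \<Longrightarrow> algebra K S \<Longrightarrow> x \<in> carrier (val M S) \<Longrightarrow>
    y \<in> carrier (val M S) \<Longrightarrow> x \<oplus>\<^bsub>val M S\<^esub> y \<in> carrier (val M S)"
  by (simp add: closed_functor_def)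

lemma closed_functor_smult: "closed_functor K M \<Longrightarrow> algebra K S \<Longrightarrow> s \<in> carrier S \<Longrightarrow>
    x \<in> carrier (val M S) \<Longrightarrow> s \<odot>\<^bsub>val M S\<^esub> x \<in> carrier (val M S)"
  by (simp add: closed_functor_def)

lemma mod_functor_module: "mod_functor K M \<Longrightarrow> algebra K S \<Longrightarrow> module S (val M S)"
  by (simp add: mod_functor_def)

lemma mod_functor_set: "mod_functor K M \<Longrightarrow> set_functor K M"
  by (simp add: mod_functor_def)

lemma mod_functor_closed:
  fixes M :: "('u, 'm) modfunctor"
  assumes "mod_functor K M" shows "closed_functor K M"
  unfolding closed_functor_def
proof (intro conjI allI impI ballI)
  show "set_functor K M" by (rule mod_functor_set[OF assms])
next
  fix S :: "'u alg" and s x y assume *: "algebra K S"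
  interpret module S "val M S" by (rule mod_functor_module[OF assms *])
  show "x \<in> carrier (val M S) \<Longrightarrow> y \<in> carrier (val M S) \<Longrightarrow> x \<oplus>\<^bsub>val M S\<^esub> y \<in> carrier (val M S)"
    and "s \<in> carrier S \<Longrightarrow> x \<in> carrier (val M S) \<Longrightarrow> s \<odot>\<^bsub>val M S\<^esub> x \<in> carrier (val M S)"
    by auto
qed

lemma mod_functor_tr_add:
  "mod_functor K M \<Longrightarrow> algebra K S \<Longrightarrow> algebra K T \<Longrightarrow> p \<in> alg_hom K S T \<Longrightarrow>
    x \<in> carrier (val M S) \<Longrightarrow> y \<in> carrier (val M S) \<Longrightarrow>
    tr M S T p (x \<oplus>\<^bsub>val M S\<^esub> y) = tr M S T p x \<oplus>\<^bsub>val M T\<^esub> tr M S T p y"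
  by (simp add: mod_functor_def)

lemma mod_functor_tr_smult:
  "mod_functor K M \<Longrightarrow> algebra K S \<Longrightarrow> algebra K T \<Longrightarrow> p \<in> alg_hom K S T \<Longrightarrow>
    s \<in> carrier S \<Longrightarrow> x \<in> carrier (val M S) \<Longrightarrow>
    tr M S T p (s \<odot>\<^bsub>val M S\<^esub> x) = p s \<odot>\<^bsub>val M T\<^esub> tr M S T p x"
  by (simp add: mod_functor_def)

lemma mod_mor_overI:
  assumes "closed_functor K M" "algebra K S"
    and "\<And>T p x. algebra K T \<Longrightarrow> p \<in> alg_hom K S T \<Longrightarrow> x \<in> carrier (val M T) \<Longrightarrow>
      f T p x \<in> carrier (val N T)"
    and "\<And>T U p q x. algebra K T \<Longrightarrow> algebra K U \<Longrightarrow> p \<in> alg_hom K S T \<Longrightarrow> q \<in> alg_hom K T U \<Longrightarrow>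
      x \<in> carrier (val M T) \<Longrightarrow> f U (compose (carrier S) q p) (tr M T U q x) = tr N T U q (f T p x)"
    and "\<And>T p x y. algebra K T \<Longrightarrow> p \<in> alg_hom K S T \<Longrightarrow> x \<in> carrier (val M T) \<Longrightarrow>
      y \<in> carrier (val M T) \<Longrightarrow> f T p (x \<oplus>\<^bsub>val M T\<^esub> y) = f T p x \<oplus>\<^bsub>val N T\<^esub> f T p y"
    and "\<And>T p t x. algebra K T \<Longrightarrow> p \<in> alg_hom K S T \<Longrightarrow> t \<in> carrier T \<Longrightarrow> x \<in> carrier (val M T) \<Longrightarrow>
      f T p (t \<odot>\<^bsub>val M T\<^esub> x) = t \<odot>\<^bsub>val N T\<^esub> f T p x"
  shows "fam K S (\<lambda>T p. \<lambda>x\<in>carrier (val M T). f T p x) \<in> mod_mor_over K S M N"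
  using assms set_mor_overI[where X = M and Y = N and f = f and K = K and S = S]
  by (auto simp: mod_mor_over_def linear_maps_def closed_functor_def)

lemma fam_restrict_set_mor_over:
  assumes "algebra K S" "algebra K S'" "r \<in> alg_hom K S S'" "\<alpha> \<in> set_mor_over K S X Y"
  shows "fam_restrict K S S' r \<alpha> \<in> set_mor_over K S' X Y"
  using assms set_mor_over_natural[OF assms(4)] unfolding set_mor_over_def
  by (auto simp: fam_restrict_def)

lemma fam_restrict_mod_mor_over:
  assumes "algebra K S" "algebra K S'" "r \<in> alg_hom K S S'" "\<alpha> \<in> mod_mor_over K S M N"
  shows "fam_restrict K S S' r \<alpha> \<in> mod_mor_over K S' M N"
  using assms fam_restrict_set_mor_over[OF assms(1-3), of \<alpha> M N]
  by (auto simp: mod_mor_over_def)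

lemma fam_restrict_id: "fam K S \<alpha> = \<alpha> \<Longrightarrow> fam_restrict K S S (idm S) \<alpha> = \<alpha>"
proof -
  have "fam_restrict K S S (idm S) \<alpha> = fam K S \<alpha>"
    by (auto simp: fam_restrict_def fam_def fun_eq_iff)
  then show "fam K S \<alpha> = \<alpha> \<Longrightarrow> ?thesis" by simp
qed

lemma fam_restrict_compose:
  "algebra K S \<Longrightarrow> algebra K T \<Longrightarrow> p \<in> alg_hom K S T \<Longrightarrow> q \<in> alg_hom K T U \<Longrightarrow>
    fam_restrict K T U q (fam_restrict K S T p \<alpha>) = fam_restrict K S U (compose (carrier S) q p) \<alpha>"
  by (auto simp: fam_restrict_def fam_def fun_eq_iff)

lemma fam_of_mor_over: "\<alpha> \<in> set_mor_over K S X Y \<Longrightarrow> fam K S \<alpha> = \<alpha>"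
  by (simp add: set_mor_over_def)

lemma set_functor_hom [simp]: "set_functor K (hom_functor K M N)"
  by (auto simp: set_functor_def fam_restrict_mod_mor_over fam_restrict_compose fam_restrict_id
      fam_of_mor_over[OF mod_mor_over_set])

lemma set_functor_fun [simp]: "set_functor K (fun_functor K X)"
  by (auto simp: set_functor_def fam_restrict_set_mor_over fam_restrict_compose fam_restrict_id
      fam_of_mor_over)

lemma set_functor_end [simp]: "set_functor K (end_functor K M)"
  by (auto simp: set_functor_def fam_restrict_mod_mor_over fam_restrict_compose fam_restrict_id
      fam_of_mor_over[OF mod_mor_over_set])

lemma set_functor_dist [simp]: "set_functor K (dist_algebra K G)"
  by (auto simp: set_functor_def fam_restrict_mod_mor_over fam_restrict_compose fam_restrict_id
      fam_of_mor_over[OF mod_mor_over_set])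

lemma mod_functor_base: "mod_functor K base_functor"
  unfolding mod_functor_def
proof (intro conjI allI impI ballI)
  show "set_functor K base_functor"
    by (auto simp: set_functor_def alg_hom_closed)
next
  fix S :: "'a alg" assume "algebra K S"
  then interpret cring S by (rule algebraD)
  have "abelian_group (val base_functor S)"
  proof (rule abelian_groupI)
    fix x assume "x \<in> carrier (val base_functor S)"
    then show "\<exists>y\<in>carrier (val base_functor S). y \<oplus>\<^bsub>val base_functor S\<^esub> x = \<zero>\<^bsub>val base_functor S\<^esub>"
      using l_neg by auto
  qed (auto simp: a_ac)
  then show "module S (val base_functor S)"
    by (intro moduleI) (auto simp: l_distr r_distr m_assoc is_cring)
qed (auto simp: alg_hom_add alg_hom_mult)

lemma closed_functor_fun:
  assumes "set_functor K X"
  shows "closed_functor K (fun_functor K X)"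
  unfolding closed_functor_def fun_functor_simps
proof (intro conjI allI impI ballI)
  fix S :: "'a alg" and f g assume S: "algebra K S" and f: "f \<in> set_mor_over K S X base_functor"
  note f' = set_mor_over_closed[OF f, simplified] set_mor_over_natural[OF f, simplified]
  show "f \<oplus>\<^bsub>val (fun_functor K X) S\<^esub> g \<in> set_mor_over K S X base_functor"
    if g: "g \<in> set_mor_over K S X base_functor"
    unfolding fun_functor_ops
    by (rule set_mor_overI[OF assms S])
      (simp_all add: f' alg_hom_add set_mor_over_closed[OF g, simplified] set_mor_over_natural[OF g, simplified])
  show "s \<odot>\<^bsub>val (fun_functor K X) S\<^esub> f \<in> set_mor_over K S X base_functor"
    if s: "s \<in> carrier S" for s
    unfolding fun_functor_ops
    by (rule set_mor_overI[OF assms S])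
      (simp_all add: f' alg_hom_mult alg_hom_closed[of _ K S] s)
qed simp

lemma closed_functor_hom:
  assumes M: "closed_functor K M" and N: "mod_functor K N"
  shows "closed_functor K (hom_functor K M N)"
  unfolding closed_functor_def hom_functor_simps
proof (intro conjI allI impI ballI)
  note N' = mod_functor_closed[OF N]
  fix S :: "'a alg" and f g assume S: "algebra K S" and f: "f \<in> mod_mor_over K S M N"
  note f' = mod_mor_over_closed[OF f] mod_mor_over_natural[OF f] mod_mor_over_add[OF f] mod_mor_over_smult[OF f]
  show "f \<oplus>\<^bsub>val (hom_functor K M N) S\<^esub> g \<in> mod_mor_over K S M N"
    if g: "g \<in> mod_mor_over K S M N"
  proof -
    note g' = mod_mor_over_closed[OF g] mod_mor_over_natural[OF g] mod_mor_over_add[OF g] mod_mor_over_smult[OF g]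
    show ?thesis unfolding hom_functor_ops
    proof (rule mod_mor_overI[OF M S])
      fix T p x y assume T: "algebra K T" "p \<in> alg_hom K S T" "x \<in> carrier (val M T)" "y \<in> carrier (val M T)"
      interpret module T "val N T" by (rule mod_functor_module[OF N T(1)])
      show "f T p (x \<oplus>\<^bsub>val M T\<^esub> y) \<oplus>\<^bsub>val N T\<^esub> g T p (x \<oplus>\<^bsub>val M T\<^esub> y) =
         f T p x \<oplus>\<^bsub>val N T\<^esub> g T p x \<oplus>\<^bsub>val N T\<^esub> (f T p y \<oplus>\<^bsub>val N T\<^esub> g T p y)"
        using T f' g' by (simp add: M.a_ac)
    next
      fix T p x t assume T: "algebra K T" "p \<in> alg_hom K S T" "x \<in> carrier (val M T)" "t \<in> carrier T"
      interpret module T "val N T" by (rule mod_functor_module[OF N T(1)])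
      show "f T p (t \<odot>\<^bsub>val M T\<^esub> x) \<oplus>\<^bsub>val N T\<^esub> g T p (t \<odot>\<^bsub>val M T\<^esub> x) =
         t \<odot>\<^bsub>val N T\<^esub> (f T p x \<oplus>\<^bsub>val N T\<^esub> g T p x)"
        using T f' g' by (simp add: smult_r_distr)
    qed (simp_all add: f' g' mod_functor_tr_add[OF N] closed_functor_add[OF N'])
  qed
  show "s \<odot>\<^bsub>val (hom_functor K M N) S\<^esub> f \<in> mod_mor_over K S M N"
    if s: "s \<in> carrier S" for s
  proof -
    show ?thesis unfolding hom_functor_ops
    proof (rule mod_mor_overI[OF M S])
      fix T p x y assume T: "algebra K T" "p \<in> alg_hom K S T" "x \<in> carrier (val M T)" "y \<in> carrier (val M T)"
      interpret module T "val N T" by (rule mod_functor_module[OF N T(1)])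
      show "p s \<odot>\<^bsub>val N T\<^esub> f T p (x \<oplus>\<^bsub>val M T\<^esub> y) =
         p s \<odot>\<^bsub>val N T\<^esub> f T p x \<oplus>\<^bsub>val N T\<^esub> p s \<odot>\<^bsub>val N T\<^esub> f T p y"
        using T f' alg_hom_closed[OF T(2) s] by (simp add: smult_r_distr)
    next
      fix T p x t assume T: "algebra K T" "p \<in> alg_hom K S T" "x \<in> carrier (val M T)" "t \<in> carrier T"
      interpret module T "val N T" by (rule mod_functor_module[OF N T(1)])
      note ps = alg_hom_closed[OF T(2) s]
      have "p s \<odot>\<^bsub>val N T\<^esub> f T p (t \<odot>\<^bsub>val M T\<^esub> x) = (p s \<otimes>\<^bsub>T\<^esub> t) \<odot>\<^bsub>val N T\<^esub> f T p x"
        using T f' ps by (simp add: smult_assoc1)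
      also have "\<dots> = (t \<otimes>\<^bsub>T\<^esub> p s) \<odot>\<^bsub>val N T\<^esub> f T p x"
        using T ps by (simp add: m_comm)
      also have "\<dots> = t \<odot>\<^bsub>val N T\<^esub> (p s \<odot>\<^bsub>val N T\<^esub> f T p x)"
        using T f' ps by (simp add: smult_assoc1)
      finally show "p s \<odot>\<^bsub>val N T\<^esub> f T p (t \<odot>\<^bsub>val M T\<^esub> x) =
         t \<odot>\<^bsub>val N T\<^esub> (p s \<odot>\<^bsub>val N T\<^esub> f T p x)" .
    qed (simp_all add: f' s mod_functor_tr_smult[OF N] closed_functor_smult[OF N'] alg_hom_closed[of _ K S])
  qed
qed simp

lemma closed_functor_end:
  assumes "mod_functor K M"
  shows "closed_functor K (end_functor K M)"
  using closed_functor_hom[OF mod_functor_closed[OF assms] assms]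
  by (simp add: closed_functor_def end_functor_ops hom_functor_ops)

lemma eval_map_apply [simp]:
  "algebra K S \<Longrightarrow> x \<in> carrier (val X S) \<Longrightarrow> algebra K T \<Longrightarrow> p \<in> alg_hom K S T \<Longrightarrow>
    f \<in> set_mor_over K T X base_functor \<Longrightarrow> eval_map K X S x T p f = f T (idm T) (tr X S T p x)"
  by (simp add: eval_map_def)

lemma eval_map_closed:
  assumes X: "set_functor K X" and S: "algebra K S" and x: "x \<in> carrier (val X S)"
  shows "eval_map K X S x \<in> mod_mor_over K S (fun_functor K X) base_functor"
proof -
  note [simp] = set_functor_closed[OF X] set_mor_over_closed[where Y = base_functor and X = X, simplified]
  have "fam K S (\<lambda>T p. \<lambda>f\<in>carrier (val (fun_functor K X) T). f T (idm T) (tr X S T p x)) \<in>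
      mod_mor_over K S (fun_functor K X) base_functor"
  proof (rule mod_mor_overI[OF closed_functor_fun[OF X] S], goal_cases)
    case (2 T U p q f)
    then show ?case
      using S x set_mor_over_natural_id[of f K T X base_functor U q "tr X S T p x"]
      by (simp add: set_functor_compose[OF X])
  qed (use S x in \<open>simp_all\<close>)
  with S x show ?thesis by (simp add: eval_map_def)
qed

lemma eval_map_natural:
  assumes X: "set_functor K X" and S: "algebra K S" and x: "x \<in> carrier (val X S)"
    and T: "algebra K T" and p: "p \<in> alg_hom K S T"
  shows "eval_map K X T (tr X S T p x) = fam_restrict K S T p (eval_map K X S x)"
proof (rule mod_mor_over_ext)
  show "eval_map K X T (tr X S T p x) \<in> mod_mor_over K T (fun_functor K X) base_functor"
    by (intro eval_map_closed set_functor_closed[OF X] assms)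
  show "fam_restrict K S T p (eval_map K X S x) \<in> mod_mor_over K T (fun_functor K X) base_functor"
    by (intro fam_restrict_mod_mor_over eval_map_closed assms)
qed (use assms in \<open>simp add: set_functor_closed[OF X] set_functor_compose[OF X]\<close>)

section \<open>Extending functions to distributions\<close>

definition extends :: "'u ring \<Rightarrow> ('u, ('x, 's) partial_object_scheme, 'x) kfunctor \<Rightarrow>
    ('u, 'm) modfunctor \<Rightarrow> bool" where
  "extends K X M \<longleftrightarrow> (\<forall>S f. algebra K S \<longrightarrow> f \<in> set_mor_over K S X M \<longrightarrow>
     (\<exists>!F. F \<in> mod_mor_over K S (dual K (fun_functor K X)) M \<and>
       (\<forall>T p x. algebra K T \<longrightarrow> p \<in> alg_hom K S T \<longrightarrow> x \<in> carrier (val X T) \<longrightarrow>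
          F T p (eval_map K X T x) = f T p x)))"

lemma mod_isoD:
  assumes "\<beta> \<in> mod_iso K M N" "algebra K S"
  shows "x \<in> carrier (val M S) \<Longrightarrow> \<beta> S x \<in> carrier (val N S)"
    and "algebra K T \<Longrightarrow> p \<in> alg_hom K S T \<Longrightarrow> x \<in> carrier (val M S) \<Longrightarrow>
      \<beta> T (tr M S T p x) = tr N S T p (\<beta> S x)"
    and "x \<in> carrier (val M S) \<Longrightarrow> y \<in> carrier (val M S) \<Longrightarrow>
      \<beta> S (x \<oplus>\<^bsub>val M S\<^esub> y) = \<beta> S x \<oplus>\<^bsub>val N S\<^esub> \<beta> S y"
    and "s \<in> carrier S \<Longrightarrow> x \<in> carrier (val M S) \<Longrightarrow> \<beta> S (s \<odot>\<^bsub>val M S\<^esub> x) = s \<odot>\<^bsub>val N S\<^esub> \<beta> S x"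
    and "bij_betw (\<beta> S) (carrier (val M S)) (carrier (val N S))"
    and "inj_on (\<beta> S) (carrier (val M S))"
    and "z \<in> carrier (val N S) \<Longrightarrow> inv_into (carrier (val M S)) (\<beta> S) z \<in> carrier (val M S)"
    and "z \<in> carrier (val N S) \<Longrightarrow> \<beta> S (inv_into (carrier (val M S)) (\<beta> S) z) = z"
proof -
  show bij: "bij_betw (\<beta> S) (carrier (val M S)) (carrier (val N S))"
    using assms by (simp add: mod_iso_def)
  show "inj_on (\<beta> S) (carrier (val M S))" by (rule bij_betw_imp_inj_on[OF bij])
  show "z \<in> carrier (val N S) \<Longrightarrow> inv_into (carrier (val M S)) (\<beta> S) z \<in> carrier (val M S)"
    "z \<in> carrier (val N S) \<Longrightarrow> \<beta> S (inv_into (carrier (val M S)) (\<beta> S) z) = z"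
    using bij by (simp_all add: bij_betw_def f_inv_into_f inv_into_into)
qed (use assms in \<open>auto simp: mod_iso_def mod_mor_def linear_maps_def set_mor_def\<close>)

text \<open>After composing with \<open>\<beta>\<close> and evaluating at \<open>n\<close>, a linear map on \<open>\<A>\<^sub>X\<^sup>*\<close> becomes an element
  of \<open>\<A>\<^sub>X\<^sup>*\<^sup>*\<close>, that is, a function on \<open>X\<close>.\<close>

lemma linear_extension_unique:
  fixes K :: "'u ring" and X :: "('u, ('x, 's) partial_object_scheme, 'x) kfunctor"
    and M :: "('u, 'm) modfunctor" and N :: "('u, 'n) modfunctor"
  assumes X: "set_functor K X" and refl: "reflexive K (fun_functor K X)"
    and M: "mod_functor K M" and N: "mod_functor K N" and \<beta>: "\<beta> \<in> mod_iso K M (dual K N)"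
    and S: "algebra K S"
    and F: "F \<in> mod_mor_over K S (dual K (fun_functor K X)) M"
    and F': "F' \<in> mod_mor_over K S (dual K (fun_functor K X)) M"
    and agree: "\<And>T p x. algebra K T \<Longrightarrow> p \<in> alg_hom K S T \<Longrightarrow> x \<in> carrier (val X T) \<Longrightarrow>
      F T p (eval_map K X T x) = F' T p (eval_map K X T x)"
  shows "F = F'"
proof (rule mod_mor_over_ext[OF F F'])
  let ?A = "fun_functor K X"
  define \<Phi> where "\<Phi> F U p n = fam K U (\<lambda>V r. \<lambda>w\<in>carrier (val (dual K ?A) V).
      \<beta> V (F V (compose (carrier S) r p) w) V (idm V) (tr N U V r n))"
    for F :: "('u, ('u, ('u, 'x, 'u) family, 'u) family, 'm) family" and U p n
  note \<beta>' = mod_isoD[OF \<beta>, simplified]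
  note [simp] = set_functor_closed[OF mod_functor_set[OF N]]
    set_functor_compose[OF mod_functor_set[OF N]] set_functor_id[OF mod_functor_set[OF N]]
  have \<Phi>_mem: "\<Phi> F U p n \<in> mod_mor_over K U (dual K ?A) base_functor"
    if F: "F \<in> mod_mor_over K S (dual K ?A) M" and U: "algebra K U" "p \<in> alg_hom K S U" "n \<in> carrier (val N U)"
    for F U p n
  proof -
    note F' = mod_mor_over_closed[OF F, simplified]
    have mem: "\<beta> V (F V (compose (carrier S) r p) w) \<in> mod_mor_over K V N base_functor"
      if "algebra K V" "r \<in> alg_hom K U V" "w \<in> mod_mor_over K V ?A base_functor" for V r w
      using that U S by (intro \<beta>' F') auto
    note clo = mod_mor_over_closed[OF mem, simplified]
    show ?thesis
      unfolding \<Phi>_def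
    proof (rule mod_mor_overI, goal_cases)
      case 1 show ?case by (rule closed_functor_hom[OF closed_functor_fun[OF X] mod_functor_base])
    next
      case (4 V W r q w)
      let ?rp = "compose (carrier S) r p"
      have rp: "?rp \<in> alg_hom K S V" using 4 U S by auto
      have w: "w \<in> mod_mor_over K V ?A base_functor" using 4 by simp
      have y: "F V ?rp w \<in> carrier (val M V)" using F'[of V ?rp w] rp 4 by simp
      have "F W (compose (carrier S) q ?rp) (fam_restrict K V W q w) = tr M V W q (F V ?rp w)"
        using mod_mor_over_natural[OF F, of V W ?rp q w] rp 4 by simp
      then show ?case
        using 4 U S \<beta>'(2)[of V W q "F V ?rp w"] y mod_mor_over_natural_id[OF mem[OF 4(1,3) w], of W q "tr N U V r n"]
        by simp
    next
      case (5 V r w w')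
      then show ?case
        using mod_mor_over_add[OF F, of V "compose (carrier S) r p" w w'] U S
          F'[of V "compose (carrier S) r p" w] F'[of V "compose (carrier S) r p" w']
        by (simp add: \<beta>'(3) )
    next
      case (6 V r t w)
      then show ?case
        using mod_mor_over_smult[OF F, of V "compose (carrier S) r p" t w] U S
          F'[of V "compose (carrier S) r p" w]
        by (simp add: \<beta>'(4) )
    qed (use U in \<open>simp_all add: clo\<close>)
  qed
  fix T p w assume T: "algebra K T" "p \<in> alg_hom K S T" "w \<in> carrier (val (dual K ?A) T)"
  have clo: "F T p w \<in> carrier (val M T)" "F' T p w \<in> carrier (val M T)"
    using mod_mor_over_closed[OF F T] mod_mor_over_closed[OF F' T] .
  have \<Phi>_eq: "\<beta> T (H T p w) U q n = \<Phi> H U (compose (carrier S) q p) n U (idm U) (fam_restrict K T U q w)"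
    if H: "H \<in> mod_mor_over K S (dual K ?A) M" and U: "algebra K U" "q \<in> alg_hom K T U" "n \<in> carrier (val N U)"
    for H U q n
  proof -
    have "H U (compose (carrier S) q p) (fam_restrict K T U q w) = tr M T U q (H T p w)"
      using mod_mor_over_natural[OF H, of T U p q w] T U by simp
    moreover have "fam_restrict K T U q w \<in> mod_mor_over K U ?A base_functor"
      using T U by (auto intro: fam_restrict_mod_mor_over)
    moreover have "H T p w \<in> carrier (val M T)" by (rule mod_mor_over_closed[OF H T])
    ultimately show ?thesis using T U S by (simp add: \<Phi>_def \<beta>'(2))
  qed
  have "\<Phi> F U q n = \<Phi> F' U q n" if U: "algebra K U" "q \<in> alg_hom K S U" "n \<in> carrier (val N U)" for U q n
  proof -
    have bij: "bij_betw (bidual_map K ?A U) (carrier (val ?A U)) (carrier (val (dual K (dual K ?A)) U))"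
      using refl U by (simp add: reflexive_def mod_iso_def)
    have ex: "\<exists>a\<in>carrier (val ?A U). bidual_map K ?A U a = \<Phi> H U q n"
      if "H \<in> mod_mor_over K S (dual K ?A) M" for H
    proof -
      have "\<Phi> H U q n \<in> carrier (val (dual K (dual K ?A)) U)"
        using \<Phi>_mem[OF that U] by simp
      then show ?thesis using bij by (force simp: bij_betw_def)
    qed
    obtain a where a: "a \<in> set_mor_over K U X base_functor" "bidual_map K ?A U a = \<Phi> F U q n"
      using ex[OF F] by auto
    obtain a' where a': "a' \<in> set_mor_over K U X base_functor" "bidual_map K ?A U a' = \<Phi> F' U q n"
      using ex[OF F'] by auto
    have ev: "b V r x = \<beta> V (H V (compose (carrier S) r q) (eval_map K X V x)) V (idm V) (tr N U V r n)"
      if H: "b \<in> set_mor_over K U X base_functor" "bidual_map K ?A U b = \<Phi> H U q n"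
        and V: "algebra K V" "r \<in> alg_hom K U V" "x \<in> carrier (val X V)" for b H V r x
    proof -
      have "fam_restrict K U V r b \<in> set_mor_over K V X base_functor"
        by (rule fam_restrict_set_mor_over[OF U(1) V(1,2) H(1)])
      then have "b V r x = bidual_map K ?A U b V r (eval_map K X V x)"
        using U V H(1) eval_map_closed[OF X V(1,3)]
        by (simp add: bidual_map_def set_functor_id[OF X])
      then show ?thesis
        using U V H(1) eval_map_closed[OF X V(1,3)] by (simp add: H(2) \<Phi>_def)
    qed
    have "a = a'"
      using U S by (intro set_mor_over_ext[OF a(1) a'(1)]) (simp add: ev[OF a] ev[OF a'] agree)
    then show ?thesis using a a' by simp
  qed
  then have "\<beta> T (F T p w) U q n = \<beta> T (F' T p w) U q n"
    if "algebra K U" "q \<in> alg_hom K T U" "n \<in> carrier (val N U)" for U q n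
    using \<Phi>_eq[OF F that] \<Phi>_eq[OF F' that] T that S by simp
  then have "\<beta> T (F T p w) = \<beta> T (F' T p w)"
    using clo by (intro mod_mor_over_ext[OF \<beta>'(1)[OF T(1)] \<beta>'(1)[OF T(1)]])
  then show "F T p w = F' T p w"
    using inj_onD[OF \<beta>'(6)[OF T(1)]] clo by blast
qed

lemma linear_extension_exists:
  fixes K :: "'u ring" and X :: "('u, ('x, 's) partial_object_scheme, 'x) kfunctor"
    and M :: "('u, 'm) modfunctor" and N :: "('u, 'n) modfunctor"
  assumes X: "set_functor K X"
    and M: "mod_functor K M" and N: "mod_functor K N" and \<beta>: "\<beta> \<in> mod_iso K M (dual K N)"
    and S: "algebra K S" and f: "f \<in> set_mor_over K S X M"
  obtains F where "F \<in> mod_mor_over K S (dual K (fun_functor K X)) M"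
    and "\<And>T p x. algebra K T \<Longrightarrow> p \<in> alg_hom K S T \<Longrightarrow> x \<in> carrier (val X T) \<Longrightarrow>
      F T p (eval_map K X T x) = f T p x"
proof -
  let ?A = "fun_functor K X"
  note \<beta>' = mod_isoD[OF \<beta>, simplified]
  note N' = mod_functor_closed[OF N]
  note A_closed = closed_functor_fun[OF X]
  note [simp] = set_functor_closed[OF mod_functor_set[OF N]] set_functor_compose[OF mod_functor_set[OF N]]
    set_functor_id[OF mod_functor_set[OF N]]
    set_functor_closed[OF X] set_functor_compose[OF X] set_functor_id[OF X]
  define e where "e U p n = fam K U (\<lambda>V r. \<lambda>x\<in>carrier (val X V).
      \<beta> V (f V (compose (carrier S) r p) x) V (idm V) (tr N U V r n))" for U p n
  define H where "H T p w = fam K T (\<lambda>U q. \<lambda>n\<in>carrier (val N U). w U q (e U (compose (carrier S) q p) n))"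
    for T p and w :: "('u, ('u, 'x, 'u) family, 'u) family"
  define J where "J T = inv_into (carrier (val M T)) (\<beta> T)" for T
  have \<beta>f: "\<beta> V (f V r x) \<in> mod_mor_over K V N base_functor"
    if "algebra K V" "r \<in> alg_hom K S V" "x \<in> carrier (val X V)" for V r x
    using that S by (intro \<beta>' set_mor_over_closed[OF f])
  have \<beta>f_nat: "\<beta> W (f W (compose (carrier S) q r) (tr X V W q x)) = fam_restrict K V W q (\<beta> V (f V r x))"
    if "algebra K V" "algebra K W" "r \<in> alg_hom K S V" "q \<in> alg_hom K V W" "x \<in> carrier (val X V)" for V W q r x
    using that by (simp add: set_mor_over_natural[OF f] \<beta>' set_mor_over_closed[OF f])
  have e_closed: "e U p n \<in> set_mor_over K U X base_functor"
    if U: "algebra K U" "p \<in> alg_hom K S U" "n \<in> carrier (val N U)" for U p n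
    unfolding e_def
  proof (rule set_mor_overI[OF X U(1)], goal_cases)
    case (1 V r x)
    with U S show ?case using mod_mor_over_closed[OF \<beta>f, of V "compose (carrier S) r p" x V "idm V"] by simp
  next
    case (2 V W r q x)
    with U S show ?case
      using mod_mor_over_natural_id[OF \<beta>f, of V "compose (carrier S) r p" x W q "tr N U V r n"]
        \<beta>f_nat[of V W "compose (carrier S) r p" q x]
      by simp
  qed
  have e_nat: "e W (compose (carrier S) q p) (tr N U W q n) = fam_restrict K U W q (e U p n)"
    if U: "algebra K U" "algebra K W" "p \<in> alg_hom K S U" "q \<in> alg_hom K U W" "n \<in> carrier (val N U)" for U W p q n
  proof (rule set_mor_over_ext)
    show "e W (compose (carrier S) q p) (tr N U W q n) \<in> set_mor_over K W X base_functor"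
      "fam_restrict K U W q (e U p n) \<in> set_mor_over K W X base_functor"
      using U S by (simp_all add: e_closed fam_restrict_set_mor_over[OF U(1,2,4)])
  qed (use U S in \<open>simp add: e_def\<close>)
  have e_add: "e U p (n \<oplus>\<^bsub>val N U\<^esub> n') = e U p n \<oplus>\<^bsub>val ?A U\<^esub> e U p n'"
    if U: "algebra K U" "p \<in> alg_hom K S U" "n \<in> carrier (val N U)" "n' \<in> carrier (val N U)" for U p n n'
  proof (rule set_mor_over_ext)
    show "e U p (n \<oplus>\<^bsub>val N U\<^esub> n') \<in> set_mor_over K U X base_functor"
      by (intro e_closed U closed_functor_add[OF N'])
    show "e U p n \<oplus>\<^bsub>val ?A U\<^esub> e U p n' \<in> set_mor_over K U X base_functor"
      using closed_functor_add[OF A_closed U(1)] e_closed U by simp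
  next
    fix V r x assume V: "algebra K V" "r \<in> alg_hom K U V" "x \<in> carrier (val X V)"
    show "e U p (n \<oplus>\<^bsub>val N U\<^esub> n') V r x = (e U p n \<oplus>\<^bsub>val ?A U\<^esub> e U p n') V r x"
      using U V S by (simp add: e_def mod_functor_tr_add[OF N] mod_mor_over_add[OF \<beta>f])
  qed
  have e_smult: "e U p (s \<odot>\<^bsub>val N U\<^esub> n) = s \<odot>\<^bsub>val ?A U\<^esub> e U p n"
    if U: "algebra K U" "p \<in> alg_hom K S U" "s \<in> carrier U" "n \<in> carrier (val N U)" for U p s n
  proof (rule set_mor_over_ext)
    show "e U p (s \<odot>\<^bsub>val N U\<^esub> n) \<in> set_mor_over K U X base_functor"
      by (intro e_closed U closed_functor_smult[OF N'])
    show "s \<odot>\<^bsub>val ?A U\<^esub> e U p n \<in> set_mor_over K U X base_functor"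
      using closed_functor_smult[OF A_closed U(1)] e_closed U by simp
  next
    fix V r x assume V: "algebra K V" "r \<in> alg_hom K U V" "x \<in> carrier (val X V)"
    show "e U p (s \<odot>\<^bsub>val N U\<^esub> n) V r x = (s \<odot>\<^bsub>val ?A U\<^esub> e U p n) V r x"
      using U V S alg_hom_closed[OF V(2) U(3)]
      by (simp add: e_def mod_functor_tr_smult[OF N] mod_mor_over_smult[OF \<beta>f])
  qed
  have H_closed: "H T p w \<in> mod_mor_over K T N base_functor"
    if T: "algebra K T" "p \<in> alg_hom K S T" and w: "w \<in> mod_mor_over K T ?A base_functor" for T p w
    unfolding H_def
  proof (rule mod_mor_overI[OF N' T(1)], goal_cases)
    case (1 U q n)
    with T S show ?case using mod_mor_over_closed[OF w, of U q] e_closed by simp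
  next
    case (2 U W q r n)
    with T S show ?case using mod_mor_over_natural[OF w, of U W q r] e_closed
        e_nat[of U W "compose (carrier S) q p" r n] by simp
  next
    case (3 U q n n')
    with T S show ?case using mod_mor_over_add[OF w] e_closed by (simp add: e_add)
  next
    case (4 U q s n)
    with T S show ?case using mod_mor_over_smult[OF w] e_closed by (simp add: e_smult)
  qed
  have J: "J T y \<in> carrier (val M T)" "\<beta> T (J T y) = y"
    if "algebra K T" "y \<in> mod_mor_over K T N base_functor" for T y
    using \<beta>'(7,8)[OF that] by (simp_all add: J_def)
  have J_eq: "J T y = m" if "algebra K T" "m \<in> carrier (val M T)" "y = \<beta> T m" for T y m
    using \<beta>'(6) that by (simp add: J_def)
  let ?F = "fam K S (\<lambda>T p. \<lambda>w\<in>carrier (val (dual K ?A) T). J T (H T p w))"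
  have "?F \<in> mod_mor_over K S (dual K ?A) M"
  proof (rule mod_mor_overI, goal_cases)
    case 1 show ?case by (rule closed_functor_hom[OF A_closed mod_functor_base])
  next
    case (3 T p w) then show ?case by (simp add: J H_closed)
  next
    case (4 T U p q w)
    then have w: "w \<in> mod_mor_over K T ?A base_functor" by simp
    have "H U (compose (carrier S) q p) (fam_restrict K T U q w) = fam_restrict K T U q (H T p w)"
    proof (rule mod_mor_over_ext)
      show "H U (compose (carrier S) q p) (fam_restrict K T U q w) \<in> mod_mor_over K U N base_functor"
        "fam_restrict K T U q (H T p w) \<in> mod_mor_over K U N base_functor"
        using 4 S w by (simp_all add: H_closed fam_restrict_mod_mor_over[OF 4(1,2,4)])
    qed (use 4 S w in \<open>simp add: H_def\<close>)
    also have "\<dots> = \<beta> U (tr M T U q (J T (H T p w)))"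
      using \<beta>'(2)[OF 4(1,2,4), of "J T (H T p w)"] 4 w by (simp add: J H_closed)
    finally show ?case
      using 4 w by (intro J_eq set_functor_closed[OF mod_functor_set[OF M]]) (simp_all add: J H_closed)
  next
    case (5 T p w w')
    then have w: "w \<in> mod_mor_over K T ?A base_functor" "w' \<in> mod_mor_over K T ?A base_functor" by simp_all
    have ww: "w \<oplus>\<^bsub>val (dual K ?A) T\<^esub> w' \<in> mod_mor_over K T ?A base_functor"
      using closed_functor_add[OF closed_functor_hom[OF A_closed mod_functor_base] 5(1,3,4)] by simp
    have hh: "H T p w \<oplus>\<^bsub>val (dual K N) T\<^esub> H T p w' \<in> mod_mor_over K T N base_functor"
      using closed_functor_add[OF closed_functor_hom[OF N' mod_functor_base] 5(1)] H_closed[OF 5(1,2)] w by simp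
    have "H T p (w \<oplus>\<^bsub>val (dual K ?A) T\<^esub> w') = H T p w \<oplus>\<^bsub>val (dual K N) T\<^esub> H T p w'"
      by (rule mod_mor_over_ext[OF H_closed[OF 5(1,2) ww] hh])
        (use 5 S w in \<open>simp_all add: H_def[abs_def] e_closed\<close>)
    then show ?case
      using 5 w by (intro J_eq closed_functor_add[OF mod_functor_closed[OF M]]) (simp_all add: J \<beta>'(3) H_closed)
  next
    case (6 T p t w)
    then have w: "w \<in> mod_mor_over K T ?A base_functor" by simp_all
    have ww: "t \<odot>\<^bsub>val (dual K ?A) T\<^esub> w \<in> mod_mor_over K T ?A base_functor"
      using closed_functor_smult[OF closed_functor_hom[OF A_closed mod_functor_base] 6(1,3,4)] by simp
    have hh: "t \<odot>\<^bsub>val (dual K N) T\<^esub> H T p w \<in> mod_mor_over K T N base_functor"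
      using closed_functor_smult[OF closed_functor_hom[OF N' mod_functor_base] 6(1,3)] H_closed[OF 6(1,2)] w by simp
    have "H T p (t \<odot>\<^bsub>val (dual K ?A) T\<^esub> w) = t \<odot>\<^bsub>val (dual K N) T\<^esub> H T p w"
      by (rule mod_mor_over_ext[OF H_closed[OF 6(1,2) ww] hh])
        (use 6 S w in \<open>simp_all add: H_def[abs_def] e_closed\<close>)
    then show ?case
      using 6 w by (intro J_eq closed_functor_smult[OF mod_functor_closed[OF M]]) (simp_all add: J \<beta>'(4) H_closed)
  qed (use S in simp)
  moreover have "?F T p (eval_map K X T x) = f T p x"
    if T: "algebra K T" "p \<in> alg_hom K S T" "x \<in> carrier (val X T)" for T p x
  proof -
    note x = eval_map_closed[OF X T(1,3)]
    have "H T p (eval_map K X T x) = \<beta> T (f T p x)"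
    proof (rule mod_mor_over_ext[OF H_closed[OF T(1,2) x] \<beta>f[OF T]])
      fix U q n assume U: "algebra K U" "q \<in> alg_hom K T U" "n \<in> carrier (val N U)"
      then show "H T p (eval_map K X T x) U q n = \<beta> T (f T p x) U q n"
        using T S e_closed[of U "compose (carrier S) q p" n] \<beta>f_nat[of T U p q x]
        by (simp add: H_def) (simp add: e_def)
    qed
    then show ?thesis using T x
      by (simp add: J_eq set_mor_over_closed[OF f])
  qed
  ultimately show ?thesis by (rule that)
qed

lemma extends_dual:
  assumes "set_functor K X" "reflexive K (fun_functor K X)"
    and "dual_functor n K M"
  shows "extends K X M"
proof -
  from assms(3) obtain N :: "('a, 'd) modfunctor" and \<beta>
    where M: "mod_functor K M" and N: "mod_functor K N" and \<beta>: "\<beta> \<in> mod_iso K M (dual K N)"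
    by (auto simp: dual_functor_def)
  show ?thesis unfolding extends_def
  proof (intro allI impI)
    fix S f assume S: "algebra K S" and f: "f \<in> set_mor_over K S X M"
    from linear_extension_exists[OF assms(1) M N \<beta> S f] obtain F
      where F: "F \<in> mod_mor_over K S (dual K (fun_functor K X)) M"
        "\<And>T p x. algebra K T \<Longrightarrow> p \<in> alg_hom K S T \<Longrightarrow> x \<in> carrier (val X T) \<Longrightarrow>
          F T p (eval_map K X T x) = f T p x" by blast
    show "\<exists>!F. F \<in> mod_mor_over K S (dual K (fun_functor K X)) M \<and>
       (\<forall>T p x. algebra K T \<longrightarrow> p \<in> alg_hom K S T \<longrightarrow> x \<in> carrier (val X T) \<longrightarrow>
          F T p (eval_map K X T x) = f T p x)"
      using F linear_extension_unique[OF assms(1,2) M N \<beta> S] by (intro ex1I[of _ F]) auto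
  qed
qed

section \<open>Convolution\<close>

abbreviation dist where "dist K G \<equiv> dual K (fun_functor K G)"

lemma fam_cong: "(\<And>T p. algebra K T \<Longrightarrow> p \<in> alg_hom K S T \<Longrightarrow> \<alpha> T p = \<beta> T p) \<Longrightarrow> fam K S \<alpha> = fam K S \<beta>"
  by (auto simp: fam_def fun_eq_iff)

definition left_translate where
  "left_translate K G T f U q g = fam K U (\<lambda>V r. \<lambda>h\<in>carrier (val G V).
     f V (compose (carrier T) r q) (tr G U V r g \<otimes>\<^bsub>val G V\<^esub> h))"

definition contract where
  "contract K G T w f = fam K T (\<lambda>U q. \<lambda>g\<in>carrier (val G U). w U q (left_translate K G T f U q g))"

locale monoid_kfunctor =
  fixes K :: "'u ring" and G :: "('u, 'g) monfunctor"
  assumes monoid_functor: "monoid_functor K G"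
begin

abbreviation "A \<equiv> fun_functor K G"
abbreviation "Fun S \<equiv> set_mor_over K S G base_functor"
abbreviation "Dist S \<equiv> mod_mor_over K S A base_functor"

lemma set_functor_G [simp]: "set_functor K G"
  using monoid_functor by (simp add: monoid_functor_def)

lemma A_closed: "closed_functor K A"
  by (rule closed_functor_fun) simp

lemma dist_closed: "closed_functor K (dist K G)"
  by (rule closed_functor_hom[OF A_closed mod_functor_base])

lemma dist_closed':
  "algebra K S \<Longrightarrow> w \<in> Dist S \<Longrightarrow> w' \<in> Dist S \<Longrightarrow>
    w \<oplus>\<^bsub>val (dist K G) S\<^esub> w' \<in> Dist S"
  "algebra K S \<Longrightarrow> s \<in> carrier S \<Longrightarrow> w \<in> Dist S \<Longrightarrow>
    s \<odot>\<^bsub>val (dist K G) S\<^esub> w \<in> Dist S"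
  using closed_functor_add[OF dist_closed] closed_functor_smult[OF dist_closed] by simp_all

lemma A_closed':
  "algebra K S \<Longrightarrow> f \<in> Fun S \<Longrightarrow> f' \<in> Fun S \<Longrightarrow>
    f \<oplus>\<^bsub>val A S\<^esub> f' \<in> Fun S"
  "algebra K S \<Longrightarrow> s \<in> carrier S \<Longrightarrow> f \<in> Fun S \<Longrightarrow>
    s \<odot>\<^bsub>val A S\<^esub> f \<in> Fun S"
  using closed_functor_add[OF A_closed] closed_functor_smult[OF A_closed] by simp_all

lemmas [simp] = set_functor_closed[OF set_functor_G] set_functor_compose[OF set_functor_G]
  set_functor_id[OF set_functor_G]

lemma G_mult_closed [simp]:
  "algebra K S \<Longrightarrow> g \<in> carrier (val G S) \<Longrightarrow> h \<in> carrier (val G S) \<Longrightarrow>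
    g \<otimes>\<^bsub>val G S\<^esub> h \<in> carrier (val G S)"
  using monoid_functor by (auto simp: monoid_functor_def intro: monoid.m_closed)

lemma G_one_closed [simp]: "algebra K S \<Longrightarrow> \<one>\<^bsub>val G S\<^esub> \<in> carrier (val G S)"
  using monoid_functor by (auto simp: monoid_functor_def intro: monoid.one_closed)

lemma G_tr_mult:
  "algebra K S \<Longrightarrow> algebra K T \<Longrightarrow> p \<in> alg_hom K S T \<Longrightarrow> g \<in> carrier (val G S) \<Longrightarrow>
    h \<in> carrier (val G S) \<Longrightarrow>
    tr G S T p (g \<otimes>\<^bsub>val G S\<^esub> h) = tr G S T p g \<otimes>\<^bsub>val G T\<^esub> tr G S T p h"
  using monoid_functor by (auto simp: monoid_functor_def hom_def)

lemma G_tr_one: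
  "algebra K S \<Longrightarrow> algebra K T \<Longrightarrow> p \<in> alg_hom K S T \<Longrightarrow> tr G S T p \<one>\<^bsub>val G S\<^esub> = \<one>\<^bsub>val G T\<^esub>"
  using monoid_functor by (auto simp: monoid_functor_def)

lemma left_translate_closed:
  assumes f: "f \<in> Fun T"
    and T: "algebra K T" and U: "algebra K U" "q \<in> alg_hom K T U" "g \<in> carrier (val G U)"
  shows "left_translate K G T f U q g \<in> Fun U"
  unfolding left_translate_def
proof (rule set_mor_overI[OF set_functor_G U(1)], goal_cases)
  case (1 V r h)
  with T U show ?case using set_mor_over_closed[OF f, of V "compose (carrier T) r q"] by simp
next
  case (2 V W r s h)
  with T U show ?case
    using set_mor_over_natural[OF f, of V W "compose (carrier T) r q" s "tr G U V r g \<otimes>\<^bsub>val G V\<^esub> h"]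
    by (simp add: G_tr_mult)
qed

lemma left_translate_natural:
  assumes f: "f \<in> Fun T" and T: "algebra K T"
    and U: "algebra K U" "q \<in> alg_hom K T U" "g \<in> carrier (val G U)"
    and V: "algebra K V" "r \<in> alg_hom K U V"
  shows "left_translate K G T f V (compose (carrier T) r q) (tr G U V r g) =
    fam_restrict K U V r (left_translate K G T f U q g)"
proof (rule set_mor_over_ext)
  show "left_translate K G T f V (compose (carrier T) r q) (tr G U V r g) \<in> Fun V"
    "fam_restrict K U V r (left_translate K G T f U q g) \<in> Fun V"
    using assms by (auto intro!: left_translate_closed fam_restrict_set_mor_over)
qed (use assms in \<open>simp add: left_translate_def\<close>)

lemma left_translate_restrict:
  assumes f: "f \<in> Fun S" and S: "algebra K S"
    and T: "algebra K T" "p \<in> alg_hom K S T"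
    and U: "algebra K U" "q \<in> alg_hom K T U" "g \<in> carrier (val G U)"
  shows "left_translate K G T (fam_restrict K S T p f) U q g =
    left_translate K G S f U (compose (carrier S) q p) g"
proof (rule set_mor_over_ext)
  show "left_translate K G T (fam_restrict K S T p f) U q g \<in> Fun U"
    "left_translate K G S f U (compose (carrier S) q p) g \<in> Fun U"
    using assms by (auto intro!: left_translate_closed fam_restrict_set_mor_over)
qed (use assms in \<open>simp add: left_translate_def\<close>)

lemma left_translate_add:
  assumes f: "f \<in> Fun T" "f' \<in> Fun T"
    and T: "algebra K T" and U: "algebra K U" "q \<in> alg_hom K T U" "g \<in> carrier (val G U)"
  shows "left_translate K G T (f \<oplus>\<^bsub>val A T\<^esub> f') U q g =
    left_translate K G T f U q g \<oplus>\<^bsub>val A U\<^esub> left_translate K G T f' U q g"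
proof (rule set_mor_over_ext)
  show "left_translate K G T (f \<oplus>\<^bsub>val A T\<^esub> f') U q g \<in> Fun U"
    "left_translate K G T f U q g \<oplus>\<^bsub>val A U\<^esub> left_translate K G T f' U q g \<in> Fun U"
    using assms by (auto intro!: left_translate_closed A_closed')
qed (use assms in \<open>simp add: left_translate_def\<close>)

lemma left_translate_smult:
  assumes f: "f \<in> Fun T" and s: "s \<in> carrier T"
    and T: "algebra K T" and U: "algebra K U" "q \<in> alg_hom K T U" "g \<in> carrier (val G U)"
  shows "left_translate K G T (s \<odot>\<^bsub>val A T\<^esub> f) U q g = q s \<odot>\<^bsub>val A U\<^esub> left_translate K G T f U q g"
proof (rule set_mor_over_ext)
  show "left_translate K G T (s \<odot>\<^bsub>val A T\<^esub> f) U q g \<in> Fun U"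
    "q s \<odot>\<^bsub>val A U\<^esub> left_translate K G T f U q g \<in> Fun U"
    using assms by (auto intro!: left_translate_closed A_closed' alg_hom_closed[OF U(2)])
qed (use assms in \<open>simp add: left_translate_def\<close>)

lemma contract_closed:
  assumes w: "w \<in> Dist T" and f: "f \<in> Fun T"
    and T: "algebra K T"
  shows "contract K G T w f \<in> Fun T"
  unfolding contract_def
proof (rule set_mor_overI[OF set_functor_G T], goal_cases)
  case (1 U q g)
  with T f show ?case using mod_mor_over_closed[OF w, of U q] left_translate_closed by simp
next
  case (2 U V q r g)
  with T f show ?case using mod_mor_over_natural[OF w, of U V q r] left_translate_closed
    by (simp add: left_translate_natural)
qed

lemma contract_restrict:
  assumes w: "w \<in> Dist S" and f: "f \<in> Fun S"
    and S: "algebra K S" and T: "algebra K T" "p \<in> alg_hom K S T"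
  shows "contract K G T (fam_restrict K S T p w) (fam_restrict K S T p f) =
    fam_restrict K S T p (contract K G S w f)"
proof (rule set_mor_over_ext)
  show "contract K G T (fam_restrict K S T p w) (fam_restrict K S T p f) \<in> Fun T"
    "fam_restrict K S T p (contract K G S w f) \<in> Fun T"
    using assms by (auto intro!: contract_closed fam_restrict_set_mor_over fam_restrict_mod_mor_over)
qed (use assms in \<open>simp add: contract_def left_translate_restrict\<close>)

lemma contract_add_right:
  assumes w: "w \<in> Dist T"
    and f: "f \<in> Fun T" "f' \<in> Fun T"
    and T: "algebra K T"
  shows "contract K G T w (f \<oplus>\<^bsub>val A T\<^esub> f') = contract K G T w f \<oplus>\<^bsub>val A T\<^esub> contract K G T w f'"
proof (rule set_mor_over_ext)
  show "contract K G T w (f \<oplus>\<^bsub>val A T\<^esub> f') \<in> Fun T"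
    "contract K G T w f \<oplus>\<^bsub>val A T\<^esub> contract K G T w f' \<in> Fun T"
    using assms by (auto intro!: contract_closed A_closed')
qed (use assms mod_mor_over_add[OF w] in \<open>simp add: contract_def left_translate_add left_translate_closed\<close>)

lemma contract_smult_right:
  assumes w: "w \<in> Dist T" and f: "f \<in> Fun T"
    and T: "algebra K T" and s: "s \<in> carrier T"
  shows "contract K G T w (s \<odot>\<^bsub>val A T\<^esub> f) = s \<odot>\<^bsub>val A T\<^esub> contract K G T w f"
proof (rule set_mor_over_ext)
  show "contract K G T w (s \<odot>\<^bsub>val A T\<^esub> f) \<in> Fun T"
    "s \<odot>\<^bsub>val A T\<^esub> contract K G T w f \<in> Fun T"
    using assms by (auto intro!: contract_closed A_closed')
qed (use assms mod_mor_over_smult[OF w] in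
    \<open>simp add: contract_def left_translate_smult left_translate_closed alg_hom_closed[of _ K T]\<close>)

lemma contract_add_left:
  assumes w: "w \<in> Dist T" "w' \<in> Dist T"
    and f: "f \<in> Fun T"
    and T: "algebra K T"
  shows "contract K G T (w \<oplus>\<^bsub>val (dist K G) T\<^esub> w') f = contract K G T w f \<oplus>\<^bsub>val A T\<^esub> contract K G T w' f"
proof (rule set_mor_over_ext)
  show "contract K G T (w \<oplus>\<^bsub>val (dist K G) T\<^esub> w') f \<in> Fun T"
    "contract K G T w f \<oplus>\<^bsub>val A T\<^esub> contract K G T w' f \<in> Fun T"
    using assms by (auto intro!: contract_closed A_closed' dist_closed')
qed (use assms in \<open>simp add: contract_def left_translate_closed\<close>)

lemma contract_smult_left:
  assumes w: "w \<in> Dist T" and f: "f \<in> Fun T"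
    and T: "algebra K T" and s: "s \<in> carrier T"
  shows "contract K G T (s \<odot>\<^bsub>val (dist K G) T\<^esub> w) f = s \<odot>\<^bsub>val A T\<^esub> contract K G T w f"
proof (rule set_mor_over_ext)
  show "contract K G T (s \<odot>\<^bsub>val (dist K G) T\<^esub> w) f \<in> Fun T"
    "s \<odot>\<^bsub>val A T\<^esub> contract K G T w f \<in> Fun T"
    using assms by (auto intro!: contract_closed A_closed' dist_closed')
qed (use assms in \<open>simp add: contract_def left_translate_closed\<close>)

lemma convolution_eq:
  "convolution K G S w w' = fam K S (\<lambda>T p. \<lambda>f\<in>carrier (val A T). w T p (contract K G T (fam_restrict K S T p w') f))"
proof -
  have "fam K T (\<lambda>U q. \<lambda>g\<in>carrier (val G U). w' U (compose (carrier S) q p) (left_translate K G T f U q g)) =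
      contract K G T (fam_restrict K S T p w') f" if "algebra K T" "p \<in> alg_hom K S T" for T p f
    unfolding contract_def using that by (intro fam_cong) simp
  then show ?thesis
    unfolding convolution_def left_translate_def[symmetric] by (intro fam_cong) simp
qed

lemma convolution_apply:
  assumes "algebra K T" "p \<in> alg_hom K S T" "f \<in> Fun T"
  shows "convolution K G S w w' T p f = w T p (contract K G T (fam_restrict K S T p w') f)"
  using assms by (simp add: convolution_eq)

lemma convolution_closed:
  assumes w: "w \<in> Dist S" and w': "w' \<in> Dist S"
    and S: "algebra K S"
  shows "convolution K G S w w' \<in> Dist S"
  unfolding convolution_eq
proof (rule mod_mor_overI[OF A_closed S], goal_cases)
  have r: "fam_restrict K S T p w' \<in> Dist T" if "algebra K T" "p \<in> alg_hom K S T" for T p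
    using that S w' by (auto intro: fam_restrict_mod_mor_over)
  {
    case (1 T p f)
    then show ?case using mod_mor_over_closed[OF w] contract_closed[OF r] by simp
  next
    case (2 T U p q f)
    then have f: "f \<in> Fun T" by simp
    have "contract K G U (fam_restrict K S U (compose (carrier S) q p) w') (fam_restrict K T U q f) =
        fam_restrict K T U q (contract K G T (fam_restrict K S T p w') f)"
      using 2 S f by (simp add: contract_restrict[OF r, symmetric] fam_restrict_compose)
    then show ?case
      using mod_mor_over_natural[OF w 2(1-4), of "contract K G T (fam_restrict K S T p w') f"] 2 f
      by (simp add: contract_closed[OF r])
  next
    case (3 T p f f')
    then show ?case using mod_mor_over_add[OF w 3(1,2)] r
      by (simp add: contract_add_right contract_closed)
  next
    case (4 T p s f)
    then show ?case using mod_mor_over_smult[OF w 4(1,2)] r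
      by (simp add: contract_smult_right contract_closed)
  }
qed

lemma convolution_natural:
  assumes w: "w \<in> Dist S" and w': "w' \<in> Dist S"
    and S: "algebra K S" and T: "algebra K T" "p \<in> alg_hom K S T"
  shows "fam_restrict K S T p (convolution K G S w w') =
    convolution K G T (fam_restrict K S T p w) (fam_restrict K S T p w')"
proof (rule mod_mor_over_ext)
  show "fam_restrict K S T p (convolution K G S w w') \<in> Dist T"
    "convolution K G T (fam_restrict K S T p w) (fam_restrict K S T p w') \<in> Dist T"
    using assms by (auto intro!: convolution_closed fam_restrict_mod_mor_over)
qed (use assms in \<open>simp add: convolution_apply fam_restrict_compose\<close>)

lemma dist_restrict_add:
  assumes "w \<in> Dist S" "w' \<in> Dist S"
    and "algebra K S" and "algebra K T" "p \<in> alg_hom K S T"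
  shows "fam_restrict K S T p (w \<oplus>\<^bsub>val (dist K G) S\<^esub> w') =
    fam_restrict K S T p w \<oplus>\<^bsub>val (dist K G) T\<^esub> fam_restrict K S T p w'"
proof (rule mod_mor_over_ext)
  show "fam_restrict K S T p (w \<oplus>\<^bsub>val (dist K G) S\<^esub> w') \<in> Dist T"
    "fam_restrict K S T p w \<oplus>\<^bsub>val (dist K G) T\<^esub> fam_restrict K S T p w' \<in> Dist T"
    using assms by (auto intro!: dist_closed' fam_restrict_mod_mor_over)
qed (use assms in \<open>simp\<close>)

lemma dist_restrict_smult:
  assumes "w \<in> Dist S" "s \<in> carrier S"
    and "algebra K S" and "algebra K T" "p \<in> alg_hom K S T"
  shows "fam_restrict K S T p (s \<odot>\<^bsub>val (dist K G) S\<^esub> w) = p s \<odot>\<^bsub>val (dist K G) T\<^esub> fam_restrict K S T p w"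
proof (rule mod_mor_over_ext)
  show "fam_restrict K S T p (s \<odot>\<^bsub>val (dist K G) S\<^esub> w) \<in> Dist T"
    "p s \<odot>\<^bsub>val (dist K G) T\<^esub> fam_restrict K S T p w \<in> Dist T"
    using assms by (auto intro!: dist_closed' fam_restrict_mod_mor_over alg_hom_closed[OF assms(5)])
qed (use assms in \<open>simp\<close>)

lemma convolution_add_left:
  assumes "w \<in> Dist S" "v \<in> Dist S"
    and "w' \<in> Dist S" and "algebra K S"
  shows "convolution K G S (w \<oplus>\<^bsub>val (dist K G) S\<^esub> v) w' =
    convolution K G S w w' \<oplus>\<^bsub>val (dist K G) S\<^esub> convolution K G S v w'"
proof (rule mod_mor_over_ext)
  show "convolution K G S (w \<oplus>\<^bsub>val (dist K G) S\<^esub> v) w' \<in> Dist S"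
    "convolution K G S w w' \<oplus>\<^bsub>val (dist K G) S\<^esub> convolution K G S v w' \<in> Dist S"
    using assms by (auto intro!: dist_closed' convolution_closed)
qed (use assms in \<open>simp add: convolution_apply contract_closed fam_restrict_mod_mor_over\<close>)

lemma convolution_smult_left:
  assumes "w \<in> Dist S" "s \<in> carrier S"
    and "w' \<in> Dist S" and "algebra K S"
  shows "convolution K G S (s \<odot>\<^bsub>val (dist K G) S\<^esub> w) w' = s \<odot>\<^bsub>val (dist K G) S\<^esub> convolution K G S w w'"
proof (rule mod_mor_over_ext)
  show "convolution K G S (s \<odot>\<^bsub>val (dist K G) S\<^esub> w) w' \<in> Dist S"
    "s \<odot>\<^bsub>val (dist K G) S\<^esub> convolution K G S w w' \<in> Dist S"
    using assms by (auto intro!: dist_closed' convolution_closed)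
qed (use assms in \<open>simp add: convolution_apply contract_closed fam_restrict_mod_mor_over\<close>)

lemma convolution_add_right:
  assumes w: "w \<in> Dist S" and "v \<in> Dist S"
    and "w' \<in> Dist S" and S: "algebra K S"
  shows "convolution K G S w (v \<oplus>\<^bsub>val (dist K G) S\<^esub> w') =
    convolution K G S w v \<oplus>\<^bsub>val (dist K G) S\<^esub> convolution K G S w w'"
proof (rule mod_mor_over_ext)
  show "convolution K G S w (v \<oplus>\<^bsub>val (dist K G) S\<^esub> w') \<in> Dist S"
    "convolution K G S w v \<oplus>\<^bsub>val (dist K G) S\<^esub> convolution K G S w w' \<in> Dist S"
    using assms by (auto intro!: dist_closed' convolution_closed)
  fix T p f assume T: "algebra K T" "p \<in> alg_hom K S T" "f \<in> carrier (val A T)"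
  then show "convolution K G S w (v \<oplus>\<^bsub>val (dist K G) S\<^esub> w') T p f =
      (convolution K G S w v \<oplus>\<^bsub>val (dist K G) S\<^esub> convolution K G S w w') T p f"
    using assms mod_mor_over_add[OF w T(1,2)]
    by (simp add: convolution_apply dist_restrict_add  contract_closed contract_add_left fam_restrict_mod_mor_over)
qed

lemma convolution_smult_right:
  assumes w: "w \<in> Dist S" and "s \<in> carrier S"
    and "w' \<in> Dist S" and S: "algebra K S"
  shows "convolution K G S w (s \<odot>\<^bsub>val (dist K G) S\<^esub> w') =
    s \<odot>\<^bsub>val (dist K G) S\<^esub> convolution K G S w w'"
proof (rule mod_mor_over_ext)
  show "convolution K G S w (s \<odot>\<^bsub>val (dist K G) S\<^esub> w') \<in> Dist S"
    "s \<odot>\<^bsub>val (dist K G) S\<^esub> convolution K G S w w' \<in> Dist S"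
    using assms by (auto intro!: dist_closed' convolution_closed)
  fix T p f assume T: "algebra K T" "p \<in> alg_hom K S T" "f \<in> carrier (val A T)"
  have "(s \<odot>\<^bsub>val (dist K G) S\<^esub> convolution K G S w w') T p f = p s \<otimes>\<^bsub>T\<^esub> convolution K G S w w' T p f"
    using T by simp
  then show "convolution K G S w (s \<odot>\<^bsub>val (dist K G) S\<^esub> w') T p f =
      (s \<odot>\<^bsub>val (dist K G) S\<^esub> convolution K G S w w') T p f"
    using assms T mod_mor_over_smult[OF w T(1,2)] alg_hom_closed[OF T(2), of s]
    by (simp add: convolution_apply dist_restrict_smult contract_closed contract_smult_left
      fam_restrict_mod_mor_over)
qed

lemma convolution_eval:
  assumes S: "algebra K S" and g: "g \<in> carrier (val G S)" "h \<in> carrier (val G S)"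
  shows "convolution K G S (eval_map K G S g) (eval_map K G S h) = eval_map K G S (g \<otimes>\<^bsub>val G S\<^esub> h)"
proof (rule mod_mor_over_ext)
  show "convolution K G S (eval_map K G S g) (eval_map K G S h) \<in> Dist S"
    "eval_map K G S (g \<otimes>\<^bsub>val G S\<^esub> h) \<in> Dist S"
    using assms by (auto intro!: eval_map_closed convolution_closed)
  fix T p f assume T: "algebra K T" "p \<in> alg_hom K S T" "f \<in> carrier (val A T)"
  let ?c = "contract K G T (fam_restrict K S T p (eval_map K G S h)) f"
  have "?c T (idm T) (tr G S T p g) = f T (idm T) (tr G S T p g \<otimes>\<^bsub>val G T\<^esub> tr G S T p h)"
    using S T g left_translate_closed[of f T T "idm T" "tr G S T p g"]
    by (simp add: contract_def) (simp add: left_translate_def)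
  then show "convolution K G S (eval_map K G S g) (eval_map K G S h) T p f =
      eval_map K G S (g \<otimes>\<^bsub>val G S\<^esub> h) T p f"
    using S T g contract_closed[of "fam_restrict K S T p (eval_map K G S h)" T f]
    by (simp add: convolution_apply fam_restrict_mod_mor_over eval_map_closed G_tr_mult)
qed

end

section \<open>Modules over the monoid and over its distributions\<close>

definition lin_ext where
  "lin_ext K X M S f = (THE F. F \<in> mod_mor_over K S (dual K (fun_functor K X)) M \<and>
     (\<forall>T p x. algebra K T \<longrightarrow> p \<in> alg_hom K S T \<longrightarrow> x \<in> carrier (val X T) \<longrightarrow>
       F T p (eval_map K X T x) = f T p x))"

lemma lin_ext:
  assumes "extends K X M" "algebra K S" "f \<in> set_mor_over K S X M"
  shows "lin_ext K X M S f \<in> mod_mor_over K S (dual K (fun_functor K X)) M"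
    and "algebra K T \<Longrightarrow> p \<in> alg_hom K S T \<Longrightarrow> x \<in> carrier (val X T) \<Longrightarrow>
      lin_ext K X M S f T p (eval_map K X T x) = f T p x"
proof -
  have "\<exists>!F. F \<in> mod_mor_over K S (dual K (fun_functor K X)) M \<and>
     (\<forall>T p x. algebra K T \<longrightarrow> p \<in> alg_hom K S T \<longrightarrow> x \<in> carrier (val X T) \<longrightarrow>
       F T p (eval_map K X T x) = f T p x)"
    using assms unfolding extends_def by blast
  from theI'[OF this] show "lin_ext K X M S f \<in> mod_mor_over K S (dual K (fun_functor K X)) M"
    and "algebra K T \<Longrightarrow> p \<in> alg_hom K S T \<Longrightarrow> x \<in> carrier (val X T) \<Longrightarrow>
      lin_ext K X M S f T p (eval_map K X T x) = f T p x"
    unfolding lin_ext_def by blast+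
qed

lemma extends_unique:
  assumes X: "set_functor K X" and ext: "extends K X M" and S: "algebra K S"
    and F: "F \<in> mod_mor_over K S (dual K (fun_functor K X)) M"
    and F': "F' \<in> mod_mor_over K S (dual K (fun_functor K X)) M"
    and agree: "\<And>T p x. algebra K T \<Longrightarrow> p \<in> alg_hom K S T \<Longrightarrow> x \<in> carrier (val X T) \<Longrightarrow>
      F T p (eval_map K X T x) = F' T p (eval_map K X T x)"
  shows "F = F'"
proof -
  let ?f = "fam K S (\<lambda>T p. \<lambda>x\<in>carrier (val X T). F T p (eval_map K X T x))"
  have "?f \<in> set_mor_over K S X M"
  proof (rule set_mor_overI[OF X S], goal_cases)
    case (1 T p x)
    then show ?case using mod_mor_over_closed[OF F, of T p] eval_map_closed[OF X] by simp
  next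
    case (2 T U p q x)
    then show ?case using mod_mor_over_natural[OF F, of T U p q] eval_map_closed[OF X]
      by (simp add: eval_map_natural[OF X])
  qed
  then have "\<exists>!F. F \<in> mod_mor_over K S (dual K (fun_functor K X)) M \<and>
     (\<forall>T p x. algebra K T \<longrightarrow> p \<in> alg_hom K S T \<longrightarrow> x \<in> carrier (val X T) \<longrightarrow>
       F T p (eval_map K X T x) = ?f T p x)"
    using ext S unfolding extends_def by blast
  moreover have "F T p (eval_map K X T x) = ?f T p x \<and> F' T p (eval_map K X T x) = ?f T p x"
    if "algebra K T" "p \<in> alg_hom K S T" "x \<in> carrier (val X T)" for T p x
    using that agree by simp
  ultimately show ?thesis using F F' by blast
qed

lemma actionD:
  assumes "\<rho> \<in> set_mor K H (end_functor K M)" "algebra K S" "h \<in> carrier (val H S)"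
  shows "\<rho> S h \<in> mod_mor_over K S M M"
    and "algebra K T \<Longrightarrow> p \<in> alg_hom K S T \<Longrightarrow> \<rho> T (tr H S T p h) = fam_restrict K S T p (\<rho> S h)"
    and "algebra K T \<Longrightarrow> p \<in> alg_hom K S T \<Longrightarrow> \<rho> T (tr H S T p h) T (idm T) = \<rho> S h T p"
proof -
  show "\<rho> S h \<in> mod_mor_over K S M M"
    using assms by (auto simp: set_mor_def)
  show *: "algebra K T \<Longrightarrow> p \<in> alg_hom K S T \<Longrightarrow> \<rho> T (tr H S T p h) = fam_restrict K S T p (\<rho> S h)"
    using assms by (simp add: set_mor_def)
  show "algebra K T \<Longrightarrow> p \<in> alg_hom K S T \<Longrightarrow> \<rho> T (tr H S T p h) T (idm T) = \<rho> S h T p"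
    by (simp add: *)
qed

definition orbit where
  "orbit K H M \<rho> S m = fam K S (\<lambda>T p. \<lambda>h\<in>carrier (val H T). \<rho> T h T (idm T) (tr M S T p m))"

lemma orbit_natural:
  assumes M: "mod_functor K M" and \<rho>: "\<rho> \<in> set_mor K H (end_functor K M)"
    and S: "algebra K S" and m: "m \<in> carrier (val M S)"
    and T: "algebra K T" "algebra K U" "p \<in> alg_hom K S T" "q \<in> alg_hom K T U" "h \<in> carrier (val H T)"
  shows "\<rho> U (tr H T U q h) U (idm U) (tr M S U (compose (carrier S) q p) m) =
    tr M T U q (\<rho> T h T (idm T) (tr M S T p m))"
  using mod_mor_over_natural_id[OF actionD(1)[OF \<rho> T(1,5)] T(1,2,4), of "tr M S T p m"] S T m
  by (simp add: actionD(3)[OF \<rho>] set_functor_closed[OF mod_functor_set[OF M]] set_functor_compose[OF mod_functor_set[OF M]])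

lemma orbit_set_mor:
  assumes H: "set_functor K H" and M: "mod_functor K M" and \<rho>: "\<rho> \<in> set_mor K H (end_functor K M)"
    and S: "algebra K S" and m: "m \<in> carrier (val M S)"
  shows "orbit K H M \<rho> S m \<in> set_mor_over K S H M"
  unfolding orbit_def
proof (rule set_mor_overI[OF H S], goal_cases)
  case (1 T p h)
  with S m show ?case
    by (intro mod_mor_over_closed[OF actionD(1)[OF \<rho>]] set_functor_closed[OF mod_functor_set[OF M]]) auto
next
  case (2 T U p q h)
  then show ?case by (rule orbit_natural[OF M \<rho> S m])
qed

lemma orbit_mod_mor:
  assumes H: "closed_functor K H" and M: "mod_functor K M" and \<rho>: "\<rho> \<in> mod_mor K H (end_functor K M)"
    and S: "algebra K S" and m: "m \<in> carrier (val M S)"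
  shows "orbit K H M \<rho> S m \<in> mod_mor_over K S H M"
  unfolding orbit_def
proof (rule mod_mor_overI[OF H S], goal_cases)
  have \<rho>': "\<rho> \<in> set_mor K H (end_functor K M)" using \<rho> by (simp add: mod_mor_def)
  note M' = set_functor_closed[OF mod_functor_set[OF M]]
  {
    case (1 T p h)
    with S m show ?case
      by (intro mod_mor_over_closed[OF actionD(1)[OF \<rho>']] M') auto
  next
    case (2 T U p q h)
    then show ?case by (rule orbit_natural[OF M \<rho>' S m])
  next
    case (3 T p h h')
    then have "\<rho> T (h \<oplus>\<^bsub>val H T\<^esub> h') = \<rho> T h \<oplus>\<^bsub>val (end_functor K M) T\<^esub> \<rho> T h'"
      using \<rho> by (simp add: mod_mor_def linear_maps_def)
    with 3 S m show ?case by (simp add: M')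
  next
    case (4 T p t h)
    then have "\<rho> T (t \<odot>\<^bsub>val H T\<^esub> h) = t \<odot>\<^bsub>val (end_functor K M) T\<^esub> \<rho> T h"
      using \<rho> by (simp add: mod_mor_def linear_maps_def)
    with 4 S m show ?case by (simp add: M')
  }
qed

definition act where
  "act K G M \<rho> S w m = lin_ext K G M S (orbit K G M \<rho> S m) S (idm S) w"

definition extension where
  "extension K G M \<rho> = (\<lambda>S. if algebra K S
     then \<lambda>w\<in>carrier (val (dist_algebra K G) S). fam K S (\<lambda>T p. \<lambda>x\<in>carrier (val M T).
       act K G M \<rho> T (fam_restrict K S T p w) x)
     else undefined)"

definition restriction where
  "restriction K G \<rho> = (\<lambda>S. if algebra K S
     then compose (carrier (val G S)) (\<rho> S) (eval_map K G S) else undefined)"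

context monoid_kfunctor begin

lemma mod_mor_over_dist_algebra:
  "mod_mor_over K S (dist_algebra K G) M = mod_mor_over K S (dist K G) M"
  by (simp add: mod_mor_over_def set_mor_over_def linear_maps_def)

lemma closed_dist_algebra: "closed_functor K (dist_algebra K G)"
  using dist_closed by (simp add: closed_functor_def)

lemma restriction_apply [simp]:
  "algebra K S \<Longrightarrow> g \<in> carrier (val G S) \<Longrightarrow> restriction K G \<rho> S g = \<rho> S (eval_map K G S g)"
  by (simp add: restriction_def)

lemma restriction_monoid_mor:
  assumes "\<rho> \<in> monoid_mor K (dist_algebra K G) N"
  shows "restriction K G \<rho> \<in> monoid_mor K G N"
  unfolding monoid_mor_def set_mor_def hom_def
proof (intro CollectI conjI allI impI ballI)
  fix S :: "'u alg" assume S: "algebra K S"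
  have "\<rho> S \<in> Dist S \<rightarrow>\<^sub>E carrier (val N S)"
    using assms S by (simp add: monoid_mor_def set_mor_def)
  then show "restriction K G \<rho> S \<in> carrier (val G S) \<rightarrow>\<^sub>E carrier (val N S)"
    "restriction K G \<rho> S \<in> carrier (val G S) \<rightarrow> carrier (val N S)"
    using S by (auto simp: eval_map_closed) (simp_all add: restriction_def compose_def)
  fix g h assume g: "g \<in> carrier (val G S)" "h \<in> carrier (val G S)"
  have "\<rho> S (v \<otimes>\<^bsub>val (dist_algebra K G) S\<^esub> w) = \<rho> S v \<otimes>\<^bsub>val N S\<^esub> \<rho> S w"
    if "v \<in> Dist S" "w \<in> Dist S" for v w
    using assms S that by (simp add: monoid_mor_def hom_def)
  then show "restriction K G \<rho> S (g \<otimes>\<^bsub>val G S\<^esub> h) = restriction K G \<rho> S g \<otimes>\<^bsub>val N S\<^esub> restriction K G \<rho> S h"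
    using S g by (simp add: eval_map_closed flip: convolution_eval)
qed (use assms in \<open>simp_all add: monoid_mor_def set_mor_def restriction_def eval_map_natural eval_map_closed\<close>)

lemma restriction_inj:
  assumes M: "mod_functor K M" and ext: "extends K G M"
    and \<rho>: "\<rho> \<in> mod_mor K (dist_algebra K G) (end_functor K M)"
    and \<rho>': "\<rho>' \<in> mod_mor K (dist_algebra K G) (end_functor K M)"
    and eq: "restriction K G \<rho> = restriction K G \<rho>'"
  shows "\<rho> = \<rho>'"
proof -
  let ?D = "dist_algebra K G"
  have s: "\<rho> \<in> set_mor K ?D (end_functor K M)" "\<rho>' \<in> set_mor K ?D (end_functor K M)"
    using \<rho> \<rho>' by (simp_all add: mod_mor_def)
  have orb: "orbit K ?D M \<rho> T m = orbit K ?D M \<rho>' T m" if T: "algebra K T" "m \<in> carrier (val M T)" for T m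
  proof (rule extends_unique[OF set_functor_G ext T(1)])
    show "orbit K ?D M \<rho> T m \<in> mod_mor_over K T (dist K G) M"
      "orbit K ?D M \<rho>' T m \<in> mod_mor_over K T (dist K G) M"
      using orbit_mod_mor[OF closed_dist_algebra M] \<rho> \<rho>' T by (simp_all add: mod_mor_over_dist_algebra)
    fix U p g assume U: "algebra K U" "p \<in> alg_hom K T U" "g \<in> carrier (val G U)"
    then have "\<rho> U (eval_map K G U g) = \<rho>' U (eval_map K G U g)"
      using fun_cong[OF fun_cong[OF eq, of U], of g] by simp
    then show "orbit K ?D M \<rho> T m U p (eval_map K G U g) = orbit K ?D M \<rho>' T m U p (eval_map K G U g)"
      using U by (simp add: orbit_def eval_map_closed)
  qed
  have "\<rho> S w = \<rho>' S w" if S: "algebra K S" "w \<in> carrier (val ?D S)" for S w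
  proof (rule mod_mor_over_ext)
    show "\<rho> S w \<in> mod_mor_over K S M M" "\<rho>' S w \<in> mod_mor_over K S M M"
      using actionD(1)[OF s(1) S] actionD(1)[OF s(2) S] by simp_all
    fix T p m assume T: "algebra K T" "p \<in> alg_hom K S T" "m \<in> carrier (val M T)"
    have r: "fam_restrict K S T p w \<in> carrier (val ?D T)"
      using S T by (simp add: fam_restrict_mod_mor_over)
    have "\<rho> T (fam_restrict K S T p w) T (idm T) m = \<rho>' T (fam_restrict K S T p w) T (idm T) m"
      using arg_cong[OF orb[OF T(1,3)], of "\<lambda>f. f T (idm T) (fam_restrict K S T p w)"] r T
        set_functor_id[OF mod_functor_set[OF M] T(1,3)]
      by (simp add: orbit_def)
    then show "\<rho> S w T p m = \<rho>' S w T p m"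
      using actionD(3)[OF s(1) S T(1,2)] actionD(3)[OF s(2) S T(1,2)] by simp
  qed
  then have "\<rho> S = \<rho>' S" if "algebra K S" for S
    using s that by (intro PiE_ext[of _ "carrier (val ?D S)" "\<lambda>_. mod_mor_over K S M M"])
      (auto simp: set_mor_def)
  moreover have "\<rho> S = \<rho>' S" if "\<not> algebra K S" for S
    using s that by (simp add: set_mor_def)
  ultimately show ?thesis by blast
qed

lemma rep_mor_restriction:
  assumes M: "mod_functor K M" and M': "mod_functor K M'" and ext: "extends K G M'"
    and \<rho>: "\<rho> \<in> mod_mor K (dist_algebra K G) (end_functor K M)"
    and \<rho>': "\<rho>' \<in> mod_mor K (dist_algebra K G) (end_functor K M')"
  shows "rep_mor K G (M, restriction K G \<rho>) (M', restriction K G \<rho>') =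
    rep_mor K (dist_algebra K G) (M, \<rho>) (M', \<rho>')"
proof (intro equalityI subsetI)
  let ?D = "dist_algebra K G"
  fix \<alpha> assume "\<alpha> \<in> rep_mor K ?D (M, \<rho>) (M', \<rho>')"
  then show "\<alpha> \<in> rep_mor K G (M, restriction K G \<rho>) (M', restriction K G \<rho>')"
    by (auto simp: rep_mor_def eval_map_closed)
next
  let ?D = "dist_algebra K G"
  have s: "\<rho> \<in> set_mor K ?D (end_functor K M)" "\<rho>' \<in> set_mor K ?D (end_functor K M')"
    using \<rho> \<rho>' by (simp_all add: mod_mor_def)
  fix \<alpha> assume \<alpha>: "\<alpha> \<in> rep_mor K G (M, restriction K G \<rho>) (M', restriction K G \<rho>')"
  then have \<alpha>': "\<alpha> \<in> mod_mor K M M'" by (simp add: rep_mor_def)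
  have \<alpha>_add: "\<alpha> T (x \<oplus>\<^bsub>val M T\<^esub> y) = \<alpha> T x \<oplus>\<^bsub>val M' T\<^esub> \<alpha> T y"
    if "algebra K T" "x \<in> carrier (val M T)" "y \<in> carrier (val M T)" for T x y
    using \<alpha>' that by (simp add: mod_mor_def linear_maps_def)
  have \<alpha>_smult: "\<alpha> T (t \<odot>\<^bsub>val M T\<^esub> x) = t \<odot>\<^bsub>val M' T\<^esub> \<alpha> T x"
    if "algebra K T" "t \<in> carrier T" "x \<in> carrier (val M T)" for T t x
    using \<alpha>' that by (simp add: mod_mor_def linear_maps_def)
  have \<alpha>_closed: "\<alpha> T x \<in> carrier (val M' T)"
    if "algebra K T" "x \<in> carrier (val M T)" for T x
    using \<alpha>' that by (auto simp: mod_mor_def set_mor_def)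
  have \<alpha>_nat: "\<alpha> U (tr M T U p x) = tr M' T U p (\<alpha> T x)"
    if "algebra K T" "algebra K U" "p \<in> alg_hom K T U" "x \<in> carrier (val M T)" for T U p x
    using \<alpha>' that by (auto simp: mod_mor_def set_mor_def)
  note M_tr = set_functor_closed[OF mod_functor_set[OF M]]
  have orb: "fam K T (\<lambda>U p. \<lambda>w\<in>carrier (val ?D U). \<alpha> U (orbit K ?D M \<rho> T m U p w)) = orbit K ?D M' \<rho>' T (\<alpha> T m)"
    (is "?F = _") if T: "algebra K T" "m \<in> carrier (val M T)" for T m
  proof (rule extends_unique[OF set_functor_G ext T(1)])
    have o: "orbit K ?D M \<rho> T m \<in> mod_mor_over K T ?D M"
      by (rule orbit_mod_mor[OF closed_dist_algebra M \<rho> T])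
    have "?F \<in> mod_mor_over K T ?D M'"
    proof (rule mod_mor_overI[OF closed_dist_algebra T(1)], goal_cases)
      case (1 U p w) then show ?case by (intro \<alpha>_closed mod_mor_over_closed[OF o]) auto
    next
      case (2 U V p q w)
      then show ?case using mod_mor_over_natural[OF o 2] mod_mor_over_closed[OF o 2(1,3,5)]
        by (simp add: \<alpha>_nat)
    next
      case (3 U p w w')
      then show ?case using mod_mor_over_add[OF o 3] mod_mor_over_closed[OF o 3(1,2)]
        by (simp add: \<alpha>_add del: dist_algebra_simps)
    next
      case (4 U p t w)
      then show ?case using mod_mor_over_smult[OF o 4] mod_mor_over_closed[OF o 4(1,2)]
        by (simp add: \<alpha>_smult del: dist_algebra_simps)
    qed
    then show "?F \<in> mod_mor_over K T (dist K G) M'" by (simp only: mod_mor_over_dist_algebra)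
    show "orbit K ?D M' \<rho>' T (\<alpha> T m) \<in> mod_mor_over K T (dist K G) M'"
      using orbit_mod_mor[OF closed_dist_algebra M' \<rho>'] T \<alpha>_closed by (simp add: mod_mor_over_dist_algebra)
    fix U p g assume U: "algebra K U" "p \<in> alg_hom K T U" "g \<in> carrier (val G U)"
    then have "\<alpha> U (\<rho> U (eval_map K G U g) U (idm U) (tr M T U p m)) =
        \<rho>' U (eval_map K G U g) U (idm U) (\<alpha> U (tr M T U p m))"
      using \<alpha> T M_tr[of T U p m] by (auto simp: rep_mor_def)
    then show "?F U p (eval_map K G U g) = orbit K ?D M' \<rho>' T (\<alpha> T m) U p (eval_map K G U g)"
      using U T by (simp add: orbit_def eval_map_closed \<alpha>_nat)
  qed
  have "\<alpha> T (\<rho> S w T p m) = \<rho>' S w T p (\<alpha> T m)"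
    if S: "algebra K S" and T: "algebra K T" "p \<in> alg_hom K S T" "m \<in> carrier (val M T)"
      and w: "w \<in> carrier (val ?D S)" for S T p m w
  proof -
    have r: "fam_restrict K S T p w \<in> carrier (val ?D T)"
      using S T w by (simp add: fam_restrict_mod_mor_over)
    have "\<alpha> T (\<rho> T (fam_restrict K S T p w) T (idm T) m) = \<rho>' T (fam_restrict K S T p w) T (idm T) (\<alpha> T m)"
      using arg_cong[OF orb[OF T(1,3)], of "\<lambda>f. f T (idm T) (fam_restrict K S T p w)"] r T
        set_functor_id[OF mod_functor_set[OF M] T(1,3)] set_functor_id[OF mod_functor_set[OF M'] T(1) \<alpha>_closed[OF T(1,3)]]
      by (simp add: orbit_def)
    then show ?thesis
      using actionD(3)[OF s(1) S w T(1,2)] actionD(3)[OF s(2) S w T(1,2)] by simp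
  qed
  with \<alpha>' show "\<alpha> \<in> rep_mor K ?D (M, \<rho>) (M', \<rho>')"
    by (simp add: rep_mor_def)
qed

end

locale extendable_rep = monoid_kfunctor K G for K :: "'u ring" and G :: "('u, 'g) monfunctor" +
  fixes M :: "('u, 'm) modfunctor" and \<rho>
  assumes M: "mod_functor K M" and ext: "extends K G M" and \<rho>: "\<rho> \<in> monoid_mor K G (end_functor K M)"
begin

abbreviation "E S m \<equiv> lin_ext K G M S (orbit K G M \<rho> S m)"
abbreviation "a S w m \<equiv> act K G M \<rho> S w m"

lemma \<rho>_set: "\<rho> \<in> set_mor K G (end_functor K M)"
  using \<rho> by (simp add: monoid_mor_def)

lemmas M_closed = mod_functor_closed[OF M]
lemmas [simp] = set_functor_closed[OF mod_functor_set[OF M]] set_functor_id[OF mod_functor_set[OF M]]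
  set_functor_compose[OF mod_functor_set[OF M]] closed_functor_add[OF M_closed] closed_functor_smult[OF M_closed]

lemma E_closed: "algebra K S \<Longrightarrow> m \<in> carrier (val M S) \<Longrightarrow> E S m \<in> mod_mor_over K S (dist K G) M"
  by (intro lin_ext ext orbit_set_mor M \<rho>_set set_functor_G)

lemma E_eval:
  "algebra K S \<Longrightarrow> m \<in> carrier (val M S) \<Longrightarrow> algebra K T \<Longrightarrow> p \<in> alg_hom K S T \<Longrightarrow>
    g \<in> carrier (val G T) \<Longrightarrow> E S m T p (eval_map K G T g) = \<rho> T g T (idm T) (tr M S T p m)"
  using lin_ext(2)[OF ext _ orbit_set_mor[OF set_functor_G M \<rho>_set]] by (simp add: orbit_def)

lemma E_restrict:
  assumes S: "algebra K S" "m \<in> carrier (val M S)" and T: "algebra K T" "p \<in> alg_hom K S T"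
  shows "E T (tr M S T p m) = fam_restrict K S T p (E S m)"
  by (rule extends_unique[OF set_functor_G ext T(1)])
    (use S T in \<open>simp_all add: E_closed fam_restrict_mod_mor_over E_eval\<close>)

lemma E_act:
  assumes "algebra K S" "m \<in> carrier (val M S)" "algebra K T" "p \<in> alg_hom K S T"
  shows "E S m T p w = a T w (tr M S T p m)"
  using assms by (simp add: act_def E_restrict)

lemma act_closed [simp]:
  assumes "algebra K S" "w \<in> Dist S" "m \<in> carrier (val M S)"
  shows "a S w m \<in> carrier (val M S)"
  using assms mod_mor_over_closed[OF E_closed, of S m S "idm S" w] by (simp add: act_def)

lemma act_natural:
  assumes "algebra K S" "w \<in> Dist S" "m \<in> carrier (val M S)"
    and "algebra K T" "p \<in> alg_hom K S T"
  shows "a T (fam_restrict K S T p w) (tr M S T p m) = tr M S T p (a S w m)"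
  using assms mod_mor_over_natural_id[OF E_closed, of S m T p w] by (simp add: E_act)

lemma act_eval:
  assumes "algebra K S" "g \<in> carrier (val G S)" "m \<in> carrier (val M S)"
  shows "a S (eval_map K G S g) m = \<rho> S g S (idm S) m"
  using assms by (simp add: act_def E_eval)

lemma act_add_left:
  assumes "algebra K S" "w \<in> Dist S" "w' \<in> Dist S" "m \<in> carrier (val M S)"
  shows "a S (w \<oplus>\<^bsub>val (dist K G) S\<^esub> w') m = a S w m \<oplus>\<^bsub>val M S\<^esub> a S w' m"
  using assms mod_mor_over_add[OF E_closed, of S m S "idm S" w w'] by (simp add: act_def)

lemma act_smult_left:
  assumes "algebra K S" "w \<in> Dist S" "s \<in> carrier S" "m \<in> carrier (val M S)"
  shows "a S (s \<odot>\<^bsub>val (dist K G) S\<^esub> w) m = s \<odot>\<^bsub>val M S\<^esub> a S w m"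
  using assms mod_mor_over_smult[OF E_closed, of S m S "idm S" s w] by (simp add: act_def)

lemma \<rho>_closed: "algebra K S \<Longrightarrow> g \<in> carrier (val G S) \<Longrightarrow> \<rho> S g \<in> mod_mor_over K S M M"
  by (rule actionD(1)[OF \<rho>_set])

lemma act_add_right:
  assumes S: "algebra K S" "w \<in> Dist S" "m \<in> carrier (val M S)" "m' \<in> carrier (val M S)"
  shows "a S w (m \<oplus>\<^bsub>val M S\<^esub> m') = a S w m \<oplus>\<^bsub>val M S\<^esub> a S w m'"
proof -
  have "E S (m \<oplus>\<^bsub>val M S\<^esub> m') = E S m \<oplus>\<^bsub>val (hom_functor K (dist K G) M) S\<^esub> E S m'"
  proof (rule extends_unique[OF set_functor_G ext S(1)])
    show "E S m \<oplus>\<^bsub>val (hom_functor K (dist K G) M) S\<^esub> E S m' \<in> mod_mor_over K S (dist K G) M"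
      using closed_functor_add[OF closed_functor_hom[OF dist_closed M] S(1)] E_closed S by simp
  qed (use S mod_mor_over_add[OF \<rho>_closed] in
      \<open>simp_all add: E_closed E_eval eval_map_closed mod_functor_tr_add[OF M]\<close>)
  then show ?thesis using S by (simp add: act_def)
qed

lemma act_smult_right:
  assumes S: "algebra K S" "w \<in> Dist S" "s \<in> carrier S" "m \<in> carrier (val M S)"
  shows "a S w (s \<odot>\<^bsub>val M S\<^esub> m) = s \<odot>\<^bsub>val M S\<^esub> a S w m"
proof -
  have "E S (s \<odot>\<^bsub>val M S\<^esub> m) = s \<odot>\<^bsub>val (hom_functor K (dist K G) M) S\<^esub> E S m"
  proof (rule extends_unique[OF set_functor_G ext S(1)])
    show "s \<odot>\<^bsub>val (hom_functor K (dist K G) M) S\<^esub> E S m \<in> mod_mor_over K S (dist K G) M"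
      using closed_functor_smult[OF closed_functor_hom[OF dist_closed M] S(1)] E_closed S by simp
  qed (use S mod_mor_over_smult[OF \<rho>_closed] in
      \<open>simp_all add: E_closed E_eval eval_map_closed mod_functor_tr_smult[OF M] alg_hom_closed[of _ K S]\<close>)
  then show ?thesis using S by (simp add: act_def)
qed

lemma act_one:
  assumes "algebra K S" "m \<in> carrier (val M S)"
  shows "a S (eval_map K G S \<one>\<^bsub>val G S\<^esub>) m = m"
proof -
  have "\<rho> S \<one>\<^bsub>val G S\<^esub> = \<one>\<^bsub>val (end_functor K M) S\<^esub>"
    using \<rho> assms by (simp add: monoid_mor_def)
  with assms show ?thesis by (simp add: act_eval)
qed

lemma act_convolution_eval:
  assumes S: "algebra K S" "g \<in> carrier (val G S)" "w \<in> Dist S" "m \<in> carrier (val M S)"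
  shows "a S (convolution K G S (eval_map K G S g) w) m = a S (eval_map K G S g) (a S w m)"
proof -
  let ?F = "fam K S (\<lambda>T p. \<lambda>w\<in>carrier (val (dist K G) T).
    a T (convolution K G T (eval_map K G T (tr G S T p g)) w) (tr M S T p m))"
  let ?F' = "fam K S (\<lambda>T p. \<lambda>w\<in>carrier (val (dist K G) T). \<rho> S g T p (a T w (tr M S T p m)))"
  note \<rho>g = \<rho>_closed[OF S(1,2)]
  have "?F = ?F'"
  proof (rule extends_unique[OF set_functor_G ext S(1)])
    show "?F \<in> mod_mor_over K S (dist K G) M"
    proof (rule mod_mor_overI[OF dist_closed S(1)], goal_cases)
      case (1 T p w)
      with S show ?case by (simp add: convolution_closed eval_map_closed)
    next
      case (2 T U p q w)
      have "convolution K G U (eval_map K G U (tr G S U (compose (carrier S) q p) g)) (fam_restrict K T U q w) =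
        fam_restrict K T U q (convolution K G T (eval_map K G T (tr G S T p g)) w)"
        using 2 S eval_map_natural[OF set_functor_G 2(1) _ 2(2,4), of "tr G S T p g"]
        by (simp add: convolution_natural eval_map_closed)
      with 2 S show ?case
        using act_natural[of T "convolution K G T (eval_map K G T (tr G S T p g)) w" "tr M S T p m" U q]
        by (simp add: convolution_closed eval_map_closed)
    next
      case (3 T p w w')
      with S show ?case by (simp add: convolution_add_right act_add_left convolution_closed eval_map_closed)
    next
      case (4 T p t w)
      with S show ?case by (simp add: convolution_smult_right act_smult_left convolution_closed eval_map_closed)
    qed
    show "?F' \<in> mod_mor_over K S (dist K G) M"
    proof (rule mod_mor_overI[OF dist_closed S(1)], goal_cases)
      case (1 T p w)
      with S show ?case using mod_mor_over_closed[OF \<rho>g, of T p] by simp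
    next
      case (2 T U p q w)
      with S show ?case
        using act_natural[of T w "tr M S T p m" U q] mod_mor_over_natural[OF \<rho>g 2(1-4), of "a T w (tr M S T p m)"]
        by simp
    next
      case (3 T p w w')
      with S show ?case by (simp add: act_add_left mod_mor_over_add[OF \<rho>g])
    next
      case (4 T p t w)
      with S show ?case by (simp add: act_smult_left mod_mor_over_smult[OF \<rho>g])
    qed
  next
    fix T p h assume T: "algebra K T" "p \<in> alg_hom K S T" "h \<in> carrier (val G T)"
    let ?g = "tr G S T p g"
    have "\<rho> T (?g \<otimes>\<^bsub>val G T\<^esub> h) = \<rho> T ?g \<otimes>\<^bsub>val (end_functor K M) T\<^esub> \<rho> T h"
      using \<rho> S T by (simp add: monoid_mor_def hom_def)
    with S T show "?F T p (eval_map K G T h) = ?F' T p (eval_map K G T h)"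
      using mod_mor_over_closed[OF \<rho>_closed[OF T(1,3)]]
      by (simp add: eval_map_closed convolution_eval act_eval actionD(3)[OF \<rho>_set])
  qed
  from fun_cong[OF fun_cong[OF fun_cong[OF this, of S], of "idm S"], of w] S
  show ?thesis by (simp add: act_eval)
qed

lemma act_convolution:
  assumes S: "algebra K S" "w \<in> Dist S" "w' \<in> Dist S"
    "m \<in> carrier (val M S)"
  shows "a S (convolution K G S w w') m = a S w (a S w' m)"
proof -
  let ?F = "fam K S (\<lambda>T p. \<lambda>w\<in>carrier (val (dist K G) T).
    a T (convolution K G T w (fam_restrict K S T p w')) (tr M S T p m))"
  have r: "fam_restrict K S T p w' \<in> Dist T" if "algebra K T" "p \<in> alg_hom K S T" for T p
    using that S by (auto intro: fam_restrict_mod_mor_over)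
  have "?F = E S (a S w' m)"
  proof (rule extends_unique[OF set_functor_G ext S(1)])
    show "?F \<in> mod_mor_over K S (dist K G) M"
    proof (rule mod_mor_overI[OF dist_closed S(1)], goal_cases)
      case (1 T p w)
      with S show ?case by (simp add: convolution_closed r)
    next
      case (2 T U p q w)
      have "convolution K G U (fam_restrict K T U q w) (fam_restrict K S U (compose (carrier S) q p) w') =
        fam_restrict K T U q (convolution K G T w (fam_restrict K S T p w'))"
        using 2 S by (simp add: convolution_natural r fam_restrict_compose)
      with 2 S show ?case
        using act_natural[of T "convolution K G T w (fam_restrict K S T p w')" "tr M S T p m" U q]
        by (simp add: convolution_closed r)
    next
      case (3 T p w w')
      with S show ?case by (simp add: convolution_add_left act_add_left convolution_closed r)
    next
      case (4 T p t w)
      with S show ?case by (simp add: convolution_smult_left act_smult_left convolution_closed r)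
    qed
    show "E S (a S w' m) \<in> mod_mor_over K S (dist K G) M" using S by (simp add: E_closed)
  next
    fix T p g assume T: "algebra K T" "p \<in> alg_hom K S T" "g \<in> carrier (val G T)"
    with S show "?F T p (eval_map K G T g) = E S (a S w' m) T p (eval_map K G T g)"
      by (simp add: eval_map_closed act_convolution_eval E_eval r act_natural[symmetric]) (simp add: act_eval r)
  qed
  from fun_cong[OF fun_cong[OF fun_cong[OF this, of S], of "idm S"], of w] S
  show ?thesis by (simp add: E_act fam_restrict_id fam_of_mor_over[OF mod_mor_over_set])
qed

lemma extension_apply [simp]:
  "algebra K S \<Longrightarrow> w \<in> Dist S \<Longrightarrow> algebra K T \<Longrightarrow> p \<in> alg_hom K S T \<Longrightarrow>
    x \<in> carrier (val M T) \<Longrightarrow> extension K G M \<rho> S w T p x = a T (fam_restrict K S T p w) x"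
  by (simp add: extension_def)

lemma extension_closed [simp]:
  assumes S: "algebra K S" "w \<in> Dist S"
  shows "extension K G M \<rho> S w \<in> mod_mor_over K S M M"
proof -
  have r: "fam_restrict K S T p w \<in> Dist T" if "algebra K T" "p \<in> alg_hom K S T" for T p
    using that S by (auto intro: fam_restrict_mod_mor_over)
  have "fam K S (\<lambda>T p. \<lambda>x\<in>carrier (val M T). a T (fam_restrict K S T p w) x) \<in> mod_mor_over K S M M"
  proof (rule mod_mor_overI[OF M_closed S(1)], goal_cases)
    case (2 T U p q x)
    with S show ?case using act_natural[of T "fam_restrict K S T p w" x U q]
      by (simp add: r fam_restrict_compose)
  qed (simp_all add: r act_add_right act_smult_right)
  with S show ?thesis by (simp add: extension_def)
qed

lemma extension_alg_mor: "extension K G M \<rho> \<in> alg_mor K (dist_algebra K G) (end_functor K M)"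
proof -
  let ?D = "dist_algebra K G" and ?E = "end_functor K M" and ?\<rho> = "extension K G M \<rho>"
  have clo: "?\<rho> S \<in> carrier (val ?D S) \<rightarrow>\<^sub>E carrier (val ?E S)" if "algebra K S" for S
  proof (rule PiE_I)
    show "?\<rho> S w \<in> carrier (val ?E S)" if "w \<in> carrier (val ?D S)" for w
      using that \<open>algebra K S\<close> by simp
    show "?\<rho> S w = undefined" if "w \<notin> carrier (val ?D S)" for w
      using that \<open>algebra K S\<close> by (simp add: extension_def)
  qed
  note [simp] = fam_restrict_mod_mor_over dist_restrict_add dist_restrict_smult act_add_left act_smult_left
    convolution_closed convolution_natural act_convolution dist_closed' fam_restrict_compose
  have add: "?\<rho> S (w \<oplus>\<^bsub>val ?D S\<^esub> w') = ?\<rho> S w \<oplus>\<^bsub>val ?E S\<^esub> ?\<rho> S w'"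
    if S: "algebra K S" "w \<in> carrier (val ?D S)" "w' \<in> carrier (val ?D S)" for S w w'
  proof (rule mod_mor_over_ext)
    show "?\<rho> S w \<oplus>\<^bsub>val ?E S\<^esub> ?\<rho> S w' \<in> mod_mor_over K S M M"
      using closed_functor_add[OF closed_functor_end[OF M] S(1)] S by simp
  qed (use S in simp_all)
  have smult: "?\<rho> S (s \<odot>\<^bsub>val ?D S\<^esub> w) = s \<odot>\<^bsub>val ?E S\<^esub> ?\<rho> S w"
    if S: "algebra K S" "s \<in> carrier S" "w \<in> carrier (val ?D S)" for S w s
  proof (rule mod_mor_over_ext)
    show "s \<odot>\<^bsub>val ?E S\<^esub> ?\<rho> S w \<in> mod_mor_over K S M M"
      using closed_functor_smult[OF closed_functor_end[OF M] S(1)] S by simp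
  qed (use S in \<open>simp_all add: alg_hom_closed[of _ K S]\<close>)
  have mult: "?\<rho> S (w \<otimes>\<^bsub>val ?D S\<^esub> w') = ?\<rho> S w \<otimes>\<^bsub>val ?E S\<^esub> ?\<rho> S w'"
    if S: "algebra K S" "w \<in> carrier (val ?D S)" "w' \<in> carrier (val ?D S)" for S w w'
  proof (rule set_mor_over_ext)
    have "fam K S (\<lambda>T p. \<lambda>x\<in>carrier (val M T). ?\<rho> S w T p (?\<rho> S w' T p x)) \<in> set_mor_over K S M M"
      using S mod_mor_over_natural[OF extension_closed] mod_mor_over_closed[OF extension_closed]
      by (intro set_mor_overI[OF mod_functor_set[OF M]]) (simp_all del: extension_apply)
    then show "?\<rho> S w \<otimes>\<^bsub>val ?E S\<^esub> ?\<rho> S w' \<in> set_mor_over K S M M"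
      by (simp add: end_functor_ops compose_def del: extension_apply)
    show "?\<rho> S (w \<otimes>\<^bsub>val ?D S\<^esub> w') \<in> set_mor_over K S M M"
      using S by (intro mod_mor_over_set) simp
  qed (use S in simp_all)
  have one: "?\<rho> S \<one>\<^bsub>val ?D S\<^esub> = \<one>\<^bsub>val ?E S\<^esub>" if S: "algebra K S" for S
  proof (rule set_mor_over_ext)
    show "\<one>\<^bsub>val ?E S\<^esub> \<in> set_mor_over K S M M"
      unfolding end_functor_ops by (rule set_mor_overI[OF mod_functor_set[OF M] S]) simp_all
    show "?\<rho> S \<one>\<^bsub>val ?D S\<^esub> \<in> set_mor_over K S M M"
      using S by (intro mod_mor_over_set) (simp add: eval_map_closed)
    fix T p x assume T: "algebra K T" "p \<in> alg_hom K S T" "x \<in> carrier (val M T)"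
    then show "?\<rho> S \<one>\<^bsub>val ?D S\<^esub> T p x = \<one>\<^bsub>val ?E S\<^esub> T p x"
      using S by (simp add: eval_map_closed eval_map_natural[symmetric] G_tr_one act_one)
  qed
  have nat: "?\<rho> T (tr ?D S T p w) = tr ?E S T p (?\<rho> S w)"
    if S: "algebra K S" "algebra K T" "p \<in> alg_hom K S T" "w \<in> carrier (val ?D S)" for S T p w
  proof (rule mod_mor_over_ext)
    show "tr ?E S T p (?\<rho> S w) \<in> mod_mor_over K T M M" "?\<rho> T (tr ?D S T p w) \<in> mod_mor_over K T M M"
      using S by simp_all
  qed (use S in simp)
  have set: "?\<rho> \<in> set_mor K ?D ?E"
    unfolding set_mor_def
  proof (intro CollectI conjI allI impI ballI)
    fix S :: "'u alg" assume "\<not> algebra K S" then show "?\<rho> S = undefined" by (simp add: extension_def)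
  qed (rule clo nat; assumption)+
  moreover have "?\<rho> S \<in> linear_maps S (val ?D S) (val ?E S)" "?\<rho> S \<in> hom (val ?D S) (val ?E S)"
    if "algebra K S" for S
    unfolding linear_maps_def hom_def using clo[OF that] add[OF that] smult[OF that] mult[OF that] by auto
  ultimately show ?thesis
    using one by (simp add: alg_mor_def mod_mor_def monoid_mor_def)
qed

lemma restriction_extension: "restriction K G (extension K G M \<rho>) = \<rho>"
proof -
  have "restriction K G (extension K G M \<rho>) S g = \<rho> S g" if S: "algebra K S" "g \<in> carrier (val G S)" for S g
  proof (rule mod_mor_over_ext)
    show "\<rho> S g \<in> mod_mor_over K S M M" by (rule \<rho>_closed[OF S])
    show "restriction K G (extension K G M \<rho>) S g \<in> mod_mor_over K S M M"
      using S by (simp add: eval_map_closed)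
    fix T p x assume T: "algebra K T" "p \<in> alg_hom K S T" "x \<in> carrier (val M T)"
    then show "restriction K G (extension K G M \<rho>) S g T p x = \<rho> S g T p x"
      using S by (simp add: eval_map_closed eval_map_natural[symmetric] act_eval actionD(3)[OF \<rho>_set])
  qed
  moreover have "\<rho> S \<in> extensional (carrier (val G S))" if "algebra K S" for S
    using \<rho>_set that by (auto simp: set_mor_def PiE_def)
  ultimately have "restriction K G (extension K G M \<rho>) S = \<rho> S" if "algebra K S" for S
    using that by (intro extensionalityI[of _ "carrier (val G S)"]) (simp_all add: restriction_def)
  moreover have "\<rho> S = undefined" if "\<not> algebra K S" for S
    using \<rho>_set that by (simp add: set_mor_def)
  ultimately show ?thesis by (auto simp: restriction_def fun_eq_iff)
qed

end

section \<open>Equivalence of categories\<close>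

lemma is_equivalence_bij:
  fixes C :: "('o, 'a) cat" and D :: "('p, 'a) cat"
  assumes C: "is_category C" and D: "is_category D"
    and bij: "bij_betw (on_ob F) (Ob C) (Ob D)"
    and mor: "\<And>X Y f. on_mor F X Y f = f"
    and Hom: "\<And>X Y. X \<in> Ob C \<Longrightarrow> Y \<in> Ob C \<Longrightarrow> Hom D (on_ob F X) (on_ob F Y) = Hom C X Y"
    and Idt: "\<And>X. X \<in> Ob C \<Longrightarrow> Idt D (on_ob F X) = Idt C X"
    and Cmp: "\<And>X Y Z f g. X \<in> Ob C \<Longrightarrow> Y \<in> Ob C \<Longrightarrow> Z \<in> Ob C \<Longrightarrow>
      Cmp D (on_ob F X) (on_ob F Y) (on_ob F Z) g f = Cmp C X Y Z g f"
  shows "is_equivalence C D F"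
proof -
  define i where "i = inv_into (Ob C) (on_ob F)"
  define G where "G = \<lparr>on_ob = i, on_mor = \<lambda>X Y (f :: 'a). f\<rparr>"
  have i: "i Y \<in> Ob C" "on_ob F (i Y) = Y" if "Y \<in> Ob D" for Y
    using bij that by (simp_all add: i_def bij_betw_def f_inv_into_f inv_into_into)
  have iF: "i (on_ob F X) = X" if "X \<in> Ob C" for X
    using bij that by (simp add: i_def bij_betw_def)
  have F: "on_ob F X \<in> Ob D" if "X \<in> Ob C" for X
    using bij that by (auto simp: bij_betw_def)
  have "is_cfunctor C D F"
    unfolding is_cfunctor_def using C D by (simp add: mor Hom Idt Cmp F)
  moreover have "is_cfunctor D C G"
    unfolding is_cfunctor_def
  proof (intro conjI ballI C D)
    fix X Y Z f g assume X: "X \<in> Ob D" "Y \<in> Ob D"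
    show "on_ob G X \<in> Ob C" "on_mor G X X (Idt D X) = Idt C (on_ob G X)"
      using X i Idt[of "i X"] by (simp_all add: G_def)
    show "f \<in> Hom D X Y \<Longrightarrow> on_mor G X Y f \<in> Hom C (on_ob G X) (on_ob G Y)"
      using X i Hom[of "i X" "i Y"] by (simp add: G_def)
    show "Z \<in> Ob D \<Longrightarrow> on_mor G X Z (Cmp D X Y Z g f) =
      Cmp C (on_ob G X) (on_ob G Y) (on_ob G Z) (on_mor G Y Z g) (on_mor G X Y f)"
      using X i Cmp[of "i X" "i Y" "i Z"] by (simp add: G_def)
  qed
  moreover have "naturally_isomorphic C C (comp_cfunctor G F) id_cfunctor"
    unfolding naturally_isomorphic_def using C
    by (intro exI[of _ "Idt C"]) (simp add: comp_cfunctor_def id_cfunctor_def G_def iF mor is_category_def)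
  moreover have "naturally_isomorphic D D (comp_cfunctor F G) id_cfunctor"
    unfolding naturally_isomorphic_def using D
    by (intro exI[of _ "Idt D"]) (simp add: comp_cfunctor_def id_cfunctor_def G_def i mor is_category_def)
  ultimately show ?thesis unfolding is_equivalence_def by blast
qed

lemma rep_mor_apply:
  assumes "\<alpha> \<in> rep_mor K H X Y" "algebra K S"
  shows "x \<in> carrier (val (fst X) S) \<Longrightarrow> \<alpha> S x \<in> carrier (val (fst Y) S)"
    and "\<alpha> S \<in> carrier (val (fst X) S) \<rightarrow>\<^sub>E carrier (val (fst Y) S)"
  using assms by (auto simp: rep_mor_def mod_mor_def set_mor_def)

lemma rep_mor_ext:
  assumes "\<alpha> \<in> rep_mor K H X Y" "\<beta> \<in> rep_mor K H X Y"
    and "\<And>S x. algebra K S \<Longrightarrow> x \<in> carrier (val (fst X) S) \<Longrightarrow> \<alpha> S x = \<beta> S x"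
  shows "\<alpha> = \<beta>"
proof
  fix S show "\<alpha> S = \<beta> S"
  proof (cases "algebra K S")
    case True then show ?thesis
      using PiE_ext[OF rep_mor_apply(2)[OF assms(1)] rep_mor_apply(2)[OF assms(2)]] assms(3) by blast
  next
    case False then show ?thesis using assms(1,2) by (simp add: rep_mor_def mod_mor_def set_mor_def)
  qed
qed

lemma is_category_rep_category:
  assumes reps: "\<And>X. X \<in> reps \<Longrightarrow> mod_functor K (fst X) \<and> snd X \<in> set_mor K H (end_functor K (fst X))"
  shows "is_category (rep_category K H reps)"
proof -
  let ?C = "rep_category K H reps"
  have act: "snd X S h T p x \<in> carrier (val (fst X) T)"
    if "X \<in> reps" "algebra K S" "h \<in> carrier (val H S)" "algebra K T" "p \<in> alg_hom K S T"
      "x \<in> carrier (val (fst X) T)" for X S h T p x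
    using that reps by (blast intro: mod_mor_over_closed actionD(1))
  have I: "Idt ?C X \<in> rep_mor K H X X" if X: "X \<in> reps" for X
  proof -
    note M = mod_functor_closed[of K "fst X"]
    have M': "mod_functor K (fst X)" using reps X by simp
    note [simp] = set_functor_closed[OF mod_functor_set[OF M']] closed_functor_add[OF M[OF M']]
      closed_functor_smult[OF M[OF M']] act[OF X]
    show ?thesis
      by (simp add: rep_mor_def rep_category_def mod_mor_def set_mor_def linear_maps_def)
  qed
  have C: "Cmp ?C X Y Z \<beta> \<alpha> \<in> rep_mor K H X Z"
    if X: "X \<in> reps" "Y \<in> reps" "Z \<in> reps" "\<alpha> \<in> rep_mor K H X Y" "\<beta> \<in> rep_mor K H Y Z" for X Y Z \<alpha> \<beta>
  proof -
    note M = mod_functor_closed[of K "fst X"]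
    have M': "mod_functor K (fst X)" using reps X by simp
    note [simp] = set_functor_closed[OF mod_functor_set[OF M']] closed_functor_add[OF M[OF M']]
      closed_functor_smult[OF M[OF M']] act[OF X(1)] rep_mor_apply(1)[OF X(4)] rep_mor_apply(1)[OF X(5)]
    show ?thesis
      using X(4,5) by (simp add: rep_mor_def rep_category_def mod_mor_def set_mor_def linear_maps_def)
        (simp add: PiE_iff compose_def)
  qed
  have ob: "Ob ?C = reps" "Hom ?C = rep_mor K H" by (simp_all add: rep_category_def)
  show ?thesis
    unfolding is_category_def ob
  proof (intro conjI ballI)
    fix X Y f assume X: "X \<in> reps" "Y \<in> reps" "f \<in> rep_mor K H X Y"
    show "Cmp ?C X X Y f (Idt ?C X) = f" "Cmp ?C X Y Y (Idt ?C Y) f = f"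
      by (rule rep_mor_ext[OF C X(3)]; use X I rep_mor_apply(1)[OF X(3)] in \<open>simp add: rep_category_def\<close>)+
  next
    fix W X Y Z f g h assume X: "W \<in> reps" "X \<in> reps" "Y \<in> reps" "Z \<in> reps"
      and f: "f \<in> rep_mor K H W X" "g \<in> rep_mor K H X Y" "h \<in> rep_mor K H Y Z"
    show "Cmp ?C W X Z (Cmp ?C X Y Z h g) f = Cmp ?C W Y Z h (Cmp ?C W X Y g f)"
      by (rule rep_mor_ext[of _ K H W Z])
        (use X f C rep_mor_apply(1)[OF f(1)] in \<open>simp_all add: rep_category_def\<close>)
  qed (use I C in auto)
qed

lemma (in monoid_kfunctor) is_equivalence_restriction:
  fixes P :: "('u, 'm) modfunctor \<Rightarrow> bool"
  assumes ext: "\<And>M. P M \<Longrightarrow> extends K G M"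
  shows "is_equivalence
    (rep_category K (dist_algebra K G) {X \<in> algebra_reps K (dist_algebra K G). P (fst X)})
    (rep_category K G {X \<in> monoid_reps K G. P (fst X)})
    (restriction_functor K G)"
proof (rule is_equivalence_bij)
  let ?D = "dist_algebra K G"
  let ?C1 = "rep_category K ?D {X \<in> algebra_reps K ?D. P (fst X)}"
  let ?C2 = "rep_category K G {X \<in> monoid_reps K G. P (fst X)}"
  have F: "on_ob (restriction_functor K G) = (\<lambda>(M, \<rho>). (M, restriction K G \<rho>))"
    by (simp add: restriction_functor_def restriction_def[abs_def])
  show "is_category ?C1"
    by (rule is_category_rep_category) (auto simp: algebra_reps_def alg_mor_def mod_mor_def)
  show "is_category ?C2"
    by (rule is_category_rep_category) (auto simp: monoid_reps_def monoid_mor_def)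
  show "bij_betw (on_ob (restriction_functor K G)) (Ob ?C1) (Ob ?C2)"
    unfolding F
  proof (rule bij_betw_byWitness[where f' = "\<lambda>(M, \<rho>). (M, extension K G M \<rho>)"])
    have loc: "extendable_rep K G M \<rho>" if "(M, \<rho>) \<in> monoid_reps K G" "P M" for M \<rho>
      using that ext by unfold_locales (auto simp: monoid_reps_def)
    have res: "(M, restriction K G \<rho>) \<in> monoid_reps K G" if "(M, \<rho>) \<in> algebra_reps K ?D" for M \<rho>
      using that by (auto simp: algebra_reps_def monoid_reps_def alg_mor_def intro: restriction_monoid_mor)
    show "\<forall>X\<in>Ob ?C1. (case case X of (M, \<rho>) \<Rightarrow> (M, restriction K G \<rho>) of (M, \<rho>) \<Rightarrow> (M, extension K G M \<rho>)) = X"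
    proof (clarsimp simp: rep_category_def)
      fix M \<rho> assume X: "(M, \<rho>) \<in> algebra_reps K ?D" "P M"
      interpret extendable_rep K G M "restriction K G \<rho>" by (intro loc res X)
      show "extension K G M (restriction K G \<rho>) = \<rho>"
        using X extension_alg_mor restriction_extension
        by (intro restriction_inj[OF _ ext]) (auto simp: algebra_reps_def alg_mor_def)
    qed
    show "\<forall>X\<in>Ob ?C2. (case case X of (M, \<rho>) \<Rightarrow> (M, extension K G M \<rho>) of (M, \<rho>) \<Rightarrow> (M, restriction K G \<rho>)) = X"
      by (clarsimp simp: rep_category_def extendable_rep.restriction_extension[OF loc])
    show "(\<lambda>(M, \<rho>). (M, restriction K G \<rho>)) ` Ob ?C1 \<subseteq> Ob ?C2"
      by (auto simp: rep_category_def res)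
    show "(\<lambda>(M, \<rho>). (M, extension K G M \<rho>)) ` Ob ?C2 \<subseteq> Ob ?C1"
      by (auto simp: rep_category_def algebra_reps_def extendable_rep.extension_alg_mor[OF loc])
        (auto simp: monoid_reps_def)
  qed
  fix X Y assume "X \<in> Ob ?C1" "Y \<in> Ob ?C1"
  then show "Hom ?C2 (on_ob (restriction_functor K G) X) (on_ob (restriction_functor K G) Y) = Hom ?C1 X Y"
    unfolding F using ext
    by (auto simp: rep_category_def algebra_reps_def alg_mor_def rep_mor_restriction)
qed (auto simp: restriction_functor_def rep_category_def)

section \<open>Trivial extensions and tensor products\<close>

text \<open>The square-zero extension \<open>S \<oplus> P\<close>, transported into the universe \<open>'u\<close>.\<close>

lemma trivial_extension:
  fixes K :: "'u ring" and S :: "'u alg" and P :: "('u, 'p) module"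
  assumes inf: "infinite (UNIV :: 'u set)" and S: "algebra K S" and P: "module S P"
    and small: "carrier P \<lesssim> (UNIV :: 'u set)"
  obtains T :: "'u alg" and \<iota> :: "'u \<Rightarrow> 'u" and j :: "'p \<Rightarrow> 'u"
  where "algebra K T" "\<iota> \<in> alg_hom K S T" "\<And>x. x \<in> carrier P \<Longrightarrow> j x \<in> carrier T"
    and "\<And>x y. x \<in> carrier P \<Longrightarrow> y \<in> carrier P \<Longrightarrow> j (x \<oplus>\<^bsub>P\<^esub> y) = j x \<oplus>\<^bsub>T\<^esub> j y"
    and "\<And>s x. s \<in> carrier S \<Longrightarrow> x \<in> carrier P \<Longrightarrow> j (s \<odot>\<^bsub>P\<^esub> x) = \<iota> s \<otimes>\<^bsub>T\<^esub> j x"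
    and "\<And>s x t y. s \<in> carrier S \<Longrightarrow> x \<in> carrier P \<Longrightarrow> t \<in> carrier S \<Longrightarrow> y \<in> carrier P \<Longrightarrow>
      (\<iota> s \<oplus>\<^bsub>T\<^esub> j x) \<oplus>\<^bsub>T\<^esub> (\<iota> t \<oplus>\<^bsub>T\<^esub> j y) = \<iota> (s \<oplus>\<^bsub>S\<^esub> t) \<oplus>\<^bsub>T\<^esub> j (x \<oplus>\<^bsub>P\<^esub> y)"
    and "\<And>s x t y. s \<in> carrier S \<Longrightarrow> x \<in> carrier P \<Longrightarrow> t \<in> carrier S \<Longrightarrow> y \<in> carrier P \<Longrightarrow>
      (\<iota> s \<oplus>\<^bsub>T\<^esub> j x) \<otimes>\<^bsub>T\<^esub> (\<iota> t \<oplus>\<^bsub>T\<^esub> j y) =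
      \<iota> (s \<otimes>\<^bsub>S\<^esub> t) \<oplus>\<^bsub>T\<^esub> j (s \<odot>\<^bsub>P\<^esub> y \<oplus>\<^bsub>P\<^esub> t \<odot>\<^bsub>P\<^esub> x)"
    and "\<And>k s x. k \<in> carrier K \<Longrightarrow> s \<in> carrier S \<Longrightarrow> x \<in> carrier P \<Longrightarrow>
      k \<odot>\<^bsub>T\<^esub> (\<iota> s \<oplus>\<^bsub>T\<^esub> j x) = \<iota> (k \<odot>\<^bsub>S\<^esub> s) \<oplus>\<^bsub>T\<^esub> j ((k \<odot>\<^bsub>S\<^esub> \<one>\<^bsub>S\<^esub>) \<odot>\<^bsub>P\<^esub> x)"
    and "\<And>t. t \<in> carrier T \<Longrightarrow> \<exists>s\<in>carrier S. \<exists>x\<in>carrier P. t = \<iota> s \<oplus>\<^bsub>T\<^esub> j x"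
    and "\<And>s x s' x'. s \<in> carrier S \<Longrightarrow> x \<in> carrier P \<Longrightarrow> s' \<in> carrier S \<Longrightarrow> x' \<in> carrier P \<Longrightarrow>
      \<iota> s \<oplus>\<^bsub>T\<^esub> j x = \<iota> s' \<oplus>\<^bsub>T\<^esub> j x' \<Longrightarrow> s = s' \<and> x = x'"
proof -
  interpret S: cring S by (rule algebraD(1)[OF S])
  interpret A: module K S by (rule algebraD(2)[OF S])
  interpret P: module S P by (rule P)
  have "carrier S \<times> carrier P \<lesssim> (UNIV :: 'u set) \<times> (UNIV :: 'u set)"
    using small by (intro times_lepoll_mono) (auto intro: subset_imp_lepoll)
  also have "\<dots> \<approx> (UNIV :: 'u set)"
    unfolding eqpoll_iff_card_of_ordIso by (rule card_of_Times_same_infinite[OF inf])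
  finally obtain e :: "'u \<times> 'p \<Rightarrow> 'u" where e: "inj_on e (carrier S \<times> carrier P)"
    by (auto simp: lepoll_def)
  define d where "d = inv_into (carrier S \<times> carrier P) e"
  have d [simp]: "d (e (s, x)) = (s, x)" if "s \<in> carrier S" "x \<in> carrier P" for s x
    using e that by (simp add: d_def)
  define c where "c k = k \<odot>\<^bsub>S\<^esub> \<one>\<^bsub>S\<^esub>" for k
  have c [simp]: "c k \<in> carrier S" if "k \<in> carrier K" for k
    using that by (simp add: c_def)
  have cS: "k \<odot>\<^bsub>S\<^esub> s = c k \<otimes>\<^bsub>S\<^esub> s" if "k \<in> carrier K" "s \<in> carrier S" for k s
    using algebra.smult_assoc2[OF S, of k "\<one>\<^bsub>S\<^esub>" s] that by (simp add: c_def)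
  have c_add: "c (k \<oplus>\<^bsub>K\<^esub> l) = c k \<oplus>\<^bsub>S\<^esub> c l" and c_mult: "c (k \<otimes>\<^bsub>K\<^esub> l) = c k \<otimes>\<^bsub>S\<^esub> c l"
    if "k \<in> carrier K" "l \<in> carrier K" for k l
  proof -
    show "c (k \<oplus>\<^bsub>K\<^esub> l) = c k \<oplus>\<^bsub>S\<^esub> c l" using that by (simp add: c_def A.smult_l_distr)
    have "c (k \<otimes>\<^bsub>K\<^esub> l) = k \<odot>\<^bsub>S\<^esub> c l" using that by (simp add: c_def A.smult_assoc1)
    then show "c (k \<otimes>\<^bsub>K\<^esub> l) = c k \<otimes>\<^bsub>S\<^esub> c l" using that by (simp add: cS)
  qed
  have c_one: "c \<one>\<^bsub>K\<^esub> = \<one>\<^bsub>S\<^esub>" by (simp add: c_def)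
  define T :: "'u alg" where "T = \<lparr>carrier = e ` (carrier S \<times> carrier P),
    monoid.mult = (\<lambda>a b. e (fst (d a) \<otimes>\<^bsub>S\<^esub> fst (d b),
      fst (d a) \<odot>\<^bsub>P\<^esub> snd (d b) \<oplus>\<^bsub>P\<^esub> fst (d b) \<odot>\<^bsub>P\<^esub> snd (d a))),
    one = e (\<one>\<^bsub>S\<^esub>, \<zero>\<^bsub>P\<^esub>), ring.zero = e (\<zero>\<^bsub>S\<^esub>, \<zero>\<^bsub>P\<^esub>),
    ring.add = (\<lambda>a b. e (fst (d a) \<oplus>\<^bsub>S\<^esub> fst (d b), snd (d a) \<oplus>\<^bsub>P\<^esub> snd (d b))),
    smult = (\<lambda>k a. e (k \<odot>\<^bsub>S\<^esub> fst (d a), c k \<odot>\<^bsub>P\<^esub> snd (d a)))\<rparr>"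
  have carrier: "carrier T = e ` (carrier S \<times> carrier P)" by (simp add: T_def)
  have one: "\<one>\<^bsub>T\<^esub> = e (\<one>\<^bsub>S\<^esub>, \<zero>\<^bsub>P\<^esub>)" and zero: "\<zero>\<^bsub>T\<^esub> = e (\<zero>\<^bsub>S\<^esub>, \<zero>\<^bsub>P\<^esub>)" by (simp_all add: T_def)
  have add: "e (s, x) \<oplus>\<^bsub>T\<^esub> e (t, y) = e (s \<oplus>\<^bsub>S\<^esub> t, x \<oplus>\<^bsub>P\<^esub> y)"
    and mult: "e (s, x) \<otimes>\<^bsub>T\<^esub> e (t, y) = e (s \<otimes>\<^bsub>S\<^esub> t, s \<odot>\<^bsub>P\<^esub> y \<oplus>\<^bsub>P\<^esub> t \<odot>\<^bsub>P\<^esub> x)"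
    if "s \<in> carrier S" "x \<in> carrier P" "t \<in> carrier S" "y \<in> carrier P" for s x t y
    using that by (simp_all add: T_def)
  have smult: "k \<odot>\<^bsub>T\<^esub> e (s, x) = e (k \<odot>\<^bsub>S\<^esub> s, c k \<odot>\<^bsub>P\<^esub> x)"
    if "s \<in> carrier S" "x \<in> carrier P" for k s x
    using that by (simp add: T_def)
  have ab: "abelian_group T"
  proof (rule abelian_groupI)
    fix a assume "a \<in> carrier T"
    then obtain s x where a: "a = e (s, x)" "s \<in> carrier S" "x \<in> carrier P" by (auto simp: carrier)
    then show "\<exists>b\<in>carrier T. b \<oplus>\<^bsub>T\<^esub> a = \<zero>\<^bsub>T\<^esub>"
      by (intro bexI[of _ "e (\<ominus>\<^bsub>S\<^esub> s, \<ominus>\<^bsub>P\<^esub> x)"]) (auto simp: carrier add zero S.l_neg P.M.l_neg)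
  qed (auto simp: carrier add zero S.a_ac P.M.a_ac)
  have "comm_monoid T"
  proof (rule comm_monoidI)
    fix a b g assume "a \<in> carrier T" "b \<in> carrier T" "g \<in> carrier T"
    then show "a \<otimes>\<^bsub>T\<^esub> b \<otimes>\<^bsub>T\<^esub> g = a \<otimes>\<^bsub>T\<^esub> (b \<otimes>\<^bsub>T\<^esub> g)"
      by (auto simp: carrier mult S.m_ac P.smult_r_distr P.smult_assoc1[symmetric] P.M.a_assoc)
  qed (auto simp: carrier mult one S.m_comm P.M.a_comm)
  then have T: "cring T"
    using ab by (intro cringI) (auto simp: carrier add mult S.l_distr P.smult_r_distr P.smult_l_distr P.M.a_ac)
  have alg: "algebra K T"
  proof (rule algebraI[OF A.is_cring T])
    fix k l a b assume k: "k \<in> carrier K" "l \<in> carrier K" "a \<in> carrier T" "b \<in> carrier T"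
    show "(k \<odot>\<^bsub>T\<^esub> a) \<otimes>\<^bsub>T\<^esub> b = k \<odot>\<^bsub>T\<^esub> (a \<otimes>\<^bsub>T\<^esub> b)"
      using k by (auto simp: carrier smult mult cS S.m_ac P.smult_r_distr P.smult_assoc1[symmetric])
    show "(k \<oplus>\<^bsub>K\<^esub> l) \<odot>\<^bsub>T\<^esub> a = k \<odot>\<^bsub>T\<^esub> a \<oplus>\<^bsub>T\<^esub> l \<odot>\<^bsub>T\<^esub> a"
      using k by (auto simp: carrier smult add A.smult_l_distr c_add P.smult_l_distr)
    show "(k \<otimes>\<^bsub>K\<^esub> l) \<odot>\<^bsub>T\<^esub> a = k \<odot>\<^bsub>T\<^esub> (l \<odot>\<^bsub>T\<^esub> a)"
      using k by (auto simp: carrier smult A.smult_assoc1 c_mult P.smult_assoc1)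
  qed (auto simp: carrier smult add A.smult_r_distr P.smult_r_distr c_one)
  define \<iota> where "\<iota> = (\<lambda>s\<in>carrier S. e (s, \<zero>\<^bsub>P\<^esub>))"
  define j where "j x = e (\<zero>\<^bsub>S\<^esub>, x)" for x
  have sum: "\<iota> s \<oplus>\<^bsub>T\<^esub> j x = e (s, x)" if "s \<in> carrier S" "x \<in> carrier P" for s x
    using that by (simp add: \<iota>_def j_def add)
  show thesis
  proof (rule that[OF alg, of \<iota> j])
    show "\<iota> \<in> alg_hom K S T"
      by (auto simp: alg_hom_def ring_hom_def \<iota>_def carrier add mult one smult)
    show "s = s' \<and> x = x'"
      if "s \<in> carrier S" "x \<in> carrier P" "s' \<in> carrier S" "x' \<in> carrier P"
        "\<iota> s \<oplus>\<^bsub>T\<^esub> j x = \<iota> s' \<oplus>\<^bsub>T\<^esub> j x'" for s x s' x'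
      using inj_onD[OF e, of "(s, x)" "(s', x')"] that by (simp add: sum)
    show "\<exists>s\<in>carrier S. \<exists>x\<in>carrier P. t = \<iota> s \<oplus>\<^bsub>T\<^esub> j x" if "t \<in> carrier T" for t
      using that sum by (force simp: carrier)
    show "k \<odot>\<^bsub>T\<^esub> (\<iota> s \<oplus>\<^bsub>T\<^esub> j x) = \<iota> (k \<odot>\<^bsub>S\<^esub> s) \<oplus>\<^bsub>T\<^esub> j ((k \<odot>\<^bsub>S\<^esub> \<one>\<^bsub>S\<^esub>) \<odot>\<^bsub>P\<^esub> x)"
      if "k \<in> carrier K" "s \<in> carrier S" "x \<in> carrier P" for k s x
      using that c[OF that(1)] by (simp add: sum smult) (simp add: c_def sum)
  qed (simp_all add: sum add mult, auto simp: carrier j_def \<iota>_def add mult)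
qed

lemma in_keys_diffD:
  "z \<in> Poly_Mapping.keys (x - y) \<Longrightarrow> z \<in> Poly_Mapping.keys x \<or> z \<in> Poly_Mapping.keys y"
  using keys_diff[of x y] by blast

lemma tensor_relations_normal:
  assumes V: "module K V" and S: "algebra K S"
  shows "tensor_relations K V S \<lhd> tensor_group V S"
proof -
  interpret V: module K V by (rule V)
  interpret comm_group "tensor_group V S"
    unfolding tensor_group_def by (rule abelian_free_Abelian_group)
  show ?thesis
    unfolding normal_iff_subgroup tensor_relations_def
    by (rule generate_is_subgroup) (use S in \<open>auto simp: tensor_group_def keys_frag_of dest!: in_keys_diffD\<close>)
qed

lemma frag_extend_hom:
  assumes "f ` A \<subseteq> carrier (free_Abelian_group B)"
  shows "frag_extend f \<in> hom (free_Abelian_group A) (free_Abelian_group B)"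
proof (rule homI)
  fix x assume "x \<in> carrier (free_Abelian_group A)"
  then have "(\<Union>a\<in>Poly_Mapping.keys x. Poly_Mapping.keys (f a)) \<subseteq> B"
    using assms by (intro UN_least) (auto simp: image_subset_iff)
  then show "frag_extend f x \<in> carrier (free_Abelian_group B)"
    using keys_frag_extend[of f x] by simp
qed (simp add: frag_extend_add)

lemma hom_generate_subset:
  assumes "group G" "group H" "h \<in> hom G H" "Z \<subseteq> carrier G" "subgroup N H" "h ` Z \<subseteq> N"
  shows "h ` generate G Z \<subseteq> N"
proof -
  interpret group_hom G H h using assms by (simp add: group_hom_def group_hom_axioms_def)
  interpret N: subgroup N H by fact
  have "h x \<in> N" if "x \<in> generate G Z" for x
    using that
  proof induction
    case (eng x y)
    then show ?case using G.generate_in_carrier[OF assms(4)] by auto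
  next
    case (inv x)
    then show ?case using assms(4,6) by (subst hom_inv) auto
  qed (use assms(4,6) in auto)
  then show ?thesis by blast
qed

abbreviation "coset K V S z \<equiv> tensor_relations K V S #>\<^bsub>tensor_group V S\<^esub> z"

lemma tensor_map_coset:
  assumes V: "module K V" and S: "algebra K S" and T: "algebra K T" and z: "z \<in> carrier (tensor_group V S)"
    and f: "\<And>s. s \<in> carrier S \<Longrightarrow> f s \<in> carrier T"
    and f_add: "\<And>s t. s \<in> carrier S \<Longrightarrow> t \<in> carrier S \<Longrightarrow> f (s \<oplus>\<^bsub>S\<^esub> t) = f s \<oplus>\<^bsub>T\<^esub> f t"
    and f_smult: "\<And>k s. k \<in> carrier K \<Longrightarrow> s \<in> carrier S \<Longrightarrow> f (k \<odot>\<^bsub>S\<^esub> s) = k \<odot>\<^bsub>T\<^esub> f s"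
  shows "tensor_map K V T f (coset K V S z) = coset K V T (frag_extend (\<lambda>(m, s). frag_of (m, f s)) z)"
proof -
  let ?F = "frag_extend (\<lambda>(m, s). frag_of (m, f s))"
  interpret V: module K V by (rule V)
  interpret NS: normal "tensor_relations K V S" "tensor_group V S" by (rule tensor_relations_normal[OF V S])
  interpret NT: normal "tensor_relations K V T" "tensor_group V T" by (rule tensor_relations_normal[OF V T])
  have F: "?F \<in> hom (tensor_group V S) (tensor_group V T)"
    unfolding tensor_group_def by (rule frag_extend_hom) (auto simp: f)
  have R: "?F r \<in> tensor_relations K V T" if r: "r \<in> tensor_relations K V S" for r
  proof -
    have "?F ` tensor_relations K V S \<subseteq> tensor_relations K V T"
      unfolding tensor_relations_def[of K V S]
    proof (rule hom_generate_subset[OF NS.is_group NT.is_group F _ NT.is_subgroup], goal_cases)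
      case 1 show ?case using S by (auto simp: tensor_group_def keys_frag_of dest!: in_keys_diffD)
    next
      case 2 show ?case
        unfolding tensor_relations_def
        by (auto simp: frag_extend_diff f_add f_smult intro!: generate.incl)
          (use f in blast)+
    qed
    then show ?thesis using r by blast
  qed
  have "coset K V T (?F z') = coset K V T (?F z)" if "z' \<in> coset K V S z" for z'
  proof -
    have "\<exists>r\<in>tensor_relations K V S. z' = r + z"
      using that by (simp add: r_coset_def tensor_group_def)
    then obtain r where r: "r \<in> tensor_relations K V S" "z' = r + z" by blast
    have "?F z' \<in> coset K V T (?F z)"
      using R[OF r(1)] r(2) by (auto simp: r_coset_def tensor_group_def frag_extend_add)
    then show ?thesis
      using NT.repr_independence[of "?F z'" _ "?F z"] NT.is_subgroup hom_in_carrier[OF F z] by simp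
  qed
  moreover have "z \<in> coset K V S z"
    using NS.rcos_self[OF z NS.is_subgroup] .
  ultimately show ?thesis unfolding tensor_map_def by blast
qed

lemma quasi_coherent_module_simps:
  "carrier (val (quasi_coherent_module K V) S) =
    coset K V S ` carrier (tensor_group V S)"
  "C \<oplus>\<^bsub>val (quasi_coherent_module K V) S\<^esub> C' = C <#>\<^bsub>tensor_group V S\<^esub> C'"
  "s \<odot>\<^bsub>val (quasi_coherent_module K V) S\<^esub> C = tensor_map K V S (\<lambda>t. s \<otimes>\<^bsub>S\<^esub> t) C"
  "tr (quasi_coherent_module K V) S T p = tensor_map K V T p"
  by (simp_all add: quasi_coherent_module_def Let_def carrier_FactGroup)

locale quasi_coherent_functor =
  fixes K :: "'u ring" and M :: "('u, 'm) modfunctor" and V :: "('u, 'u) module" and \<beta>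
  assumes M: "mod_functor K M" and V: "module K V" and \<beta>: "\<beta> \<in> mod_iso K M (quasi_coherent_module K V)"
begin

interpretation V: module K V by (rule V)

abbreviation "Q \<equiv> quasi_coherent_module K V"
abbreviation "cs \<equiv> coset K V"

definition "q S z = inv_into (carrier (val M S)) (\<beta> S) (cs S z)"
definition "pure S v s = q S (frag_of (v, s))"

lemmas M_closed = mod_functor_closed[OF M]
lemmas M_simps [simp] = set_functor_closed[OF mod_functor_set[OF M]] set_functor_id[OF mod_functor_set[OF M]]
  set_functor_compose[OF mod_functor_set[OF M]] closed_functor_add[OF M_closed] closed_functor_smult[OF M_closed]

lemma cs_closed: "z \<in> carrier (tensor_group V S) \<Longrightarrow> cs S z \<in> carrier (val Q S)"
  by (simp add: quasi_coherent_module_simps)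

lemma q_closed [simp]:
  "algebra K S \<Longrightarrow> z \<in> carrier (tensor_group V S) \<Longrightarrow> q S z \<in> carrier (val M S)"
  unfolding q_def by (intro mod_isoD(7)[OF \<beta>] cs_closed)

lemma \<beta>_q: "algebra K S \<Longrightarrow> z \<in> carrier (tensor_group V S) \<Longrightarrow> \<beta> S (q S z) = cs S z"
  unfolding q_def by (intro mod_isoD(8)[OF \<beta>] cs_closed)

lemma \<beta>_eq: "algebra K S \<Longrightarrow> x \<in> carrier (val M S) \<Longrightarrow> y \<in> carrier (val M S) \<Longrightarrow> \<beta> S x = \<beta> S y \<Longrightarrow> x = y"
  using mod_isoD(6)[OF \<beta>] by (auto dest: inj_onD)

lemma q_surj:
  assumes "algebra K S" "m \<in> carrier (val M S)"
  obtains z where "z \<in> carrier (tensor_group V S)" "m = q S z"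
proof -
  obtain z where z: "z \<in> carrier (tensor_group V S)" "\<beta> S m = cs S z"
    using mod_isoD(1)[OF \<beta> assms] by (auto simp: quasi_coherent_module_simps)
  show thesis
    by (rule that[OF z(1)], rule \<beta>_eq[OF assms q_closed[OF assms(1) z(1)]])
      (simp add: z(2) \<beta>_q[OF assms(1) z(1)])
qed

lemma tensor_group_add [simp]:
  "x \<in> carrier (tensor_group V S) \<Longrightarrow> y \<in> carrier (tensor_group V S) \<Longrightarrow> x + y \<in> carrier (tensor_group V S)"
  "x \<in> carrier (tensor_group V S) \<Longrightarrow> y \<in> carrier (tensor_group V S) \<Longrightarrow> x - y \<in> carrier (tensor_group V S)"
  "x \<in> carrier (tensor_group V S) \<Longrightarrow> - x \<in> carrier (tensor_group V S)"
  "0 \<in> carrier (tensor_group V S)"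
  "frag_of (v, s) \<in> carrier (tensor_group V S) \<longleftrightarrow> v \<in> carrier V \<and> s \<in> carrier S"
  using keys_add[of x y] keys_diff[of x y] by (auto simp: tensor_group_def)

lemma q_add:
  assumes S: "algebra K S" and z: "z \<in> carrier (tensor_group V S)" "z' \<in> carrier (tensor_group V S)"
  shows "q S (z + z') = q S z \<oplus>\<^bsub>val M S\<^esub> q S z'"
proof (rule \<beta>_eq[OF S])
  interpret N: normal "tensor_relations K V S" "tensor_group V S" by (rule tensor_relations_normal[OF V S])
  have "cs S z <#>\<^bsub>tensor_group V S\<^esub> cs S z' = cs S (z + z')"
    using N.rcos_sum[OF z] by (simp add: tensor_group_def)
  then show "\<beta> S (q S (z + z')) = \<beta> S (q S z \<oplus>\<^bsub>val M S\<^esub> q S z')"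
    using S z mod_isoD(3)[OF \<beta> S, of "q S z" "q S z'"] by (simp add: \<beta>_q quasi_coherent_module_simps)
qed (use S z in simp_all)

lemma q_zero: "algebra K S \<Longrightarrow> q S 0 = \<zero>\<^bsub>val M S\<^esub>"
proof -
  assume S: "algebra K S"
  interpret M: module S "val M S" by (rule mod_functor_module[OF M S])
  show ?thesis using q_add[OF S, of 0 0] q_closed[OF S, of 0] M.M.add.r_cancel_one' by simp
qed

lemma q_relation:
  assumes S: "algebra K S" and z: "z \<in> carrier (tensor_group V S)" "z' \<in> carrier (tensor_group V S)"
    and "z - z' \<in> tensor_relations K V S"
  shows "q S z = q S z'"
proof -
  interpret N: normal "tensor_relations K V S" "tensor_group V S" by (rule tensor_relations_normal[OF V S])
  have "z = (z - z') + z'" by simp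
  then have "z \<in> cs S z'" using assms(4) by (force simp: r_coset_def tensor_group_def)
  then have "cs S z = cs S z'" using N.repr_independence[OF _ z(2) N.is_subgroup] by simp
  then show ?thesis by (simp add: q_def)
qed

lemma pure_closed [simp]:
  "algebra K S \<Longrightarrow> v \<in> carrier V \<Longrightarrow> s \<in> carrier S \<Longrightarrow> pure S v s \<in> carrier (val M S)"
  by (simp add: pure_def)

lemma pure_add_left:
  assumes S: "algebra K S" and v: "v \<in> carrier V" "v' \<in> carrier V" and s: "s \<in> carrier S"
  shows "pure S (v \<oplus>\<^bsub>V\<^esub> v') s = pure S v s \<oplus>\<^bsub>val M S\<^esub> pure S v' s"
proof -
  have "frag_of (v \<oplus>\<^bsub>V\<^esub> v', s) - frag_of (v, s) - frag_of (v', s) \<in> tensor_relations K V S"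
    unfolding tensor_relations_def using assms by (intro generate.incl) blast
  then have "frag_of (v \<oplus>\<^bsub>V\<^esub> v', s) - (frag_of (v, s) + frag_of (v', s)) \<in> tensor_relations K V S"
    by (simp add: diff_diff_eq)
  then have "q S (frag_of (v \<oplus>\<^bsub>V\<^esub> v', s)) = q S (frag_of (v, s) + frag_of (v', s))"
    using assms by (intro q_relation) simp_all
  then show ?thesis using assms by (simp add: pure_def q_add)
qed

lemma pure_balanced:
  assumes "algebra K S" "v \<in> carrier V" "s \<in> carrier S" "k \<in> carrier K"
  shows "pure S (k \<odot>\<^bsub>V\<^esub> v) s = pure S v (k \<odot>\<^bsub>S\<^esub> s)"
  unfolding pure_def
proof (rule q_relation)
  show "frag_of (k \<odot>\<^bsub>V\<^esub> v, s) - frag_of (v, k \<odot>\<^bsub>S\<^esub> s) \<in> tensor_relations K V S"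
    unfolding tensor_relations_def using assms by (intro generate.incl) blast
qed (use assms in simp_all)

lemma pure_smult:
  assumes S: "algebra K S" and "v \<in> carrier V" "s \<in> carrier S" "t \<in> carrier S"
  shows "t \<odot>\<^bsub>val M S\<^esub> pure S v s = pure S v (t \<otimes>\<^bsub>S\<^esub> s)"
proof (rule \<beta>_eq[OF S])
  interpret S: cring S by (rule algebraD(1)[OF S])
  interpret SM: module K S by (rule algebraD(2)[OF S])
  have "t \<otimes>\<^bsub>S\<^esub> (k \<odot>\<^bsub>S\<^esub> u) = k \<odot>\<^bsub>S\<^esub> (t \<otimes>\<^bsub>S\<^esub> u)" if "k \<in> carrier K" "u \<in> carrier S" for k u
    using algebra.smult_assoc2[OF S, of k u t] that assms by (simp add: S.m_comm)
  then have "tensor_map K V S (\<lambda>u. t \<otimes>\<^bsub>S\<^esub> u) (cs S (frag_of (v, s))) = cs S (frag_of (v, t \<otimes>\<^bsub>S\<^esub> s))"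
    using assms by (subst tensor_map_coset[OF V S S]) (simp_all add: S.r_distr)
  then show "\<beta> S (t \<odot>\<^bsub>val M S\<^esub> pure S v s) = \<beta> S (pure S v (t \<otimes>\<^bsub>S\<^esub> s))"
    using assms mod_isoD(4)[OF \<beta> S, of t "pure S v s"]
    by (simp add: pure_def \<beta>_q quasi_coherent_module_simps)
qed (use assms in simp_all)

lemma pure_tr:
  assumes S: "algebra K S" and v: "v \<in> carrier V" "s \<in> carrier S" and T: "algebra K T" "p \<in> alg_hom K S T"
  shows "tr M S T p (pure S v s) = pure T v (p s)"
proof (rule \<beta>_eq[OF T(1)])
  have "tensor_map K V T p (cs S (frag_of (v, s))) = cs T (frag_of (v, p s))"
    using assms alg_hom_closed[OF T(2)]
    by (subst tensor_map_coset[OF V S T(1)]) (simp_all add: alg_hom_add alg_hom_smult)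
  then show "\<beta> T (tr M S T p (pure S v s)) = \<beta> T (pure T v (p s))"
    using assms mod_isoD(2)[OF \<beta> S T, of "pure S v s"] alg_hom_closed[OF T(2)]
    by (simp add: pure_def \<beta>_q quasi_coherent_module_simps)
qed (use assms alg_hom_closed[OF T(2)] in simp_all)

lemma tensor_induct [consumes 2, case_names zero add_pure]:
  assumes S: "algebra K S" and m: "m \<in> carrier (val M S)"
    and zero: "P \<zero>\<^bsub>val M S\<^esub>"
    and step: "\<And>x v s. x \<in> carrier (val M S) \<Longrightarrow> P x \<Longrightarrow> v \<in> carrier V \<Longrightarrow> s \<in> carrier S \<Longrightarrow>
      P (x \<oplus>\<^bsub>val M S\<^esub> pure S v s)"
  shows "P m"
proof -
  interpret M: module S "val M S" by (rule mod_functor_module[OF M S])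
  have neg: "q S (- frag_of (v, s)) = pure S (\<ominus>\<^bsub>V\<^esub> v) s" if v: "v \<in> carrier V" "s \<in> carrier S" for v s
  proof -
    have 0: "pure S \<zero>\<^bsub>V\<^esub> s = \<zero>\<^bsub>val M S\<^esub>"
      using pure_add_left[OF S, of "\<zero>\<^bsub>V\<^esub>" "\<zero>\<^bsub>V\<^esub>" s] pure_closed[OF S, of "\<zero>\<^bsub>V\<^esub>" s] v
        M.M.add.r_cancel_one' by simp
    have "q S (- frag_of (v, s)) \<oplus>\<^bsub>val M S\<^esub> pure S v s = \<zero>\<^bsub>val M S\<^esub>"
      using q_add[OF S, of "- frag_of (v, s)" "frag_of (v, s)"] v by (simp add: pure_def q_zero S)
    moreover have "pure S (\<ominus>\<^bsub>V\<^esub> v) s \<oplus>\<^bsub>val M S\<^esub> pure S v s = \<zero>\<^bsub>val M S\<^esub>"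
      using pure_add_left[OF S, of "\<ominus>\<^bsub>V\<^esub> v" v s] v by (simp add: V.M.l_neg 0)
    ultimately show ?thesis using v S
      by (metis M.M.minus_equality V.M.a_inv_closed pure_closed q_closed tensor_group_add(3,5))
  qed
  have "\<forall>x\<in>carrier (val M S). P x \<longrightarrow> P (x \<oplus>\<^bsub>val M S\<^esub> q S z) \<and> P (x \<oplus>\<^bsub>val M S\<^esub> q S (- z))"
    if "Poly_Mapping.keys z \<subseteq> carrier V \<times> carrier S" for z
  proof (rule free_Abelian_group_induct[OF that], goal_cases)
    case 1
    then show ?case using S by (simp add: q_zero)
  next
    case (2 y z)
    have yz: "y \<in> carrier (tensor_group V S)" "z \<in> carrier (tensor_group V S)"
      using 2(1,2) by (simp_all add: tensor_group_def)
    show ?case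
    proof (intro ballI impI conjI)
      fix x assume x: "x \<in> carrier (val M S)" "P x"
      have "P (x \<oplus>\<^bsub>val M S\<^esub> q S y \<oplus>\<^bsub>val M S\<^esub> q S (- z))" using 2 x yz S by simp
      then show "P (x \<oplus>\<^bsub>val M S\<^esub> q S (y - z))"
        using q_add[OF S, of y "- z"] x yz S by (simp add: M.M.a_assoc)
      have "P (x \<oplus>\<^bsub>val M S\<^esub> q S (- y) \<oplus>\<^bsub>val M S\<^esub> q S z)" using 2 x yz S by simp
      then show "P (x \<oplus>\<^bsub>val M S\<^esub> q S (- (y - z)))"
        using q_add[OF S, of "- y" z] x yz S by (simp add: M.M.a_assoc)
    qed
  next
    case (3 a)
    then show ?case using step neg pure_def by (cases a) auto
  qed
  moreover obtain z where "z \<in> carrier (tensor_group V S)" "m = q S z"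
    using q_surj[OF S m] .
  ultimately show ?thesis using zero m S
    by (metis M.M.l_zero M.M.zero_closed carrier_free_Abelian_group_iff tensor_group_def)
qed

lemma carrier_lepoll:
  assumes inf: "infinite (UNIV :: 'u set)" and S: "algebra K S"
  shows "carrier (val M S) \<lesssim> (UNIV :: 'u set)"
proof -
  have inf2: "infinite (UNIV :: ('u \<times> 'u) set)" using inf by (simp add: finite_prod)
  have "carrier (val M S) \<subseteq> q S ` carrier (tensor_group V S)"
    by (auto elim: q_surj[OF S])
  then have "carrier (val M S) \<lesssim> carrier (tensor_group V S)"
    using subset_image_lepoll by blast
  also have "\<dots> \<lesssim> carrier (free_Abelian_group (UNIV :: ('u \<times> 'u) set))"
    by (intro subset_imp_lepoll) (auto simp: tensor_group_def)
  also have "\<dots> \<approx> (UNIV :: ('u \<times> 'u) set)" by (rule eqpoll_free_Abelian_group_infinite[OF inf2])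
  also have "\<dots> \<approx> (UNIV :: 'u set)"
    unfolding eqpoll_iff_card_of_ordIso using card_of_Times_same_infinite[OF inf] by simp
  finally show ?thesis .
qed

lemma tensor_universal:
  assumes T: "algebra K T" and \<phi>: "\<And>v. v \<in> carrier V \<Longrightarrow> \<phi> v \<in> carrier T"
    and \<phi>_add: "\<And>v w. v \<in> carrier V \<Longrightarrow> w \<in> carrier V \<Longrightarrow> \<phi> (v \<oplus>\<^bsub>V\<^esub> w) = \<phi> v \<oplus>\<^bsub>T\<^esub> \<phi> w"
    and \<phi>_smult: "\<And>k v. k \<in> carrier K \<Longrightarrow> v \<in> carrier V \<Longrightarrow> \<phi> (k \<odot>\<^bsub>V\<^esub> v) = k \<odot>\<^bsub>T\<^esub> \<phi> v"
  obtains h where "\<And>x. x \<in> carrier (val M T) \<Longrightarrow> h x \<in> carrier T"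
    and "\<And>x y. x \<in> carrier (val M T) \<Longrightarrow> y \<in> carrier (val M T) \<Longrightarrow> h (x \<oplus>\<^bsub>val M T\<^esub> y) = h x \<oplus>\<^bsub>T\<^esub> h y"
    and "\<And>v t. v \<in> carrier V \<Longrightarrow> t \<in> carrier T \<Longrightarrow> h (pure T v t) = \<phi> v \<otimes>\<^bsub>T\<^esub> t"
proof -
  interpret T: cring T by (rule algebraD(1)[OF T])
  interpret TA: algebra K T by (rule T)
  interpret N: normal "tensor_relations K V T" "tensor_group V T" by (rule tensor_relations_normal[OF V T])
  obtain h0 where h0: "h0 \<in> hom (tensor_group V T) (add_monoid T)"
    and h0_of: "\<And>x. x \<in> carrier V \<times> carrier T \<Longrightarrow> h0 (frag_of x) = (case x of (v, t) \<Rightarrow> \<phi> v \<otimes>\<^bsub>T\<^esub> t)"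
    unfolding tensor_group_def
    by (rule comm_group.free_Abelian_group_universal[OF T.a_comm_group, of "\<lambda>(v, t). \<phi> v \<otimes>\<^bsub>T\<^esub> t" "carrier V \<times> carrier T"])
      (use \<phi> in auto)
  interpret h0: group_hom "tensor_group V T" "add_monoid T" h0
    using h0 N.is_group T.a_group by (simp add: group_hom_def group_hom_axioms_def)
  have h0_add: "h0 (x + y) = h0 x \<oplus>\<^bsub>T\<^esub> h0 y" if "x \<in> carrier (tensor_group V T)" "y \<in> carrier (tensor_group V T)" for x y
    using h0.hom_mult[OF that] by (simp add: tensor_group_def)
  have h0_diff: "h0 (x - y) = h0 x \<ominus>\<^bsub>T\<^esub> h0 y" if "x \<in> carrier (tensor_group V T)" "y \<in> carrier (tensor_group V T)" for x y
    using h0_add[of "x - y" y] that h0.hom_closed[of y] h0.hom_closed[of "x - y"]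
    by (simp add: T.minus_eq T.a_assoc T.r_neg)
  have cancel: "b \<ominus>\<^bsub>T\<^esub> b = \<zero>\<^bsub>T\<^esub>" "b \<oplus>\<^bsub>T\<^esub> c \<ominus>\<^bsub>T\<^esub> b = c"
    if "b \<in> carrier T" "c \<in> carrier T" for b c
    using that by (simp_all add: T.minus_eq T.r_neg T.a_comm[of b c] T.a_assoc)
  have swap: "(k \<odot>\<^bsub>T\<^esub> a) \<otimes>\<^bsub>T\<^esub> b = a \<otimes>\<^bsub>T\<^esub> (k \<odot>\<^bsub>T\<^esub> b)"
    if "k \<in> carrier K" "a \<in> carrier T" "b \<in> carrier T" for k a b
    using TA.smult_assoc2[of k a b] TA.smult_assoc2[of k b a] that T by (simp add: T.m_comm)
  have "h0 ` tensor_relations K V T \<subseteq> {\<zero>\<^bsub>T\<^esub>}"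
    unfolding tensor_relations_def
  proof (rule hom_generate_subset[OF N.is_group T.a_group h0], goal_cases)
    case 1 show ?case using T by auto
  next
    case 2 show ?case using group.triv_subgroup[OF T.a_group] by simp
  next
    case 3 show ?case using T
      by (auto simp: h0_diff h0_of \<phi> \<phi>_add \<phi>_smult swap cancel T.l_distr T.r_distr)
  qed
  then have "tensor_relations K V T \<subseteq> kernel (tensor_group V T) (add_monoid T) h0"
    using N.subset by (auto simp: kernel_def)
  from h0.FactGroup_universal_kernel[OF N.normal_axioms this] obtain g
    where g: "g \<in> hom (tensor_group V T Mod tensor_relations K V T) (add_monoid T)"
      "\<And>x. x \<in> carrier (tensor_group V T) \<Longrightarrow> g (cs T x) = h0 x" by blast
  show thesis
  proof (rule that[of "\<lambda>x. g (\<beta> T x)"])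
    fix x y assume x: "x \<in> carrier (val M T)"
    then obtain z where z: "z \<in> carrier (tensor_group V T)" "x = q T z" by (rule q_surj[OF T])
    then show "g (\<beta> T x) \<in> carrier T" using h0.hom_closed by (simp add: \<beta>_q T g)
    assume y: "y \<in> carrier (val M T)"
    then obtain z' where z': "z' \<in> carrier (tensor_group V T)" "y = q T z'" by (rule q_surj[OF T])
    then show "g (\<beta> T (x \<oplus>\<^bsub>val M T\<^esub> y)) = g (\<beta> T x) \<oplus>\<^bsub>T\<^esub> g (\<beta> T y)"
      using z by (simp add: \<beta>_q T g h0_add flip: q_add)
  next
    fix v t assume "v \<in> carrier V" "t \<in> carrier T"
    then show "g (\<beta> T (pure T v t)) = \<phi> v \<otimes>\<^bsub>T\<^esub> t"
      by (simp add: pure_def \<beta>_q T g h0_of)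
  qed
qed

end

section \<open>Quasi-coherent modules are dual functors\<close>

definition linear_functionals :: "'u ring \<Rightarrow> ('u, 'v) module \<Rightarrow> ('u, 'v \<Rightarrow> 'u) modfunctor" where
  "linear_functionals K V =
     \<lparr>val = (\<lambda>S.
        \<lparr>carrier = {\<phi> \<in> carrier V \<rightarrow>\<^sub>E carrier S.
           (\<forall>v\<in>carrier V. \<forall>w\<in>carrier V. \<phi> (v \<oplus>\<^bsub>V\<^esub> w) = \<phi> v \<oplus>\<^bsub>S\<^esub> \<phi> w) \<and>
           (\<forall>k\<in>carrier K. \<forall>v\<in>carrier V. \<phi> (k \<odot>\<^bsub>V\<^esub> v) = k \<odot>\<^bsub>S\<^esub> \<phi> v)},
         monoid.mult = undefined,
         one = undefined,
         ring.zero = (\<lambda>v\<in>carrier V. \<zero>\<^bsub>S\<^esub>),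
         ring.add = (\<lambda>\<phi> \<psi>. \<lambda>v\<in>carrier V. \<phi> v \<oplus>\<^bsub>S\<^esub> \<psi> v),
         smult = (\<lambda>s \<phi>. \<lambda>v\<in>carrier V. s \<otimes>\<^bsub>S\<^esub> \<phi> v)\<rparr>),
      tr = (\<lambda>S T p \<phi>. \<lambda>v\<in>carrier V. p (\<phi> v))\<rparr>"

lemma linear_functionals_simps:
  "\<phi> \<oplus>\<^bsub>val (linear_functionals K V) S\<^esub> \<psi> = (\<lambda>v\<in>carrier V. \<phi> v \<oplus>\<^bsub>S\<^esub> \<psi> v)"
  "s \<odot>\<^bsub>val (linear_functionals K V) S\<^esub> \<phi> = (\<lambda>v\<in>carrier V. s \<otimes>\<^bsub>S\<^esub> \<phi> v)"
  "\<zero>\<^bsub>val (linear_functionals K V) S\<^esub> = (\<lambda>v\<in>carrier V. \<zero>\<^bsub>S\<^esub>)"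
  "tr (linear_functionals K V) S T p \<phi> = (\<lambda>v\<in>carrier V. p (\<phi> v))"
  by (simp_all add: linear_functionals_def)

lemma linear_functionals_carrier:
  "\<phi> \<in> carrier (val (linear_functionals K V) S) \<longleftrightarrow> \<phi> \<in> carrier V \<rightarrow>\<^sub>E carrier S \<and>
    (\<forall>v\<in>carrier V. \<forall>w\<in>carrier V. \<phi> (v \<oplus>\<^bsub>V\<^esub> w) = \<phi> v \<oplus>\<^bsub>S\<^esub> \<phi> w) \<and>
    (\<forall>k\<in>carrier K. \<forall>v\<in>carrier V. \<phi> (k \<odot>\<^bsub>V\<^esub> v) = k \<odot>\<^bsub>S\<^esub> \<phi> v)"
  by (simp add: linear_functionals_def)

lemma linear_functionalsD:
  assumes "\<phi> \<in> carrier (val (linear_functionals K V) S)"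
  shows "v \<in> carrier V \<Longrightarrow> \<phi> v \<in> carrier S"
    and "v \<in> carrier V \<Longrightarrow> w \<in> carrier V \<Longrightarrow> \<phi> (v \<oplus>\<^bsub>V\<^esub> w) = \<phi> v \<oplus>\<^bsub>S\<^esub> \<phi> w"
    and "k \<in> carrier K \<Longrightarrow> v \<in> carrier V \<Longrightarrow> \<phi> (k \<odot>\<^bsub>V\<^esub> v) = k \<odot>\<^bsub>S\<^esub> \<phi> v"
    and "\<phi> \<in> extensional (carrier V)"
  using assms by (auto simp: linear_functionals_carrier PiE_iff)

lemma algebra_smult_mult:
  assumes "algebra K S" "k \<in> carrier K" "s \<in> carrier S" "t \<in> carrier S"
  shows "(k \<odot>\<^bsub>S\<^esub> s) \<otimes>\<^bsub>S\<^esub> t = k \<odot>\<^bsub>S\<^esub> (s \<otimes>\<^bsub>S\<^esub> t)" "s \<otimes>\<^bsub>S\<^esub> (k \<odot>\<^bsub>S\<^esub> t) = k \<odot>\<^bsub>S\<^esub> (s \<otimes>\<^bsub>S\<^esub> t)"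
proof -
  interpret S: cring S by (rule algebraD(1)[OF assms(1)])
  show "(k \<odot>\<^bsub>S\<^esub> s) \<otimes>\<^bsub>S\<^esub> t = k \<odot>\<^bsub>S\<^esub> (s \<otimes>\<^bsub>S\<^esub> t)" "s \<otimes>\<^bsub>S\<^esub> (k \<odot>\<^bsub>S\<^esub> t) = k \<odot>\<^bsub>S\<^esub> (s \<otimes>\<^bsub>S\<^esub> t)"
    using algebra.smult_assoc2[OF assms(1), of k s t] algebra.smult_assoc2[OF assms(1), of k t s] assms
    by (simp_all add: S.m_comm)
qed

lemma mod_functor_linear_functionals:
  assumes V: "module K V"
  shows "mod_functor K (linear_functionals K V)"
  unfolding mod_functor_def
proof (intro conjI allI impI ballI)
  let ?N = "linear_functionals K V"
  interpret V: module K V by (rule V)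
  show "set_functor K ?N"
    unfolding set_functor_def
    by (auto simp: linear_functionals_carrier linear_functionals_simps alg_hom_closed alg_hom_add
        alg_hom_smult PiE_iff extensional_def fun_eq_iff)
  fix S :: "'a alg" assume S: "algebra K S"
  interpret S: cring S by (rule algebraD(1)[OF S])
  interpret SM: module K S by (rule algebraD(2)[OF S])
  have closed: "\<phi> \<oplus>\<^bsub>val ?N S\<^esub> \<psi> \<in> carrier (val ?N S)" "s \<odot>\<^bsub>val ?N S\<^esub> \<phi> \<in> carrier (val ?N S)"
    if "\<phi> \<in> carrier (val ?N S)" "\<psi> \<in> carrier (val ?N S)" "s \<in> carrier S" for \<phi> \<psi> s
    unfolding linear_functionals_carrier linear_functionals_simps
    using linear_functionalsD[OF that(1)] linear_functionalsD[OF that(2)] that(3) S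
    by (auto simp: S.a_ac SM.smult_r_distr S.r_distr algebra_smult_mult)
  have zero: "\<zero>\<^bsub>val ?N S\<^esub> \<in> carrier (val ?N S)"
    unfolding linear_functionals_carrier linear_functionals_simps by auto
  have "abelian_group (val ?N S)"
  proof (rule abelian_groupI)
    fix \<phi> assume \<phi>: "\<phi> \<in> carrier (val ?N S)"
    note \<phi>' = linear_functionalsD[OF \<phi>]
    show "\<zero>\<^bsub>val ?N S\<^esub> \<oplus>\<^bsub>val ?N S\<^esub> \<phi> = \<phi>"
      by (rule extensionalityI[OF _ \<phi>'(4)]) (auto simp: linear_functionals_simps \<phi>')
    have "(\<ominus>\<^bsub>S\<^esub> \<one>\<^bsub>S\<^esub>) \<odot>\<^bsub>val ?N S\<^esub> \<phi> \<oplus>\<^bsub>val ?N S\<^esub> \<phi> = \<zero>\<^bsub>val ?N S\<^esub>"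
      by (rule extensionalityI[of _ "carrier V"]) (auto simp: linear_functionals_simps \<phi>' S.l_minus S.l_neg)
    moreover have "(\<ominus>\<^bsub>S\<^esub> \<one>\<^bsub>S\<^esub>) \<odot>\<^bsub>val ?N S\<^esub> \<phi> \<in> carrier (val ?N S)" by (intro closed(2)[OF \<phi> \<phi>]) simp
    ultimately show "\<exists>\<psi>\<in>carrier (val ?N S). \<psi> \<oplus>\<^bsub>val ?N S\<^esub> \<phi> = \<zero>\<^bsub>val ?N S\<^esub>" by blast
    fix \<psi> assume \<psi>: "\<psi> \<in> carrier (val ?N S)"
    note \<psi>' = linear_functionalsD[OF \<psi>]
    show "\<phi> \<oplus>\<^bsub>val ?N S\<^esub> \<psi> \<in> carrier (val ?N S)" by (intro closed(1)[OF \<phi> \<psi> S.zero_closed])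
    show "\<phi> \<oplus>\<^bsub>val ?N S\<^esub> \<psi> = \<psi> \<oplus>\<^bsub>val ?N S\<^esub> \<phi>"
      by (rule extensionalityI[of _ "carrier V"]) (auto simp: linear_functionals_simps \<phi>' \<psi>' S.a_comm)
    fix \<chi> assume \<chi>: "\<chi> \<in> carrier (val ?N S)"
    show "\<phi> \<oplus>\<^bsub>val ?N S\<^esub> \<psi> \<oplus>\<^bsub>val ?N S\<^esub> \<chi> = \<phi> \<oplus>\<^bsub>val ?N S\<^esub> (\<psi> \<oplus>\<^bsub>val ?N S\<^esub> \<chi>)"
      by (rule extensionalityI[of _ "carrier V"])
        (auto simp: linear_functionals_simps \<phi>' \<psi>' linear_functionalsD(1)[OF \<chi>] S.a_assoc)
  qed (rule zero)
  then show "module S (val ?N S)"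
  proof (rule moduleI[OF S.is_cring])
    show "\<one>\<^bsub>S\<^esub> \<odot>\<^bsub>val ?N S\<^esub> \<phi> = \<phi>" if "\<phi> \<in> carrier (val ?N S)" for \<phi>
      by (rule extensionalityI[OF _ linear_functionalsD(4)[OF that]])
        (auto simp: linear_functionals_simps linear_functionalsD[OF that])
    fix s t \<phi> \<psi> assume *: "s \<in> carrier S" "t \<in> carrier S" and \<phi>: "\<phi> \<in> carrier (val ?N S)"
    note \<phi>' = linear_functionalsD[OF \<phi>]
    show "s \<odot>\<^bsub>val ?N S\<^esub> \<phi> \<in> carrier (val ?N S)" by (rule closed(2)[OF \<phi> \<phi> *(1)])
    show "(s \<oplus>\<^bsub>S\<^esub> t) \<odot>\<^bsub>val ?N S\<^esub> \<phi> = s \<odot>\<^bsub>val ?N S\<^esub> \<phi> \<oplus>\<^bsub>val ?N S\<^esub> t \<odot>\<^bsub>val ?N S\<^esub> \<phi>"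
      by (rule extensionalityI[of _ "carrier V"]) (auto simp: linear_functionals_simps \<phi>' * S.l_distr)
    show "(s \<otimes>\<^bsub>S\<^esub> t) \<odot>\<^bsub>val ?N S\<^esub> \<phi> = s \<odot>\<^bsub>val ?N S\<^esub> (t \<odot>\<^bsub>val ?N S\<^esub> \<phi>)"
      by (rule extensionalityI[of _ "carrier V"]) (auto simp: linear_functionals_simps \<phi>' * S.m_assoc)
    assume \<psi>: "\<psi> \<in> carrier (val ?N S)"
    note \<psi>' = linear_functionalsD[OF \<psi>]
    show "s \<odot>\<^bsub>val ?N S\<^esub> (\<phi> \<oplus>\<^bsub>val ?N S\<^esub> \<psi>) = s \<odot>\<^bsub>val ?N S\<^esub> \<phi> \<oplus>\<^bsub>val ?N S\<^esub> s \<odot>\<^bsub>val ?N S\<^esub> \<psi>"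
      by (rule extensionalityI[of _ "carrier V"]) (auto simp: linear_functionals_simps \<phi>' \<psi>' * S.r_distr)
  qed
qed (auto simp: linear_functionals_carrier linear_functionals_simps alg_hom_add alg_hom_mult PiE_iff fun_eq_iff)

context quasi_coherent_functor begin

interpretation V: module K V by (rule V)

abbreviation "N \<equiv> linear_functionals K V"

lemmas N = mod_functor_linear_functionals[OF V]
lemmas N_simps [simp] = set_functor_closed[OF mod_functor_set[OF N]] set_functor_id[OF mod_functor_set[OF N]]
  set_functor_compose[OF mod_functor_set[OF N]] closed_functor_add[OF mod_functor_closed[OF N]]
  closed_functor_smult[OF mod_functor_closed[OF N]]

definition "pair T \<phi> = (SOME h. (\<forall>x\<in>carrier (val M T). h x \<in> carrier T) \<and>
  (\<forall>x\<in>carrier (val M T). \<forall>y\<in>carrier (val M T). h (x \<oplus>\<^bsub>val M T\<^esub> y) = h x \<oplus>\<^bsub>T\<^esub> h y) \<and>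
  (\<forall>v\<in>carrier V. \<forall>t\<in>carrier T. h (pure T v t) = \<phi> v \<otimes>\<^bsub>T\<^esub> t))"

lemma pair:
  assumes T: "algebra K T" and \<phi>: "\<phi> \<in> carrier (val N T)"
  shows "x \<in> carrier (val M T) \<Longrightarrow> pair T \<phi> x \<in> carrier T"
    and "x \<in> carrier (val M T) \<Longrightarrow> y \<in> carrier (val M T) \<Longrightarrow>
      pair T \<phi> (x \<oplus>\<^bsub>val M T\<^esub> y) = pair T \<phi> x \<oplus>\<^bsub>T\<^esub> pair T \<phi> y"
    and "v \<in> carrier V \<Longrightarrow> t \<in> carrier T \<Longrightarrow> pair T \<phi> (pure T v t) = \<phi> v \<otimes>\<^bsub>T\<^esub> t"
proof -
  obtain h where "\<And>x. x \<in> carrier (val M T) \<Longrightarrow> h x \<in> carrier T"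
    and "\<And>x y. x \<in> carrier (val M T) \<Longrightarrow> y \<in> carrier (val M T) \<Longrightarrow> h (x \<oplus>\<^bsub>val M T\<^esub> y) = h x \<oplus>\<^bsub>T\<^esub> h y"
    and "\<And>v t. v \<in> carrier V \<Longrightarrow> t \<in> carrier T \<Longrightarrow> h (pure T v t) = \<phi> v \<otimes>\<^bsub>T\<^esub> t"
    by (rule tensor_universal[OF T, of \<phi>]) (use linear_functionalsD[OF \<phi>] in auto)
  then have "\<exists>h. (\<forall>x\<in>carrier (val M T). h x \<in> carrier T) \<and>
    (\<forall>x\<in>carrier (val M T). \<forall>y\<in>carrier (val M T). h (x \<oplus>\<^bsub>val M T\<^esub> y) = h x \<oplus>\<^bsub>T\<^esub> h y) \<and>
    (\<forall>v\<in>carrier V. \<forall>t\<in>carrier T. h (pure T v t) = \<phi> v \<otimes>\<^bsub>T\<^esub> t)" by blast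
  from someI_ex[OF this]
  show "x \<in> carrier (val M T) \<Longrightarrow> pair T \<phi> x \<in> carrier T"
    and "x \<in> carrier (val M T) \<Longrightarrow> y \<in> carrier (val M T) \<Longrightarrow>
      pair T \<phi> (x \<oplus>\<^bsub>val M T\<^esub> y) = pair T \<phi> x \<oplus>\<^bsub>T\<^esub> pair T \<phi> y"
    and "v \<in> carrier V \<Longrightarrow> t \<in> carrier T \<Longrightarrow> pair T \<phi> (pure T v t) = \<phi> v \<otimes>\<^bsub>T\<^esub> t"
    unfolding pair_def by blast+
qed

lemma zero_M [simp]: "algebra K T \<Longrightarrow> \<zero>\<^bsub>val M T\<^esub> \<in> carrier (val M T)"
  using q_closed[of T 0] by (simp add: q_zero)

lemma additive_zero:
  assumes T: "algebra K T" "algebra K U" and h: "h \<zero>\<^bsub>val M T\<^esub> \<in> carrier U"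
    "h (\<zero>\<^bsub>val M T\<^esub> \<oplus>\<^bsub>val M T\<^esub> \<zero>\<^bsub>val M T\<^esub>) = h \<zero>\<^bsub>val M T\<^esub> \<oplus>\<^bsub>U\<^esub> h \<zero>\<^bsub>val M T\<^esub>"
  shows "h \<zero>\<^bsub>val M T\<^esub> = \<zero>\<^bsub>U\<^esub>"
proof -
  interpret U: cring U by (rule algebraD(1)[OF T(2)])
  interpret M: module T "val M T" by (rule mod_functor_module[OF M T(1)])
  show ?thesis using h U.add.r_cancel_one' by simp
qed

lemma additive_eq:
  assumes T: "algebra K T" "algebra K U" and x: "x \<in> carrier (val M T)"
    and h: "\<And>x. x \<in> carrier (val M T) \<Longrightarrow> h x \<in> carrier U"
      "\<And>x y. x \<in> carrier (val M T) \<Longrightarrow> y \<in> carrier (val M T) \<Longrightarrow> h (x \<oplus>\<^bsub>val M T\<^esub> y) = h x \<oplus>\<^bsub>U\<^esub> h y"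
    and h': "\<And>x. x \<in> carrier (val M T) \<Longrightarrow> h' x \<in> carrier U"
      "\<And>x y. x \<in> carrier (val M T) \<Longrightarrow> y \<in> carrier (val M T) \<Longrightarrow> h' (x \<oplus>\<^bsub>val M T\<^esub> y) = h' x \<oplus>\<^bsub>U\<^esub> h' y"
    and eq: "\<And>v t. v \<in> carrier V \<Longrightarrow> t \<in> carrier T \<Longrightarrow> h (pure T v t) = h' (pure T v t)"
  shows "h x = h' x"
  using T(1) x
proof (induction x rule: tensor_induct)
  case zero
  show ?case using additive_zero[OF T, of h] additive_zero[OF T, of h'] h h' T by simp
next
  case (add_pure x v s)
  then show ?case using T h h' eq by simp
qed

lemma pair_smult:
  assumes T: "algebra K T" and \<phi>: "\<phi> \<in> carrier (val N T)" and x: "x \<in> carrier (val M T)" and t: "t \<in> carrier T"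
  shows "pair T \<phi> (t \<odot>\<^bsub>val M T\<^esub> x) = t \<otimes>\<^bsub>T\<^esub> pair T \<phi> x"
proof (rule additive_eq[OF T T x, of "\<lambda>x. pair T \<phi> (t \<odot>\<^bsub>val M T\<^esub> x)"])
  interpret T: cring T by (rule algebraD(1)[OF T])
  interpret M: module T "val M T" by (rule mod_functor_module[OF M T])
  note [simp] = pair[OF T \<phi>]
  fix x y assume x: "x \<in> carrier (val M T)" and y: "y \<in> carrier (val M T)"
  show "pair T \<phi> (t \<odot>\<^bsub>val M T\<^esub> (x \<oplus>\<^bsub>val M T\<^esub> y)) =
      pair T \<phi> (t \<odot>\<^bsub>val M T\<^esub> x) \<oplus>\<^bsub>T\<^esub> pair T \<phi> (t \<odot>\<^bsub>val M T\<^esub> y)"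
    "t \<otimes>\<^bsub>T\<^esub> pair T \<phi> (x \<oplus>\<^bsub>val M T\<^esub> y) = t \<otimes>\<^bsub>T\<^esub> pair T \<phi> x \<oplus>\<^bsub>T\<^esub> t \<otimes>\<^bsub>T\<^esub> pair T \<phi> y"
    using x y t T by (simp_all add: M.smult_r_distr T.r_distr)
next
  interpret T: cring T by (rule algebraD(1)[OF T])
  fix v s assume "v \<in> carrier V" "s \<in> carrier T"
  then show "pair T \<phi> (t \<odot>\<^bsub>val M T\<^esub> pure T v s) = t \<otimes>\<^bsub>T\<^esub> pair T \<phi> (pure T v s)"
    using T t pair[OF T \<phi>] linear_functionalsD(1)[OF \<phi>] by (simp add: pure_smult T.m_lcomm)
qed (use T t pair[OF T \<phi>] in simp_all)

lemma pair_add_left: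
  assumes T: "algebra K T" and \<phi>: "\<phi> \<in> carrier (val N T)" "\<psi> \<in> carrier (val N T)" and x: "x \<in> carrier (val M T)"
  shows "pair T (\<phi> \<oplus>\<^bsub>val N T\<^esub> \<psi>) x = pair T \<phi> x \<oplus>\<^bsub>T\<^esub> pair T \<psi> x"
proof -
  interpret T: cring T by (rule algebraD(1)[OF T])
  have \<chi>: "\<phi> \<oplus>\<^bsub>val N T\<^esub> \<psi> \<in> carrier (val N T)" using T \<phi> by simp
  show ?thesis
    by (rule additive_eq[OF T T x])
      (use T linear_functionalsD(1)[OF \<phi>(1)] linear_functionalsD(1)[OF \<phi>(2)]
        pair[OF T \<phi>(1)] pair[OF T \<phi>(2)] pair[OF T \<chi>] in
        \<open>simp_all add: T.a_ac T.l_distr\<close>, simp add: linear_functionals_simps T.l_distr)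
qed

lemma pair_smult_left:
  assumes T: "algebra K T" and \<phi>: "\<phi> \<in> carrier (val N T)" and s: "s \<in> carrier T" and x: "x \<in> carrier (val M T)"
  shows "pair T (s \<odot>\<^bsub>val N T\<^esub> \<phi>) x = s \<otimes>\<^bsub>T\<^esub> pair T \<phi> x"
proof -
  interpret T: cring T by (rule algebraD(1)[OF T])
  have \<chi>: "s \<odot>\<^bsub>val N T\<^esub> \<phi> \<in> carrier (val N T)" using T \<phi> s by simp
  show ?thesis
    by (rule additive_eq[OF T T x])
      (use T s linear_functionalsD(1)[OF \<phi>(1)] pair[OF T \<phi>(1)] pair[OF T \<chi>] in
        \<open>simp_all add: T.r_distr\<close>, simp add: linear_functionals_simps T.m_assoc)
qed

lemma pair_natural:
  assumes T: "algebra K T" and \<phi>: "\<phi> \<in> carrier (val N T)" and x: "x \<in> carrier (val M T)"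
    and U: "algebra K U" "p \<in> alg_hom K T U"
  shows "pair U (tr N T U p \<phi>) (tr M T U p x) = p (pair T \<phi> x)"
proof -
  have \<chi>: "tr N T U p \<phi> \<in> carrier (val N U)" using T U \<phi> by simp
  show ?thesis
    by (rule additive_eq[OF T U(1) x])
      (use T U linear_functionalsD(1)[OF \<phi>(1)] pair[OF T \<phi>(1)] pair[OF U(1) \<chi>] alg_hom_closed[OF U(2)] in
        \<open>simp_all add: mod_functor_tr_add[OF M] pure_tr alg_hom_add\<close>, simp add: linear_functionals_simps alg_hom_mult)
qed

definition "\<gamma> = (\<lambda>S. if algebra K S then \<lambda>m\<in>carrier (val M S).
  fam K S (\<lambda>T p. \<lambda>\<phi>\<in>carrier (val N T). pair T \<phi> (tr M S T p m)) else undefined)"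

lemma \<gamma>_apply [simp]:
  "algebra K S \<Longrightarrow> m \<in> carrier (val M S) \<Longrightarrow> algebra K T \<Longrightarrow> p \<in> alg_hom K S T \<Longrightarrow>
    \<phi> \<in> carrier (val N T) \<Longrightarrow> \<gamma> S m T p \<phi> = pair T \<phi> (tr M S T p m)"
  by (simp add: \<gamma>_def)

lemma \<gamma>_closed:
  assumes S: "algebra K S" and m: "m \<in> carrier (val M S)"
  shows "\<gamma> S m \<in> mod_mor_over K S N base_functor"
proof -
  have "fam K S (\<lambda>T p. \<lambda>\<phi>\<in>carrier (val N T). pair T \<phi> (tr M S T p m)) \<in> mod_mor_over K S N base_functor"
  proof (rule mod_mor_overI[OF mod_functor_closed[OF N] S], goal_cases)
    case (2 T U p q \<phi>)
    with S m show ?case using pair_natural[of T \<phi> "tr M S T p m" U q] by simp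
  qed (use S m in \<open>simp_all add: pair pair_add_left pair_smult_left\<close>)
  with S m show ?thesis by (simp add: \<gamma>_def)
qed

lemma \<gamma>_mod_mor: "\<gamma> \<in> mod_mor K M (dual K N)"
proof -
  note dual_closed = closed_functor_hom[OF mod_functor_closed[OF N] mod_functor_base]
  have "\<gamma> S \<in> carrier (val M S) \<rightarrow>\<^sub>E carrier (val (dual K N) S)" if S: "algebra K S" for S
    using S by (auto simp: \<gamma>_closed) (simp add: \<gamma>_def)
  moreover have "\<gamma> S = undefined" if S: "\<not> algebra K S" for S
    using S by (simp add: \<gamma>_def)
  moreover have "\<gamma> T (tr M S T p x) = tr (dual K N) S T p (\<gamma> S x)"
    if S: "algebra K S" "algebra K T" "p \<in> alg_hom K S T" "x \<in> carrier (val M S)" for S T p x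
  proof (rule mod_mor_over_ext)
    show "\<gamma> T (tr M S T p x) \<in> mod_mor_over K T N base_functor"
      "tr (dual K N) S T p (\<gamma> S x) \<in> mod_mor_over K T N base_functor"
      using S by (simp_all add: \<gamma>_closed fam_restrict_mod_mor_over)
  qed (use S in simp)
  moreover have "\<gamma> S (x \<oplus>\<^bsub>val M S\<^esub> y) = \<gamma> S x \<oplus>\<^bsub>val (dual K N) S\<^esub> \<gamma> S y"
    if S: "algebra K S" "x \<in> carrier (val M S)" "y \<in> carrier (val M S)" for S x y
  proof (rule mod_mor_over_ext)
    show "\<gamma> S (x \<oplus>\<^bsub>val M S\<^esub> y) \<in> mod_mor_over K S N base_functor"
      "\<gamma> S x \<oplus>\<^bsub>val (dual K N) S\<^esub> \<gamma> S y \<in> mod_mor_over K S N base_functor"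
      using S closed_functor_add[OF dual_closed S(1)] by (simp_all add: \<gamma>_closed)
  qed (use S in \<open>simp add: mod_functor_tr_add[OF M] pair\<close>)
  moreover have "\<gamma> S (s \<odot>\<^bsub>val M S\<^esub> x) = s \<odot>\<^bsub>val (dual K N) S\<^esub> \<gamma> S x"
    if S: "algebra K S" "s \<in> carrier S" "x \<in> carrier (val M S)" for S s x
  proof (rule mod_mor_over_ext)
    show "\<gamma> S (s \<odot>\<^bsub>val M S\<^esub> x) \<in> mod_mor_over K S N base_functor"
      "s \<odot>\<^bsub>val (dual K N) S\<^esub> \<gamma> S x \<in> mod_mor_over K S N base_functor"
      using S closed_functor_smult[OF dual_closed S(1)] by (simp_all add: \<gamma>_closed)
  qed (use S in \<open>simp add: mod_functor_tr_smult[OF M] pair_smult alg_hom_closed[of _ K S]\<close>)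
  ultimately show ?thesis by (simp add: mod_mor_def set_mor_def linear_maps_def)
qed

text \<open>The functional \<open>v \<mapsto> v \<otimes> 1\<close> with values in the trivial extension \<open>S \<oplus> M(S)\<close> is generic:
  every functional \<open>\<phi>\<close> over an \<open>S\<close>-algebra \<open>U\<close>, multiplied by \<open>\<epsilon>\<close>, is its image under an algebra
  morphism to the dual numbers \<open>U[\<epsilon>]\<close>.  So a form on functionals is determined by its value
  \<open>c + m\<close> at the generic one, and is the evaluation at \<open>m\<close>.\<close>

lemma \<gamma>_bij:
  assumes inf: "infinite (UNIV :: 'u set)" and S: "algebra K S"
  shows "bij_betw (\<gamma> S) (carrier (val M S)) (carrier (val (dual K N) S))"
proof -
  interpret S: cring S by (rule algebraD(1)[OF S])
  interpret MS: module S "val M S" by (rule mod_functor_module[OF M S])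
  obtain T \<iota> j where T: "algebra K T" and \<iota>: "\<iota> \<in> alg_hom K S T"
    and j: "\<And>x. x \<in> carrier (val M S) \<Longrightarrow> j x \<in> carrier T"
    and j_add: "\<And>x y. x \<in> carrier (val M S) \<Longrightarrow> y \<in> carrier (val M S) \<Longrightarrow>
      j (x \<oplus>\<^bsub>val M S\<^esub> y) = j x \<oplus>\<^bsub>T\<^esub> j y"
    and j_smult: "\<And>s x. s \<in> carrier S \<Longrightarrow> x \<in> carrier (val M S) \<Longrightarrow> j (s \<odot>\<^bsub>val M S\<^esub> x) = \<iota> s \<otimes>\<^bsub>T\<^esub> j x"
    and T_add: "\<And>s x t y. s \<in> carrier S \<Longrightarrow> x \<in> carrier (val M S) \<Longrightarrow> t \<in> carrier S \<Longrightarrow> y \<in> carrier (val M S) \<Longrightarrow>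
      (\<iota> s \<oplus>\<^bsub>T\<^esub> j x) \<oplus>\<^bsub>T\<^esub> (\<iota> t \<oplus>\<^bsub>T\<^esub> j y) = \<iota> (s \<oplus>\<^bsub>S\<^esub> t) \<oplus>\<^bsub>T\<^esub> j (x \<oplus>\<^bsub>val M S\<^esub> y)"
    and T_mult: "\<And>s x t y. s \<in> carrier S \<Longrightarrow> x \<in> carrier (val M S) \<Longrightarrow> t \<in> carrier S \<Longrightarrow> y \<in> carrier (val M S) \<Longrightarrow>
      (\<iota> s \<oplus>\<^bsub>T\<^esub> j x) \<otimes>\<^bsub>T\<^esub> (\<iota> t \<oplus>\<^bsub>T\<^esub> j y) =
      \<iota> (s \<otimes>\<^bsub>S\<^esub> t) \<oplus>\<^bsub>T\<^esub> j (s \<odot>\<^bsub>val M S\<^esub> y \<oplus>\<^bsub>val M S\<^esub> t \<odot>\<^bsub>val M S\<^esub> x)"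
    and T_smult: "\<And>k s x. k \<in> carrier K \<Longrightarrow> s \<in> carrier S \<Longrightarrow> x \<in> carrier (val M S) \<Longrightarrow>
      k \<odot>\<^bsub>T\<^esub> (\<iota> s \<oplus>\<^bsub>T\<^esub> j x) = \<iota> (k \<odot>\<^bsub>S\<^esub> s) \<oplus>\<^bsub>T\<^esub> j ((k \<odot>\<^bsub>S\<^esub> \<one>\<^bsub>S\<^esub>) \<odot>\<^bsub>val M S\<^esub> x)"
    and T_ex: "\<And>t. t \<in> carrier T \<Longrightarrow> \<exists>s\<in>carrier S. \<exists>x\<in>carrier (val M S). t = \<iota> s \<oplus>\<^bsub>T\<^esub> j x"
    and T_inj: "\<And>s x s' x'. s \<in> carrier S \<Longrightarrow> x \<in> carrier (val M S) \<Longrightarrow> s' \<in> carrier S \<Longrightarrow>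
      x' \<in> carrier (val M S) \<Longrightarrow> \<iota> s \<oplus>\<^bsub>T\<^esub> j x = \<iota> s' \<oplus>\<^bsub>T\<^esub> j x' \<Longrightarrow> s = s' \<and> x = x'"
    by (rule trivial_extension[OF inf S mod_functor_module[OF M S] carrier_lepoll[OF inf S]]) blast
  interpret T: cring T by (rule algebraD(1)[OF T])
  note \<iota>_closed = alg_hom_closed[OF \<iota>]
  define e where "e = (\<lambda>v\<in>carrier V. j (pure S v \<one>\<^bsub>S\<^esub>))"
  have k_smult: "k \<odot>\<^bsub>T\<^esub> j x = j ((k \<odot>\<^bsub>S\<^esub> \<one>\<^bsub>S\<^esub>) \<odot>\<^bsub>val M S\<^esub> x)" if "k \<in> carrier K" "x \<in> carrier (val M S)" for k x
  proof -
    have "j ((k \<odot>\<^bsub>S\<^esub> \<one>\<^bsub>S\<^esub>) \<odot>\<^bsub>val M S\<^esub> x) = (k \<odot>\<^bsub>T\<^esub> \<one>\<^bsub>T\<^esub>) \<otimes>\<^bsub>T\<^esub> j x"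
      using that S by (simp add: j_smult alg_hom_smult[OF \<iota>] alg_hom_one[OF \<iota>])
    then show ?thesis using that j[of x] by (simp add: algebra_smult_mult(1)[OF T])
  qed
  have e: "e \<in> carrier (val N T)"
    unfolding linear_functionals_carrier
  proof (intro conjI ballI)
    fix k v assume k: "k \<in> carrier K" "v \<in> carrier V"
    then show "e (k \<odot>\<^bsub>V\<^esub> v) = k \<odot>\<^bsub>T\<^esub> e v"
      using S by (simp add: e_def k_smult pure_smult pure_balanced)
  qed (use S in \<open>auto simp: e_def j pure_add_left j_add\<close>)
  have pair_e: "pair T e (tr M S T \<iota> m) = j m" if m: "m \<in> carrier (val M S)" for m
  proof (rule additive_eq[OF S T m])
    fix v s assume v: "v \<in> carrier V" "s \<in> carrier S"
    have "j (pure S v s) = j (s \<odot>\<^bsub>val M S\<^esub> pure S v \<one>\<^bsub>S\<^esub>)" using v S by (simp add: pure_smult)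
    also have "\<dots> = e v \<otimes>\<^bsub>T\<^esub> \<iota> s" using v S j[of "pure S v \<one>\<^bsub>S\<^esub>"] \<iota>_closed by (simp add: j_smult e_def T.m_comm)
    finally show "pair T e (tr M S T \<iota> (pure S v s)) = j (pure S v s)"
      using v S T \<iota> \<iota>_closed by (simp add: pure_tr pair[OF T e])
  qed (use S T \<iota> in \<open>simp_all add: j j_add mod_functor_tr_add[OF M] pair[OF T e]\<close>)
  have "inj_on (\<gamma> S) (carrier (val M S))"
  proof (rule inj_onI)
    fix m m' assume m: "m \<in> carrier (val M S)" "m' \<in> carrier (val M S)" "\<gamma> S m = \<gamma> S m'"
    have "\<gamma> S m T \<iota> e = \<gamma> S m' T \<iota> e" using m by simp
    then have "j m = j m'" using S T \<iota> e m(1,2) by (simp add: pair_e)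
    then show "m = m'" using T_inj[of "\<zero>\<^bsub>S\<^esub>" m "\<zero>\<^bsub>S\<^esub>" m'] m by simp
  qed
  moreover have "\<exists>m\<in>carrier (val M S). w = \<gamma> S m" if w: "w \<in> mod_mor_over K S N base_functor" for w
  proof -
    have "w T \<iota> e \<in> carrier T" using mod_mor_over_closed[OF w T \<iota> e] by simp
    then obtain c m where c: "c \<in> carrier S" and m: "m \<in> carrier (val M S)" and wTe: "w T \<iota> e = \<iota> c \<oplus>\<^bsub>T\<^esub> j m"
      using T_ex by blast
    have "w = \<gamma> S m"
    proof (rule mod_mor_over_ext[OF w \<gamma>_closed[OF S m]])
      fix U p \<phi> assume U: "algebra K U" and p: "p \<in> alg_hom K S U" and \<phi>: "\<phi> \<in> carrier (val N U)"
      interpret U: cring U by (rule algebraD(1)[OF U])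
      have small: "carrier (val base_functor U) \<lesssim> (UNIV :: 'u set)" by (simp add: subset_imp_lepoll)
      obtain D \<kappa> \<epsilon> where D: "algebra K D" and \<kappa>: "\<kappa> \<in> alg_hom K U D"
        and \<epsilon>: "\<And>x. x \<in> carrier U \<Longrightarrow> \<epsilon> x \<in> carrier D"
        and \<epsilon>_add: "\<And>x y. x \<in> carrier U \<Longrightarrow> y \<in> carrier U \<Longrightarrow> \<epsilon> (x \<oplus>\<^bsub>U\<^esub> y) = \<epsilon> x \<oplus>\<^bsub>D\<^esub> \<epsilon> y"
        and \<epsilon>_smult: "\<And>s x. s \<in> carrier U \<Longrightarrow> x \<in> carrier U \<Longrightarrow> \<epsilon> (s \<otimes>\<^bsub>U\<^esub> x) = \<kappa> s \<otimes>\<^bsub>D\<^esub> \<epsilon> x"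
    and D_add: "\<And>s x t y. s \<in> carrier U \<Longrightarrow> x \<in> carrier U \<Longrightarrow> t \<in> carrier U \<Longrightarrow> y \<in> carrier U \<Longrightarrow>
      (\<kappa> s \<oplus>\<^bsub>D\<^esub> \<epsilon> x) \<oplus>\<^bsub>D\<^esub> (\<kappa> t \<oplus>\<^bsub>D\<^esub> \<epsilon> y) = \<kappa> (s \<oplus>\<^bsub>U\<^esub> t) \<oplus>\<^bsub>D\<^esub> \<epsilon> (x \<oplus>\<^bsub>U\<^esub> y)"
    and D_mult: "\<And>s x t y. s \<in> carrier U \<Longrightarrow> x \<in> carrier U \<Longrightarrow> t \<in> carrier U \<Longrightarrow> y \<in> carrier U \<Longrightarrow>
      (\<kappa> s \<oplus>\<^bsub>D\<^esub> \<epsilon> x) \<otimes>\<^bsub>D\<^esub> (\<kappa> t \<oplus>\<^bsub>D\<^esub> \<epsilon> y) =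
      \<kappa> (s \<otimes>\<^bsub>U\<^esub> t) \<oplus>\<^bsub>D\<^esub> \<epsilon> (s \<otimes>\<^bsub>U\<^esub> y \<oplus>\<^bsub>U\<^esub> t \<otimes>\<^bsub>U\<^esub> x)"
    and D_smult: "\<And>k s x. k \<in> carrier K \<Longrightarrow> s \<in> carrier U \<Longrightarrow> x \<in> carrier U \<Longrightarrow>
      k \<odot>\<^bsub>D\<^esub> (\<kappa> s \<oplus>\<^bsub>D\<^esub> \<epsilon> x) = \<kappa> (k \<odot>\<^bsub>U\<^esub> s) \<oplus>\<^bsub>D\<^esub> \<epsilon> ((k \<odot>\<^bsub>U\<^esub> \<one>\<^bsub>U\<^esub>) \<otimes>\<^bsub>U\<^esub> x)"
        and D_inj: "\<And>s x s' x'. s \<in> carrier U \<Longrightarrow> x \<in> carrier U \<Longrightarrow> s' \<in> carrier U \<Longrightarrow>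
          x' \<in> carrier U \<Longrightarrow> \<kappa> s \<oplus>\<^bsub>D\<^esub> \<epsilon> x = \<kappa> s' \<oplus>\<^bsub>D\<^esub> \<epsilon> x' \<Longrightarrow> s = s' \<and> x = x'"
      proof (rule trivial_extension[OF inf U mod_functor_module[OF mod_functor_base U] small], goal_cases)
        case (1 D \<kappa> \<epsilon>)
        note f = 1[unfolded base_functor_simps]
        show thesis by (rule that) (fact f)+
      qed
      interpret D: cring D by (rule algebraD(1)[OF D])
      note \<kappa>_closed = alg_hom_closed[OF \<kappa>]
      define P where "P x = pair U \<phi> (tr M S U p x)" for x
      have P: "P x \<in> carrier U" if "x \<in> carrier (val M S)" for x
        using that S U p by (simp add: P_def pair[OF U \<phi>])
      have P_add: "P (x \<oplus>\<^bsub>val M S\<^esub> y) = P x \<oplus>\<^bsub>U\<^esub> P y"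
        if "x \<in> carrier (val M S)" "y \<in> carrier (val M S)" for x y
        using that S U p by (simp add: P_def pair[OF U \<phi>] mod_functor_tr_add[OF M])
      have P_smult: "P (s \<odot>\<^bsub>val M S\<^esub> x) = p s \<otimes>\<^bsub>U\<^esub> P x" if "x \<in> carrier (val M S)" "s \<in> carrier S" for x s
        using that S U p alg_hom_closed[OF p] by (simp add: P_def mod_functor_tr_smult[OF M] pair_smult[OF U \<phi>])
      define a where "a t = (SOME (s, x). s \<in> carrier S \<and> x \<in> carrier (val M S) \<and> t = \<iota> s \<oplus>\<^bsub>T\<^esub> j x)" for t
      have a: "a (\<iota> s \<oplus>\<^bsub>T\<^esub> j x) = (s, x)" if "s \<in> carrier S" "x \<in> carrier (val M S)" for s x
        unfolding a_def by (rule some_equality) (use that T_inj in auto)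
      define h where "h = (\<lambda>t\<in>carrier T. case a t of (s, x) \<Rightarrow> \<kappa> (p s) \<oplus>\<^bsub>D\<^esub> \<epsilon> (P x))"
      have h: "h (\<iota> s \<oplus>\<^bsub>T\<^esub> j x) = \<kappa> (p s) \<oplus>\<^bsub>D\<^esub> \<epsilon> (P x)" if "s \<in> carrier S" "x \<in> carrier (val M S)" for s x
        using that \<iota>_closed j by (simp add: h_def a)
      have \<epsilon>0: "\<epsilon> \<zero>\<^bsub>U\<^esub> = \<zero>\<^bsub>D\<^esub>"
        using \<epsilon>_smult[of "\<zero>\<^bsub>U\<^esub>" "\<zero>\<^bsub>U\<^esub>"] \<epsilon>_add[of "\<zero>\<^bsub>U\<^esub>" "\<zero>\<^bsub>U\<^esub>"] \<epsilon>[of "\<zero>\<^bsub>U\<^esub>"] D.add.r_cancel_one' by simp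
      have P0: "P \<zero>\<^bsub>val M S\<^esub> = \<zero>\<^bsub>U\<^esub>"
        by (intro additive_zero[OF S U] P P_add zero_M S)
      have j0: "j \<zero>\<^bsub>val M S\<^esub> = \<zero>\<^bsub>T\<^esub>"
        by (intro additive_zero[OF S T] j j_add zero_M S)
      have h_\<iota>: "h (\<iota> s) = \<kappa> (p s)" if "s \<in> carrier S" for s
        using h[of s "\<zero>\<^bsub>val M S\<^esub>"] that S \<iota>_closed \<kappa>_closed alg_hom_closed[OF p] by (simp add: j0 P0 \<epsilon>0)
      have h_j: "h (j x) = \<epsilon> (P x)" if "x \<in> carrier (val M S)" for x
        using h[of "\<zero>\<^bsub>S\<^esub>" x] that j[OF that] P[OF that] \<epsilon>
        by (simp add: alg_hom_zero[OF S T \<iota>] alg_hom_zero[OF S U p] alg_hom_zero[OF U D \<kappa>])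
      have p_closed: "p s \<in> carrier U" if "s \<in> carrier S" for s by (rule alg_hom_closed[OF p that])
      have h_hom: "h \<in> alg_hom K T D"
        unfolding alg_hom_def
      proof (intro CollectI IntI conjI ballI ring_hom_memI)
        show "h \<one>\<^bsub>T\<^esub> = \<one>\<^bsub>D\<^esub>"
          using h_\<iota>[of "\<one>\<^bsub>S\<^esub>"] by (simp add: alg_hom_one[OF \<iota>] alg_hom_one[OF \<kappa>] alg_hom_one[OF p])
        show "h \<in> extensional (carrier T)" by (simp add: h_def)
        show "h t \<in> carrier D" if "t \<in> carrier T" for t
          using T_ex[OF that] D h P p_closed \<kappa>_closed \<epsilon> by auto
        fix t assume "t \<in> carrier T"
        then obtain s x where t: "t = \<iota> s \<oplus>\<^bsub>T\<^esub> j x" and s: "s \<in> carrier S" and x: "x \<in> carrier (val M S)"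
          using T_ex by blast
        show "h (k \<odot>\<^bsub>T\<^esub> t) = k \<odot>\<^bsub>D\<^esub> h t" if k: "k \<in> carrier K" for k
          using k s x S P P_add P_smult p_closed
          by (simp add: t h T_smult D_smult alg_hom_smult[OF p] alg_hom_one[OF p])
        fix t' assume "t' \<in> carrier T"
        then obtain s' x' where t': "t' = \<iota> s' \<oplus>\<^bsub>T\<^esub> j x'" and s': "s' \<in> carrier S" and x': "x' \<in> carrier (val M S)"
          using T_ex by blast
        show "h (t \<oplus>\<^bsub>T\<^esub> t') = h t \<oplus>\<^bsub>D\<^esub> h t'"
          using s x s' x' S P P_add P_smult p_closed by (simp add: t t' h T_add D_add alg_hom_add[OF p])
        show "h (t \<otimes>\<^bsub>T\<^esub> t') = h t \<otimes>\<^bsub>D\<^esub> h t'"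
          using s x s' x' S P P_add P_smult p_closed by (simp add: t t' h T_mult D_mult alg_hom_mult[OF p])
      qed
      have h\<iota>: "compose (carrier S) h \<iota> = compose (carrier S) \<kappa> p"
        by (auto simp: compose_def h_\<iota> fun_eq_iff)
      let ?\<kappa>\<phi> = "tr N U D \<kappa> \<phi>"
      have he: "tr N T D h e = \<epsilon> \<one>\<^bsub>U\<^esub> \<odot>\<^bsub>val N D\<^esub> ?\<kappa>\<phi>"
      proof (rule extensionalityI[of _ "carrier V"])
        fix v assume v: "v \<in> carrier V"
        have "P (pure S v \<one>\<^bsub>S\<^esub>) = \<phi> v"
          using v S U p linear_functionalsD(1)[OF \<phi> v] by (simp add: P_def pure_tr alg_hom_one[OF p] pair[OF U \<phi>])
        moreover have "\<epsilon> (\<phi> v) = \<epsilon> \<one>\<^bsub>U\<^esub> \<otimes>\<^bsub>D\<^esub> \<kappa> (\<phi> v)"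
          using \<epsilon>_smult[of "\<phi> v" "\<one>\<^bsub>U\<^esub>"] linear_functionalsD(1)[OF \<phi> v] \<epsilon>[of "\<one>\<^bsub>U\<^esub>"] \<kappa>_closed by (simp add: D.m_comm)
        ultimately show "tr N T D h e v = (\<epsilon> \<one>\<^bsub>U\<^esub> \<odot>\<^bsub>val N D\<^esub> ?\<kappa>\<phi>) v"
          using v S by (simp add: linear_functionals_simps e_def h_j)
      qed (simp_all add: linear_functionals_simps)
      have wU: "w U p \<phi> \<in> carrier U" using mod_mor_over_closed[OF w U p \<phi>] by simp
      have "h (w T \<iota> e) = w D (compose (carrier S) \<kappa> p) (tr N T D h e)"
        using mod_mor_over_natural[OF w T D \<iota> h_hom e] by (simp add: h\<iota>)
      also have "\<dots> = \<epsilon> \<one>\<^bsub>U\<^esub> \<otimes>\<^bsub>D\<^esub> w D (compose (carrier S) \<kappa> p) ?\<kappa>\<phi>"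
        using mod_mor_over_smult[OF w D, of "compose (carrier S) \<kappa> p" "\<epsilon> \<one>\<^bsub>U\<^esub>" ?\<kappa>\<phi>] S U D p \<kappa> \<phi> \<epsilon>
        by (simp add: he)
      also have "\<dots> = \<epsilon> \<one>\<^bsub>U\<^esub> \<otimes>\<^bsub>D\<^esub> \<kappa> (w U p \<phi>)"
        using mod_mor_over_natural[OF w U D p \<kappa> \<phi>] by simp
      also have "\<dots> = \<epsilon> (w U p \<phi>)"
        using \<epsilon>_smult[of "w U p \<phi>" "\<one>\<^bsub>U\<^esub>"] \<epsilon>[of "\<one>\<^bsub>U\<^esub>"] wU \<kappa>_closed[OF wU] by (simp add: D.m_comm)
      finally have "\<kappa> (p c) \<oplus>\<^bsub>D\<^esub> \<epsilon> (P m) = \<kappa> \<zero>\<^bsub>U\<^esub> \<oplus>\<^bsub>D\<^esub> \<epsilon> (w U p \<phi>)"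
        using wU \<epsilon> c m by (simp add: wTe h alg_hom_zero[OF U D \<kappa>])
      then have "P m = w U p \<phi>"
        using D_inj[of "p c" "P m" "\<zero>\<^bsub>U\<^esub>" "w U p \<phi>"] alg_hom_closed[OF p c] P[OF m] wU by simp
      then show "w U p \<phi> = \<gamma> S m U p \<phi>"
        using S U p \<phi> m by (simp add: P_def)
    qed
    then show ?thesis using m by blast
  qed
  ultimately show ?thesis
    using \<gamma>_closed[OF S] by (auto simp: bij_betw_def)
qed

end

lemma quasi_coherent_dual_functor:
  fixes K :: "'u ring" and M :: "('u, 'm) modfunctor"
  assumes inf: "infinite (UNIV :: 'u set)" and M: "quasi_coherent K M"
  shows "dual_functor TYPE('u \<Rightarrow> 'u) K M"
proof -
  obtain V :: "('u, 'u) module" and \<beta> where *: "mod_functor K M" "module K V" "\<beta> \<in> mod_iso K M (quasi_coherent_module K V)"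
    using M by (auto simp: quasi_coherent_def)
  interpret quasi_coherent_functor K M V \<beta> by (rule quasi_coherent_functor.intro[OF *])
  have "\<gamma> \<in> mod_iso K M (dual K N)"
    using \<gamma>_mod_mor \<gamma>_bij[OF inf] by (simp add: mod_iso_def)
  then show ?thesis using N *(1) by (auto simp: dual_functor_def)
qed

theorem theorem0p5:
  fixes K :: "'u ring" and G :: "('u, 'g) monfunctor"
  assumes "infinite (UNIV :: 'u set)"
    and "field K"
    and "monoid_functor K G"
    and "reflexive K (fun_functor K G)"
  shows "is_equivalence
           (dual_A_modules TYPE('n) K (dist_algebra K G) ::
              (('u, _, 'm) rep, 'u alg \<Rightarrow> 'm \<Rightarrow> 'm) cat)
           (dual_G_modules TYPE('n) K G)
           (restriction_functor K G) \<and>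
         is_equivalence
           (quasi_coherent_A_modules K (dist_algebra K G) ::
              (('u, _, 'm) rep, 'u alg \<Rightarrow> 'm \<Rightarrow> 'm) cat)
           (quasi_coherent_G_modules K G)
           (restriction_functor K G)"
proof
  interpret monoid_kfunctor K G by unfold_locales (rule assms(3))
  note ext = extends_dual[OF set_functor_G assms(4)]
  show "is_equivalence
           (dual_A_modules TYPE('n) K (dist_algebra K G) ::
              (('u, _, 'm) rep, 'u alg \<Rightarrow> 'm \<Rightarrow> 'm) cat)
           (dual_G_modules TYPE('n) K G)
           (restriction_functor K G)"
    unfolding dual_A_modules_def dual_G_modules_def
    by (rule is_equivalence_restriction) (rule ext)
  show "is_equivalence
           (quasi_coherent_A_modules K (dist_algebra K G) ::
              (('u, _, 'm) rep, 'u alg \<Rightarrow> 'm \<Rightarrow> 'm) cat)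
           (quasi_coherent_G_modules K G)
           (restriction_functor K G)"
    unfolding quasi_coherent_A_modules_def quasi_coherent_G_modules_def
    by (rule is_equivalence_restriction) (rule ext[OF quasi_coherent_dual_functor[OF assms(1)]])
qed

end
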